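(* Let $2<p<6$, $2<q<4$ and $q<\frac p2+1$. Let $\mathcal{G}$ be a non-compact metric graph with at least $3$ half-lines and at least one vertex of degree $2$, such that every point of $\mathcal{G}$ lies on a trail that contains two half-lines. Then there exist $\underline{\mu}_{p,q}>0$ and $\widetilde{\mu}_{p,q}>0$, depending on $p,q,\mathcal{G}$, such that ground states of $F_{p,q}$ at mass $\mu$ on $\mathcal{G}$ exist both if $\mu<\underline{\mu}_{p,q}$ and if $\mu\ge\widetilde{\mu}_{p,q}$.
   Context: A metric graph $\mathcal{G}=(V,E)$ is connected, has finite vertex set $V$ and finite edge set $E$ (loops and multiple edges allowed); each bounded edge is identified with a compact interval of positive length, each unbounded edge (half-line) with $[0,+\infty)$, whose origin is a vertex (points at infinity are not vertices). $\mathcal{G}$ is non-compact if it has at least one half-line. The degree of a vertex is the number of edge-ends at it (a loop counts twice). A trail is a connected path in $\mathcal{G}$ in which every edge of the path is run through exactly once. $H^1(\mathcal{G})$ is the space of continuous functions on $\mathcal{G}$ with $\int_{\mathcal G}(|u'|^2+|u|^2)\,dx<\infty$ (weak derivative on each edge), and $H^1_\mu(\mathcal{G})=\{u\in H^1(\mathcal{G}):\|u\|_{L^2(\mathcal{G})}^2=\mu\}$ for $\mu>0$. $F_{p,q}(u,\mathcal{G})=\frac12\int_{\mathcal{G}}|u'|^2dx-\frac1p\int_{\mathcal{G}}|u|^pdx-\frac1q\sum_{v\in V}|u(v)|^q$. A ground state of $F_{p,q}$ at mass $\mu$ (where $\mu>0$) on $\mathcal{G}$ is a function $u\in H^1_\mu(\mathcal{G})$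 with $F_{p,q}(u,\mathcal{G})=\inf_{w\in H^1_\mu(\mathcal{G})}F_{p,q}(w,\mathcal{G})$. *)

theory Defs
  imports "HOL-Analysis.Analysis"
begin

section \<open>Metric graphs\<close>

text \<open>Every edge carries an arbitrary orientation. An edge \<open>e\<close> with \<open>len e = \<infinity>\<close> is a half-line
  with origin \<open>src e\<close>; the value \<open>tgt e\<close> is then never used, since points at infinity are
  not vertices.\<close>

record ('v, 'e) metric_graph =
  verts :: "'v set"
  edges :: "'e set"
  src :: "'e \<Rightarrow> 'v"
  tgt :: "'e \<Rightarrow> 'v"
  len :: "'e \<Rightarrow> ereal"

definition half_lines :: "('v, 'e) metric_graph \<Rightarrow> 'e set" where
  "half_lines G = {e \<in> edges G. len G e = \<infinity>}"

definition bounded_edges :: "('v, 'e) metric_graph \<Rightarrow> 'e set" where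
  "bounded_edges G = {e \<in> edges G. len G e \<noteq> \<infinity>}"

text \<open>Half-lines are attached at a single vertex, so connectedness of the graph only involves
  the bounded edges.\<close>

definition adjacency :: "('v, 'e) metric_graph \<Rightarrow> ('v \<times> 'v) set" where
  "adjacency G = (\<Union>e\<in>bounded_edges G. {(src G e, tgt G e), (tgt G e, src G e)})"

definition is_metric_graph :: "('v, 'e) metric_graph \<Rightarrow> bool" where
  "is_metric_graph G \<longleftrightarrow>
     finite (verts G) \<and> verts G \<noteq> {} \<and> finite (edges G) \<and>
     (\<forall>e\<in>edges G. src G e \<in> verts G \<and> len G e > 0) \<and>
     (\<forall>e\<in>bounded_edges G. tgt G e \<in> verts G) \<and>
     (\<forall>v\<in>verts G. \<forall>w\<in>verts G. (v, w) \<in> (adjacency G)\<^sup>*)"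

definition noncompact :: "('v, 'e) metric_graph \<Rightarrow> bool" where
  "noncompact G \<longleftrightarrow> half_lines G \<noteq> {}"

definition vertex_degree :: "('v, 'e) metric_graph \<Rightarrow> 'v \<Rightarrow> nat" where
  "vertex_degree G v =
     card {e \<in> edges G. src G e = v} + card {e \<in> bounded_edges G. tgt G e = v}"

subsection \<open>Points\<close>

datatype ('v, 'e) point = Vertex 'v | Inner 'e real

definition edge_dom :: "('v, 'e) metric_graph \<Rightarrow> 'e \<Rightarrow> real set" where
  "edge_dom G e = {x. 0 \<le> x \<and> ereal x \<le> len G e}"

definition edge_interior :: "('v, 'e) metric_graph \<Rightarrow> 'e \<Rightarrow> real set" where
  "edge_interior G e = {x. 0 < x \<and> ereal x < len G e}"

text \<open>The identification of \<open>[0, len e]\<close>, respectively \<open>[0, \<infinity>)\<close>, with the edge \<open>e\<close>; its end points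
  are glued to the vertices.\<close>

definition chart :: "('v, 'e) metric_graph \<Rightarrow> 'e \<Rightarrow> real \<Rightarrow> ('v, 'e) point" where
  "chart G e x =
     (if x = 0 then Vertex (src G e)
      else if ereal x = len G e then Vertex (tgt G e)
      else Inner e x)"

definition points :: "('v, 'e) metric_graph \<Rightarrow> ('v, 'e) point set" where
  "points G = Vertex ` verts G \<union> (\<Union>e\<in>edges G. chart G e ` edge_dom G e)"

subsection \<open>Trails\<close>

text \<open>A step \<open>(e, b)\<close> runs through the whole edge \<open>e\<close>, along its orientation iff \<open>b\<close> holds.
  \<open>None\<close> stands for the point at infinity of a half-line; a path cannot be continued through it.\<close>

definition step_start :: "('v, 'e) metric_graph \<Rightarrow> 'e \<times> bool \<Rightarrow> 'v option" where
  "step_start G = (\<lambda>(e, b).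
     if b then Some (src G e) else if len G e = \<infinity> then None else Some (tgt G e))"

definition step_end :: "('v, 'e) metric_graph \<Rightarrow> 'e \<times> bool \<Rightarrow> 'v option" where
  "step_end G = (\<lambda>(e, b).
     if b then (if len G e = \<infinity> then None else Some (tgt G e)) else Some (src G e))"

definition trail :: "('v, 'e) metric_graph \<Rightarrow> ('e \<times> bool) list \<Rightarrow> bool" where
  "trail G T \<longleftrightarrow>
     T \<noteq> [] \<and> fst ` set T \<subseteq> edges G \<and> distinct (map fst T) \<and>
     successively (\<lambda>s t. step_end G s \<noteq> None \<and> step_end G s = step_start G t) T"

definition trail_points :: "('v, 'e) metric_graph \<Rightarrow> ('e \<times> bool) list \<Rightarrow> ('v, 'e) point set" where
  "trail_points G T = (\<Union>e\<in>fst ` set T. chart G e ` edge_dom G e)"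

definition contains_two_half_lines :: "('v, 'e) metric_graph \<Rightarrow> ('e \<times> bool) list \<Rightarrow> bool" where
  "contains_two_half_lines G T \<longleftrightarrow>
     (\<exists>h\<in>half_lines G. \<exists>k\<in>half_lines G. h \<noteq> k \<and> h \<in> fst ` set T \<and> k \<in> fst ` set T)"

section \<open>Sobolev functions on a metric graph\<close>

text \<open>\<open>C\<^sup>1\<close> functions with compact support in the open set \<open>I\<close>, together with their derivative.\<close>

definition test_fun :: "real set \<Rightarrow> (real \<Rightarrow> real) \<Rightarrow> (real \<Rightarrow> real) \<Rightarrow> bool" where
  "test_fun I \<phi> \<phi>' \<longleftrightarrow>
     (\<forall>x. (\<phi> has_real_derivative \<phi>' x) (at x)) \<and> continuous_on UNIV \<phi>' \<and>
     compact (closure {x. \<phi> x \<noteq> 0}) \<and> closure {x. \<phi> x \<noteq> 0} \<subseteq> I"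

definition locally_integrable :: "real set \<Rightarrow> (real \<Rightarrow> real) \<Rightarrow> bool" where
  "locally_integrable I f \<longleftrightarrow> (\<forall>a b. {a..b} \<subseteq> I \<longrightarrow> set_integrable lborel {a..b} f)"

text \<open>Weak derivative on an open interval, tested against \<open>C\<^sup>1\<close> functions of compact support
  (on an interval this is the same as testing against smooth ones).\<close>

definition is_weak_deriv :: "real set \<Rightarrow> (real \<Rightarrow> real) \<Rightarrow> (real \<Rightarrow> real) \<Rightarrow> bool" where
  "is_weak_deriv I f g \<longleftrightarrow>
     locally_integrable I f \<and> locally_integrable I g \<and>
     (\<forall>\<phi> \<phi>'. test_fun I \<phi> \<phi>' \<longrightarrow>
        (LINT x:I|lborel. f x * \<phi>' x) = - (LINT x:I|lborel. g x * \<phi> x))"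

definition on_edge ::
  "('v, 'e) metric_graph \<Rightarrow> (('v, 'e) point \<Rightarrow> real) \<Rightarrow> 'e \<Rightarrow> real \<Rightarrow> real" where
  "on_edge G u e x = u (chart G e x)"

text \<open>Some representative of the weak derivative on \<open>e\<close>; it is unique almost everywhere, and only
  integrals of it are used.\<close>

definition edge_deriv ::
  "('v, 'e) metric_graph \<Rightarrow> (('v, 'e) point \<Rightarrow> real) \<Rightarrow> 'e \<Rightarrow> real \<Rightarrow> real" where
  "edge_deriv G u e = (SOME g. is_weak_deriv (edge_interior G e) (on_edge G u e) g)"

text \<open>The graph is the quotient of finitely many closed edges, so a function on it is continuous iff
  it is continuous in every chart; agreement at the vertices is built into the charts.\<close>

definition continuous_on_graph ::
  "('v, 'e) metric_graph \<Rightarrow> (('v, 'e) point \<Rightarrow> real) \<Rightarrow> bool" where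
  "continuous_on_graph G u \<longleftrightarrow> (\<forall>e\<in>edges G. continuous_on (edge_dom G e) (on_edge G u e))"

text \<open>Values of \<open>u\<close> outside \<open>points G\<close> are irrelevant.\<close>

definition H1 :: "('v, 'e) metric_graph \<Rightarrow> (('v, 'e) point \<Rightarrow> real) set" where
  "H1 G = {u. continuous_on_graph G u \<and>
     (\<forall>e\<in>edges G. (\<exists>g. is_weak_deriv (edge_interior G e) (on_edge G u e) g) \<and>
        set_integrable lborel (edge_dom G e)
          (\<lambda>x. \<bar>edge_deriv G u e x\<bar>\<^sup>2 + \<bar>on_edge G u e x\<bar>\<^sup>2))}"

definition graph_integral ::
  "('v, 'e) metric_graph \<Rightarrow> ('e \<Rightarrow> real \<Rightarrow> real) \<Rightarrow> real" where
  "graph_integral G f = (\<Sum>e\<in>edges G. LINT x:edge_dom G e|lborel. f e x)"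

definition H1_mass :: "('v, 'e) metric_graph \<Rightarrow> real \<Rightarrow> (('v, 'e) point \<Rightarrow> real) set" where
  "H1_mass G \<mu> = {u \<in> H1 G. graph_integral G (\<lambda>e x. \<bar>on_edge G u e x\<bar>\<^sup>2) = \<mu>}"

definition energy ::
  "real \<Rightarrow> real \<Rightarrow> ('v, 'e) metric_graph \<Rightarrow> (('v, 'e) point \<Rightarrow> real) \<Rightarrow> real" where
  "energy p q G u =
     1 / 2 * graph_integral G (\<lambda>e x. \<bar>edge_deriv G u e x\<bar>\<^sup>2)
     - 1 / p * graph_integral G (\<lambda>e x. \<bar>on_edge G u e x\<bar> powr p)
     - 1 / q * (\<Sum>v\<in>verts G. \<bar>u (Vertex v)\<bar> powr q)"

text \<open>The infimum is taken in the extended reals, as the energy need not be bounded below for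
  arbitrary exponents.\<close>

definition ground_state ::
  "real \<Rightarrow> real \<Rightarrow> ('v, 'e) metric_graph \<Rightarrow> real \<Rightarrow> (('v, 'e) point \<Rightarrow> real) \<Rightarrow> bool" where
  "ground_state p q G \<mu> u \<longleftrightarrow>
     u \<in> H1_mass G \<mu> \<and> ereal (energy p q G u) = (INF w\<in>H1_mass G \<mu>. ereal (energy p q G w))"

end

theory Submission
  imports Defs "HOL-Complex_Analysis.Great_Picard" "HOL-Real_Asymp.Real_Asymp"
begin

text \<open>A minimizing sequence is bounded in \<open>H\<^sup>1\<close> and converges pointwise along a subsequence. Cut every
  half-line at a large point: the inner part is lower semicontinuous, while the energy of the outer
  part is bounded below by the energy level of the real line at the escaping mass. Since
  \<open>F (c u) \<le> c\<^sup>2 F u\<close> for \<open>c \<ge> 1\<close>, no mass escapes as soon as some competitor has energy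
  below the level \<open>e\<close> of the real line at the full mass.

  The level of the real line is handled by calibration. With \<open>M = max \<bar>u\<bar>\<close> and
  \<open>W s = (2/p) (M\<^sup>p\<^sup>-\<^sup>2 s\<^sup>2 - \<bar>s\<bar>\<^sup>p) \<ge> 0\<close> on \<open>[-M, M]\<close>, one has
  \<open>\<integral> (u'\<^sup>2 + W u) / 2 \<ge> \<integral> \<bar>u'\<bar> sqrt (W u) \<ge> 2 \<integral>\<^sub>0\<^sup>M sqrt W\<close>, which bounds the energy at mass \<open>\<mu>\<close> below by
  \<open>A M\<^sup>p\<^sup>/\<^sup>2\<^sup>+\<^sup>1 - (\<mu>/p) M\<^sup>p\<^sup>-\<^sup>2\<close>; the minimum over \<open>M\<close> is attained by the soliton, and it is at least
  \<open>- C \<mu>\<^sup>\<alpha>\<close> with \<open>\<alpha> = (p + 2) / (6 - p)\<close>.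

  For small \<open>\<mu>\<close> a function that is constant on the compact core and decays like \<open>exp (- a x)\<close> on the
  half-lines has energy at most \<open>- k \<mu>\<^sup>\<beta>\<close> with \<open>\<beta> = q / (4 - q)\<close>, and \<open>q < p/2 + 1\<close> is exactly
  \<open>\<beta> < \<alpha>\<close>. For large \<open>\<mu>\<close> a soliton truncated to the two edge-ends at a vertex of degree 2 loses only
  an exponentially small energy but gains the vertex term.\<close>

section \<open>Absolutely continuous functions\<close>

text \<open>The order of two limits makes the cut work: at a fixed cut \<open>k\<close> the
  minimizing sequence is replaced by its limit \<open>F\<close>, and only then \<open>k\<close>
  tends to infinity. The boundary error of the calibration, quadratic in the value at the cut, is
  thus taken at \<open>F\<close>, which vanishes at infinity, and not at the sequence, whose mass
  may sit there. With \<open>m\<close> the mass of \<open>F\<close> and \<open>I\<close> the infimum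
  this gives \<open>energy F + (1 - m / \<mu>) * e \<le> I\<close>, while scaling gives
  \<open>m / \<mu> * I \<le> energy F\<close>; together they contradict \<open>I < e\<close> unless
  \<open>m = \<mu>\<close>.

  The weight \<open>W\<close> comes from the soliton, whose first integral says that the square of
  \<open>u'\<close> is \<open>W u\<close>: both calibration inequalities are equalities for it, so
  the level is sharp. Large mass needs this: the level is of order
  \<open>M powr (p / 2 + 1)\<close>, and for \<open>q < p / 2 + 1\<close> the vertex gain, of order
  \<open>M powr q\<close>, is smaller and could not pay for a lossy constant. For small mass the two
  sides carry different powers of \<open>\<mu>\<close>, and a crude estimate suffices.\<close>

lemma LINT_Icc_same:
  fixes g :: "real \<Rightarrow> real"
  shows "(LINT t:{a}|lborel. g t) = 0"
proof -
  have "AE x in lborel. indicator {a} x *\<^sub>R g x = 0"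
    using AE_lborel_singleton[of a] by eventually_elim (auto simp: indicator_def)
  then show ?thesis unfolding set_lebesgue_integral_def by (rule integral_eq_zero_AE)
qed

lemma LINT_Icc_split:
  fixes g :: "real \<Rightarrow> real"
  assumes "x \<le> y" "y \<le> z" "set_integrable lborel {x..z} g"
  shows "(LINT t:{x..z}|lborel. g t) = (LINT t:{x..y}|lborel. g t) + (LINT t:{y..z}|lborel. g t)"
proof -
  have i: "set_integrable lborel {x..y} g" "set_integrable lborel {y..z} g"
    using assms by (auto intro: set_integrable_subset[OF assms(3)])
  have "(LINT t:{x..y} \<union> {y..z}|lborel. g t) = (LINT t:{x..y}|lborel. g t) + (LINT t:{y..z}|lborel. g t)"
    using i by (intro set_integral_Un_AE AE_I[where N="{y}"]) auto
  moreover have "{x..y} \<union> {y..z} = {x..z}" using assms by auto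
  ultimately show ?thesis by simp
qed

lemma set_integrable_continuous_mult:
  fixes g h :: "real \<Rightarrow> real"
  assumes "set_integrable lborel {a..b} g" "continuous_on {a..b} h"
  shows "set_integrable lborel {a..b} (\<lambda>x. h x * g x)"
proof -
  have "compact (h ` {a..b})" using assms(2) by (intro compact_continuous_image) auto
  then obtain K where K: "\<And>x. x \<in> {a..b} \<Longrightarrow> \<bar>h x\<bar> \<le> K"
    by (fastforce simp: bounded_iff dest!: compact_imp_bounded)
  have mh: "(\<lambda>x. indicator {a..b} x *\<^sub>R h x) \<in> borel_measurable borel"
    using assms(2) by (intro borel_measurable_continuous_on_indicator) auto
  have mg: "(\<lambda>x. indicator {a..b} x *\<^sub>R g x) \<in> borel_measurable borel"
    using assms(1) by (auto simp: set_integrable_def)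
  have eq: "(\<lambda>x. indicator {a..b} x *\<^sub>R (h x * g x)) = (\<lambda>x. (indicator {a..b} x *\<^sub>R h x) * (indicator {a..b} x *\<^sub>R g x))"
    by (auto simp: indicator_def)
  show ?thesis
  proof (rule set_integrable_bound[where f="\<lambda>x. K * g x"])
    show "set_borel_measurable lborel {a..b} (\<lambda>x. h x * g x)"
      unfolding set_borel_measurable_def eq using mh mg by simp
    show "AE x\<in>{a..b} in lborel. norm (h x * g x) \<le> norm (K * g x)"
    proof (intro AE_I2 impI)
      fix x assume "x \<in> {a..b}"
      from K[OF this] have "\<bar>h x\<bar> \<le> \<bar>K\<bar>" by linarith
      then show "norm (h x * g x) \<le> norm (K * g x)" by (simp add: abs_mult mult_right_mono)
    qed
  qed (use assms in auto)
qed

text \<open>A telescoping sum over a fine subdivision: increments that are \<open>o(1)\<close> times those of a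
  fixed indefinite integral add up to nothing.\<close>

lemma le_of_small_increments:
  fixes \<Phi> k :: "real \<Rightarrow> real"
  assumes "a \<le> b" and k: "set_integrable lborel {a..b} k"
    and inc: "\<And>\<epsilon>. \<epsilon> > 0 \<Longrightarrow> \<exists>\<delta>>0. \<forall>x y. a \<le> x \<and> x \<le> y \<and> y \<le> b \<and> y - x < \<delta> \<longrightarrow>
        \<Phi> y - \<Phi> x \<le> \<epsilon> * (LINT t:{x..y}|lborel. k t)"
  shows "\<Phi> b \<le> \<Phi> a"
proof -
  define K where "K = (LINT t:{a..b}|lborel. k t)"
  have key: "\<Phi> b - \<Phi> a \<le> \<epsilon> * K" if "\<epsilon> > 0" for \<epsilon>
  proof -
    from inc[OF that] obtain \<delta> where \<delta>: "\<delta> > 0"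
      "\<And>x y. a \<le> x \<Longrightarrow> x \<le> y \<Longrightarrow> y \<le> b \<Longrightarrow> y - x < \<delta> \<Longrightarrow>
        \<Phi> y - \<Phi> x \<le> \<epsilon> * (LINT t:{x..y}|lborel. k t)" by blast
    obtain n :: nat where n: "(b - a) / \<delta> < real n" using reals_Archimedean2 by blast
    have n0: "n > 0"
    proof (rule ccontr)
      assume "\<not> n > 0"
      then have "(b - a) / \<delta> < 0" using n by simp
      then show False using assms(1) \<delta>(1) by (simp add: divide_less_0_iff)
    qed
    define h where "h = (b - a) / n"
    have h0: "h \<ge> 0" using assms(1) by (simp add: h_def)
    have h: "h < \<delta>" using n n0 \<delta>(1) by (simp add: h_def field_simps)
    have nh: "a + real n * h = b" using n0 by (simp add: h_def)
    have "\<Phi> (a + real i * h) - \<Phi> a \<le> \<epsilon> * (LINT t:{a..a + real i * h}|lborel. k t)" if "i \<le> n" for i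
      using that
    proof (induction i)
      case 0
      show ?case by (simp add: LINT_Icc_same)
    next
      case (Suc i)
      let ?x = "a + real i * h" and ?y = "a + real (Suc i) * h"
      have y: "?y \<le> b" using Suc.prems h0 nh
        by (metis add_le_cancel_left mult_right_mono of_nat_le_iff)
      have x: "a \<le> ?x" "?x \<le> ?y" "?y - ?x < \<delta>" using h0 h by (auto simp: algebra_simps)
      have "\<Phi> ?y - \<Phi> ?x \<le> \<epsilon> * (LINT t:{?x..?y}|lborel. k t)" by (rule \<delta>(2)) (use x y in auto)
      moreover have "(LINT t:{a..?y}|lborel. k t) = (LINT t:{a..?x}|lborel. k t) + (LINT t:{?x..?y}|lborel. k t)"
        using x y by (intro LINT_Icc_split set_integrable_subset[OF k]) auto
      ultimately show ?case using Suc by (simp add: distrib_left)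
    qed
    from this[of n] show ?thesis by (simp add: nh K_def)
  qed
  have "\<Phi> b - \<Phi> a \<le> 0"
  proof (rule field_le_epsilon)
    fix e :: real assume "e > 0"
    have "\<Phi> b - \<Phi> a \<le> e / (\<bar>K\<bar> + 1) * K" using \<open>e > 0\<close> by (intro key) auto
    also have "\<dots> \<le> e / (\<bar>K\<bar> + 1) * (\<bar>K\<bar> + 1)" using \<open>e > 0\<close> by (intro mult_left_mono) auto
    also have "\<dots> = e" by simp
    finally show "\<Phi> b - \<Phi> a \<le> 0 + e" by simp
  qed
  then show ?thesis by simp
qed

text \<open>Absolute continuity in integral form, with the density \<open>g\<close> as an explicit
  argument, so that no pointwise derivative is involved. Integrability is asked only between points
  of \<open>D\<close>, which allows \<open>D\<close> to be open or unbounded.\<close>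

definition ac_deriv :: "real set \<Rightarrow> (real \<Rightarrow> real) \<Rightarrow> (real \<Rightarrow> real) \<Rightarrow> bool" where
  "ac_deriv D f g \<longleftrightarrow> (\<forall>x\<in>D. \<forall>y\<in>D. x \<le> y \<longrightarrow>
     set_integrable lborel {x..y} g \<and> f y - f x = (LINT t:{x..y}|lborel. g t))"

lemma ac_derivD:
  assumes "ac_deriv D f g" "x \<in> D" "y \<in> D" "x \<le> y"
  shows "set_integrable lborel {x..y} g" "f y - f x = (LINT t:{x..y}|lborel. g t)"
  using assms by (auto simp: ac_deriv_def)

lemma ac_deriv_subset: "ac_deriv D f g \<Longrightarrow> D' \<subseteq> D \<Longrightarrow> ac_deriv D' f g"
  unfolding ac_deriv_def by blast

lemma ac_deriv_add:
  assumes "ac_deriv D f g" "ac_deriv D f' g'"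
  shows "ac_deriv D (\<lambda>x. f x + f' x) (\<lambda>x. g x + g' x)"
  using assms unfolding ac_deriv_def by (fastforce simp: set_integral_add)

lemma ac_deriv_cmult:
  assumes "ac_deriv D f g"
  shows "ac_deriv D (\<lambda>x. c * f x) (\<lambda>x. c * g x)"
  using assms unfolding ac_deriv_def by (auto simp: right_diff_distrib[symmetric])

lemma ac_deriv_diff:
  assumes "ac_deriv D f g" "ac_deriv D f' g'"
  shows "ac_deriv D (\<lambda>x. f x - f' x) (\<lambda>x. g x - g' x)"
  using ac_deriv_add[OF assms(1) ac_deriv_cmult[OF assms(2), of "-1"]] by simp

lemma ac_deriv_C1:
  assumes "\<And>x. x \<in> D \<Longrightarrow> (f has_real_derivative f' x) (at x within D)" "continuous_on D f'"
    "is_interval D"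
  shows "ac_deriv D f f'"
  unfolding ac_deriv_def
proof (intro ballI impI)
  fix x y assume xy: "x \<in> D" "y \<in> D" "x \<le> y"
  have sub: "{x..y} \<subseteq> D" using assms(3) xy unfolding is_interval_1 by fastforce
  have i: "set_integrable lborel {x..y} f'"
    using assms(2) sub by (intro borel_integrable_compact[of "{x..y}", folded set_integrable_def] ) (auto intro: continuous_on_subset)
  have "(f' has_integral (f y - f x)) {x..y}"
  proof (rule fundamental_theorem_of_calculus[OF xy(3)])
    fix z assume "z \<in> {x..y}"
    then have "(f has_real_derivative f' z) (at z within {x..y})"
      using assms(1)[of z] sub by (meson DERIV_subset subsetD)
    then show "(f has_vector_derivative f' z) (at z within {x..y})"
      by (simp add: has_real_derivative_iff_has_vector_derivative)
  qed
  then have "f y - f x = integral {x..y} f'" by (simp add: integral_unique)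
  then show "set_integrable lborel {x..y} f' \<and> f y - f x = (LINT t:{x..y}|lborel. f' t)"
    using i set_borel_integral_eq_integral(2)[OF i] by simp
qed

text \<open>Almost everywhere differentiation is avoided. The mean value theorem for
  \<open>S\<close> and the intermediate value theorem for \<open>f\<close> write an increment of
  \<open>S (f x)\<close> as \<open>S' (f \<xi>) * (f y - f x)\<close> with \<open>\<xi>\<close> in
  \<open>{x..y}\<close>. By uniform continuity of \<open>S' (f x)\<close>, the defect
  \<open>\<Phi>\<close> then has increments at most \<open>\<epsilon>\<close> times the integral of
  \<open>\<bar>g\<bar>\<close>, and telescoping applies to both \<open>\<Phi>\<close> and
  \<open>- \<Phi>\<close>.\<close>

lemma ac_deriv_chain:
  assumes f: "ac_deriv D f g" "continuous_on D f" "is_interval D"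
    and S: "\<And>x. (S has_real_derivative S' x) (at x)" "continuous_on UNIV S'"
  shows "ac_deriv D (\<lambda>x. S (f x)) (\<lambda>x. S' (f x) * g x)"
  unfolding ac_deriv_def
proof (intro ballI impI)
  fix a b assume ab: "a \<in> D" "b \<in> D" "a \<le> b"
  have sub: "{a..b} \<subseteq> D" using f(3) ab unfolding is_interval_1 by fastforce
  have g: "set_integrable lborel {a..b} g" using ac_derivD[OF f(1)] ab by auto
  have cf: "continuous_on {a..b} f" using f(2) sub continuous_on_subset by blast
  have cS: "continuous_on {a..b} (\<lambda>x. S' (f x))"
    using continuous_on_compose2[OF S(2) cf] by auto
  have i: "set_integrable lborel {a..b} (\<lambda>x. S' (f x) * g x)"
    by (rule set_integrable_continuous_mult[OF g cS])
  have uc: "uniformly_continuous_on {a..b} (\<lambda>x. S' (f x))"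
    using cS by (intro compact_uniformly_continuous) auto
  define \<Phi> where "\<Phi> x = S (f x) - (LINT t:{a..x}|lborel. S' (f t) * g t)" for x
  have inc: "\<exists>\<delta>>0. \<forall>x y. a \<le> x \<and> x \<le> y \<and> y \<le> b \<and> y - x < \<delta> \<longrightarrow>
        \<bar>\<Phi> y - \<Phi> x\<bar> \<le> \<epsilon> * (LINT t:{x..y}|lborel. \<bar>g t\<bar>)" if "\<epsilon> > 0" for \<epsilon>
  proof -
    from uc that obtain \<delta> where \<delta>: "\<delta> > 0" 
      "\<And>s t. s \<in> {a..b} \<Longrightarrow> t \<in> {a..b} \<Longrightarrow> \<bar>t - s\<bar> < \<delta> \<Longrightarrow> \<bar>S' (f t) - S' (f s)\<bar> < \<epsilon>"
      unfolding uniformly_continuous_on_def dist_real_def by metis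
    have "\<bar>\<Phi> y - \<Phi> x\<bar> \<le> \<epsilon> * (LINT t:{x..y}|lborel. \<bar>g t\<bar>)"
      if xy: "a \<le> x" "x \<le> y" "y \<le> b" "y - x < \<delta>" for x y
    proof -
      have sxy: "{x..y} \<subseteq> {a..b}" using xy by auto
      have D: "x \<in> D" "y \<in> D" using sub sxy xy by auto
      have gi: "set_integrable lborel {x..y} g" by (rule set_integrable_subset[OF g]) (use sxy in auto)
      have pi: "set_integrable lborel {x..y} (\<lambda>x. S' (f x) * g x)"
        by (rule set_integrable_subset[OF i]) (use sxy in auto)
      obtain \<xi> where \<xi>: "\<xi> \<in> {x..y}" "S (f y) - S (f x) = S' (f \<xi>) * (f y - f x)"
      proof -
        have "\<exists>z. min (f x) (f y) \<le> z \<and> z \<le> max (f x) (f y) \<and> S (f y) - S (f x) = S' z * (f y - f x)"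
        proof (cases "f x" "f y" rule: linorder_cases)
          case less
          then obtain z where z: "f x < z" "z < f y" "S (f y) - S (f x) = (f y - f x) * S' z"
            using MVT2[OF less, of S S'] S(1) by blast
          have "S (f y) - S (f x) = S' z * (f y - f x)" using z(3) by (simp add: algebra_simps)
          then show ?thesis using z by (intro exI[of _ z]) auto
        next
          case equal then show ?thesis by auto
        next
          case greater
          then obtain z where z: "f y < z" "z < f x" "S (f x) - S (f y) = (f x - f y) * S' z"
            using MVT2[OF greater, of S S'] S(1) by blast
          have "S (f y) - S (f x) = S' z * (f y - f x)" using z(3) by (simp add: algebra_simps)
          then show ?thesis using z by (intro exI[of _ z]) auto
        qed
        then obtain z where z: "min (f x) (f y) \<le> z" "z \<le> max (f x) (f y)"
          "S (f y) - S (f x) = S' z * (f y - f x)" by blast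
        have cxy: "continuous_on {x..y} f" using cf sxy continuous_on_subset by blast
        have "\<exists>\<xi>\<in>{x..y}. f \<xi> = z"
        proof (cases "f x \<le> f y")
          case True
          then show ?thesis using IVT'[of f x z y] z cxy xy by auto
        next
          case False
          then show ?thesis using IVT2'[of f y z x] z cxy xy by auto
        qed
        then show thesis using that z by blast
      qed
      have spl: "(LINT t:{a..y}|lborel. S' (f t) * g t) = (LINT t:{a..x}|lborel. S' (f t) * g t) + (LINT t:{x..y}|lborel. S' (f t) * g t)"
        by (intro LINT_Icc_split set_integrable_subset[OF i]) (use xy in auto)
      have "\<Phi> y - \<Phi> x = S' (f \<xi>) * (f y - f x) - (LINT t:{x..y}|lborel. S' (f t) * g t)"
        unfolding \<Phi>_def spl using \<xi>(2) by simp
      also have "\<dots> = (LINT t:{x..y}|lborel. S' (f \<xi>) * g t) - (LINT t:{x..y}|lborel. S' (f t) * g t)"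
        using ac_derivD(2)[OF f(1) D] xy by simp
      also have "\<dots> = (LINT t:{x..y}|lborel. S' (f \<xi>) * g t - S' (f t) * g t)"
        using gi pi by (simp add: set_integral_diff)
      finally have 1: "\<Phi> y - \<Phi> x = (LINT t:{x..y}|lborel. S' (f \<xi>) * g t - S' (f t) * g t)" .
      have "\<bar>LINT t:{x..y}|lborel. S' (f \<xi>) * g t - S' (f t) * g t\<bar> \<le> (LINT t:{x..y}|lborel. \<bar>S' (f \<xi>) * g t - S' (f t) * g t\<bar>)"
        using set_integral_norm_bound[of lborel "{x..y}" "\<lambda>t. S' (f \<xi>) * g t - S' (f t) * g t"] gi pi by simp
      also have "\<dots> \<le> (LINT t:{x..y}|lborel. \<epsilon> * \<bar>g t\<bar>)"
      proof (rule set_integral_mono)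
        show "set_integrable lborel {x..y} (\<lambda>t. \<bar>S' (f \<xi>) * g t - S' (f t) * g t\<bar>)"
          using gi pi by (intro set_integrable_abs set_integral_diff) auto
        show "set_integrable lborel {x..y} (\<lambda>t. \<epsilon> * \<bar>g t\<bar>)"
          using gi by (auto intro: set_integrable_abs)
        fix t assume t: "t \<in> {x..y}"
        have "\<bar>S' (f \<xi>) - S' (f t)\<bar> < \<epsilon>" by (rule \<delta>(2)) (use t \<xi> xy in auto)
        then show "\<bar>S' (f \<xi>) * g t - S' (f t) * g t\<bar> \<le> \<epsilon> * \<bar>g t\<bar>"
          by (simp add: abs_mult left_diff_distrib[symmetric] mult_right_mono)
      qed
      finally show ?thesis using 1 by simp
    qed
    with \<delta>(1) show ?thesis by blast
  qed
  have gabs: "set_integrable lborel {a..b} (\<lambda>t. \<bar>g t\<bar>)" using g by (rule set_integrable_abs)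
  have "\<Phi> b \<le> \<Phi> a"
    by (rule le_of_small_increments[OF ab(3) gabs]) (use inc in \<open>meson abs_le_D1\<close>)
  moreover have "- \<Phi> b \<le> - \<Phi> a"
  proof (rule le_of_small_increments[OF ab(3) gabs])
    fix \<epsilon> :: real assume "\<epsilon> > 0"
    from inc[OF this] show "\<exists>\<delta>>0. \<forall>x y. a \<le> x \<and> x \<le> y \<and> y \<le> b \<and> y - x < \<delta> \<longrightarrow>
        - \<Phi> y - - \<Phi> x \<le> \<epsilon> * (LINT t:{x..y}|lborel. \<bar>g t\<bar>)"
      by (force simp: abs_le_iff)
  qed
  moreover have "(LINT t:{a..a}|lborel. S' (f t) * g t) = 0" by (simp add: LINT_Icc_same)
  ultimately have "S (f b) - S (f a) = (LINT t:{a..b}|lborel. S' (f t) * g t)"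
    by (simp add: \<Phi>_def)
  with i show "set_integrable lborel {a..b} (\<lambda>x. S' (f x) * g x) \<and> S (f b) - S (f a) = (LINT t:{a..b}|lborel. S' (f t) * g t)"
    by simp
qed

lemma ac_deriv_square:
  assumes f: "ac_deriv D f g" "continuous_on D f" "is_interval D"
  shows "ac_deriv D (\<lambda>x. (f x)\<^sup>2) (\<lambda>x. 2 * f x * g x)"
  by (rule ac_deriv_chain[OF f, where S="\<lambda>x. x\<^sup>2" and S'="\<lambda>x. 2 * x"])
     (auto intro!: derivative_eq_intros continuous_intros)

text \<open>Polarization reduces the product rule to the rule for squares: twice a product is the
  square of the sum minus both squares.\<close>

lemma ac_deriv_mult:
  assumes f: "ac_deriv D f g" "continuous_on D f" and f': "ac_deriv D f' g'" "continuous_on D f'"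
    and D: "is_interval D"
  shows "ac_deriv D (\<lambda>x. f x * f' x) (\<lambda>x. f x * g' x + g x * f' x)"
proof -
  have "ac_deriv D (\<lambda>x. (f x + f' x)\<^sup>2) (\<lambda>x. 2 * (f x + f' x) * (g x + g' x))"
    by (intro ac_deriv_square ac_deriv_add assms continuous_intros)
  from ac_deriv_cmult[OF ac_deriv_diff[OF ac_deriv_diff[OF this ac_deriv_square[OF f D]] ac_deriv_square[OF f' D]], of "1/2"]
  show ?thesis by (simp add: power2_eq_square algebra_simps add_divide_distrib)
qed

text \<open>Cut off to \<open>{a..b}\<close>, the function has integral 0 over every half-line
  \<open>{x..}\<close>. These form an intersection-stable generator of the Borel sets, so Dynkin
  induction extends the vanishing to all Borel sets, and a density with vanishing integrals is 0
  almost everywhere.\<close>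

lemma AE_zero_of_LINT_Icc_zero:
  fixes g :: "real \<Rightarrow> real"
  assumes g: "set_integrable lborel {a..b} g"
    and z: "\<And>x y. a \<le> x \<Longrightarrow> x \<le> y \<Longrightarrow> y \<le> b \<Longrightarrow> (LINT t:{x..y}|lborel. g t) = 0"
  shows "AE x in lborel. x \<in> {a..b} \<longrightarrow> g x = 0"
proof -
  define h where "h x = indicator {a..b} x *\<^sub>R g x" for x
  have h: "integrable lborel h" using g unfolding set_integrable_def h_def .
  have half: "(LINT t:{x..}|lborel. h t) = 0" for x
  proof -
    have "(LINT t:{x..}|lborel. h t) = (LINT t:{max a x..b}|lborel. g t)"
      unfolding set_lebesgue_integral_def h_def by (intro Bochner_Integration.integral_cong) (auto simp: indicator_def)
    also have "\<dots> = 0"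
    proof (cases "max a x \<le> b")
      case True then show ?thesis by (intro z) auto
    qed (simp add: set_lebesgue_integral_def)
    finally show ?thesis .
  qed
  have UN: "(LINT t|lborel. h t) = 0"
  proof -
    have "(LINT t|lborel. h t) = (LINT t:{a..}|lborel. h t)"
      unfolding set_lebesgue_integral_def h_def by (intro Bochner_Integration.integral_cong) (auto simp: indicator_def)
    then show ?thesis using half by simp
  qed
  have hi: "set_integrable lborel A h" if "A \<in> sets borel" for A
    unfolding set_integrable_def using integrable_mult_indicator[OF _ h] that by simp
  have "(LINT t:A|lborel. h t) = 0" if "A \<in> sets lborel" for A
  proof -
    have "Int_stable (range (\<lambda>x::real. {x..}))"
      unfolding Int_stable_def
    proof clarify
      fix a b :: real
      have "{a..} \<inter> {b..} = {max a b..}" by auto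
      then show "{a..} \<inter> {b..} \<in> range atLeast" by auto
    qed
    moreover have "range (\<lambda>x::real. {x..}) \<subseteq> Pow UNIV" by simp
    moreover have "A \<in> sigma_sets UNIV (range (\<lambda>x::real. {x..}))"
      using that by (simp add: borel_Ici sets_measure_of)
    ultimately show ?thesis
    proof (induction rule: sigma_sets_induct_disjoint)
      case (basic A) then show ?case using half by auto
    next
      case (compl A)
      have A: "A \<in> sets lborel" using compl(1) by (simp add: borel_Ici sets_measure_of)
      have "(LINT t:A \<union> (UNIV - A)|lborel. h t) = (LINT t:A|lborel. h t) + (LINT t:UNIV - A|lborel. h t)"
        using A h by (intro set_integral_Un) (auto intro!: hi)
      moreover have e: "A \<union> (UNIV - A) = UNIV" by auto
      have "(LINT t:A \<union> (UNIV - A)|lborel. h t) = 0" unfolding e using UN by (simp add: set_lebesgue_integral_def)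
      ultimately show ?case using compl(2) by linarith
    next
      case (union A)
      have A: "A i \<in> sets lborel" for i using union by (simp add: borel_Ici sets_measure_of range_subsetD)
      have "(LINT t:(\<Union>i. A i)|lborel. h t) = (\<Sum>i. (LINT t:A i|lborel. h t))"
        using union A h by (intro lebesgue_integral_countable_add)
          (auto simp: disjoint_family_on_def intro!: hi)
      then show ?case using union by simp
    qed (auto simp: set_lebesgue_integral_def)
  qed
  then have "AE x in lborel. h x = 0" by (intro sigma_finite_measure.density_zero[OF sigma_finite_lborel h])
  then show ?thesis by eventually_elim (auto simp: h_def)
qed

section \<open>Weak derivatives\<close>

text \<open>A quadratic spline that rises from 0 to 1 on \<open>[0, 1]\<close>. Differences of rescaled copies are the test
  functions that turn a weak derivative into increments.\<close>

definition ramp :: "real \<Rightarrow> real" where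
  "ramp t = 2 * ((max 0 t)\<^sup>2 - 2 * (max 0 (t - 1/2))\<^sup>2 + (max 0 (t - 1))\<^sup>2)"

definition ramp' :: "real \<Rightarrow> real" where
  "ramp' t = 4 * (max 0 t - 2 * max 0 (t - 1/2) + max 0 (t - 1))"

lemma has_real_derivative_max_square:
  "((\<lambda>t::real. (max 0 t)\<^sup>2) has_real_derivative 2 * max 0 t) (at t)"
proof -
  consider "t < 0" | "t > 0" | "t = 0" by linarith
  then show ?thesis
  proof cases
    case 1
    have "((\<lambda>t::real. 0) has_real_derivative 0) (at t)" by simp
    then have "((\<lambda>t::real. (max 0 t)\<^sup>2) has_real_derivative 0) (at t)"
      by (rule has_field_derivative_transform_within_open[of _ _ _ "{..<0}"]) (use 1 in auto)
    with 1 show ?thesis by simp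
  next
    case 2
    have "((\<lambda>t::real. t\<^sup>2) has_real_derivative 2 * t) (at t)" by (auto intro!: derivative_eq_intros)
    then have "((\<lambda>t::real. (max 0 t)\<^sup>2) has_real_derivative 2 * t) (at t)"
      by (rule has_field_derivative_transform_within_open[of _ _ _ "{0<..}"]) (use 2 in auto)
    with 2 show ?thesis by simp
  next
    case 3
    have "((\<lambda>h::real. (max 0 h)\<^sup>2 / h) \<longlongrightarrow> 0) (at 0)"
    proof (rule Lim_null_comparison)
      show "\<forall>\<^sub>F h::real in at 0. norm ((max 0 h)\<^sup>2 / h) \<le> \<bar>h\<bar>"
        by (intro always_eventually) (auto simp: max_def power2_eq_square)
      show "((\<lambda>h::real. \<bar>h\<bar>) \<longlongrightarrow> 0) (at 0)" by (intro tendsto_rabs_zero tendsto_ident_at)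
    qed
    then show ?thesis using 3 by (simp add: DERIV_def)
  qed
qed

lemma ramp_has_derivative: "(ramp has_real_derivative ramp' t) (at t)"
proof -
  have "((\<lambda>t. (max 0 (t - c))\<^sup>2) has_real_derivative 2 * max 0 (t - c)) (at t)" for c :: real
  proof -
    have "((\<lambda>t. t - c) has_real_derivative 1) (at t)" by (auto intro!: derivative_eq_intros)
    from DERIV_chain2[OF has_real_derivative_max_square this] show ?thesis by simp
  qed
  from DERIV_cmult[OF DERIV_add[OF DERIV_diff[OF this[of 0] DERIV_cmult[OF this[of "1/2"], of 2]] this[of 1]], of 2]
  show ?thesis by (simp add: ramp_def[abs_def] ramp'_def algebra_simps)
qed

lemma ramp_le0: "t \<le> 0 \<Longrightarrow> ramp t = 0" and ramp_ge1: "t \<ge> 1 \<Longrightarrow> ramp t = 1"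
  by (auto simp: ramp_def max_def power2_eq_square algebra_simps)

lemma ramp'_nonneg: "ramp' t \<ge> 0" and ramp'_out: "t \<notin> {0..1} \<Longrightarrow> ramp' t = 0"
  by (auto simp: ramp'_def max_def)

lemma ramp_bounds: "0 \<le> ramp t" "ramp t \<le> 1"
proof -
  have m: "ramp x \<le> ramp y" if "x \<le> y" for x y
    using that ramp_has_derivative ramp'_nonneg by (meson DERIV_nonneg_imp_nondecreasing)
  show "0 \<le> ramp t" using m[of "min 0 t" t] ramp_le0[of "min 0 t"] by simp
  show "ramp t \<le> 1" using m[of t "max 1 t"] ramp_ge1[of "max 1 t"] by simp
qed

lemma continuous_ramp': "continuous_on A ramp'"
  unfolding ramp'_def[abs_def] by (intro continuous_intros)

lemma ramp'_integral: "integrable lborel ramp'" "(LINT t|lborel. ramp' t) = 1"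
proof -
  have e: "(\<lambda>t. indicator {0..1} t *\<^sub>R ramp' t) = ramp'"
    using ramp'_out by (auto simp: indicator_def fun_eq_iff)
  have "set_integrable lborel {0..1} ramp'"
    unfolding set_integrable_def by (intro borel_integrable_compact continuous_ramp') auto
  then show "integrable lborel ramp'" unfolding set_integrable_def e .
  have "ac_deriv UNIV ramp ramp'"
    by (intro ac_deriv_C1 continuous_ramp' DERIV_subset[OF ramp_has_derivative]) auto
  from ac_derivD(2)[OF this, of 0 1] have "(LINT t:{0..1}|lborel. ramp' t) = 1"
    by (simp add: ramp_le0 ramp_ge1)
  then show "(LINT t|lborel. ramp' t) = 1" unfolding set_lebesgue_integral_def e .
qed

text \<open>The rescaled kernels live to the right of \<open>x\<close>, so a right limit of
  \<open>F\<close> is enough. This matters because \<open>F\<close> will be a function cut off at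
  the left end point of an interval, where it may jump.\<close>

lemma ramp'_approximates_delta:
  fixes F :: "real \<Rightarrow> real"
  assumes F: "F \<in> borel_measurable borel" "\<And>t. \<bar>F t\<bar> \<le> B" and c: "(F \<longlongrightarrow> F x) (at_right x)"
  shows "(\<lambda>n. LINT t|lborel. F t * (real (Suc n) * ramp' (real (Suc n) * (t - x)))) \<longlonglongrightarrow> F x"
proof -
  have [measurable]: "ramp' \<in> borel_measurable borel"
    using continuous_ramp' by (intro borel_measurable_continuous_onI)
  note [measurable] = F(1)
  have "(LINT t|lborel. F t * (real (Suc n) * ramp' (real (Suc n) * (t - x))))
     = (LINT s|lborel. F (x + s / Suc n) * ramp' s)" for n
  proof -
    define k where "k = real (Suc n)"
    have k: "k > 0" by (simp add: k_def)
    have "(LINT t|lborel. F t * (k * ramp' (k * (t - x)))) = (1 / k) * (LINT s|lborel. k * (F (x + s / k) * ramp' s))"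
      using lborel_integral_real_affine[of "1 / k" "\<lambda>t. F t * (k * ramp' (k * (t - x)))" x] k
      by (simp add: mult_ac)
    then show ?thesis using k unfolding k_def[symmetric] by simp
  qed
  moreover have "(\<lambda>n. LINT s|lborel. F (x + s / Suc n) * ramp' s) \<longlonglongrightarrow> (LINT s|lborel. F x * ramp' s)"
  proof (rule integral_dominated_convergence[where w="\<lambda>s. B * ramp' s"])
    show "integrable lborel (\<lambda>s. B * ramp' s)" using ramp'_integral by simp
    have "(\<lambda>n. F (x + s / Suc n) * ramp' s) \<longlonglongrightarrow> F x * ramp' s" for s
    proof (cases "s \<in> {0<..1}")
      case True
      have "filterlim (\<lambda>n. x + s / Suc n) (at_right x) sequentially"
        unfolding filterlim_at
      proof
        have "(\<lambda>n. s * inverse (real (Suc n))) \<longlonglongrightarrow> s * 0"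
          by (intro tendsto_mult tendsto_const LIMSEQ_inverse_real_of_nat)
        then have "(\<lambda>n. x + s * inverse (real (Suc n))) \<longlonglongrightarrow> x + s * 0" by (intro tendsto_add tendsto_const)
        then show "(\<lambda>n. x + s / Suc n) \<longlonglongrightarrow> x" by (simp add: divide_inverse)
        show "\<forall>\<^sub>F n in sequentially. x + s / Suc n \<in> {x<..} \<and> x + s / Suc n \<noteq> x" using True by auto
      qed
      then show ?thesis using c by (intro tendsto_intros) (rule filterlim_compose)
    next
      case False
      then have "ramp' s = 0" using ramp'_out[of s] by (cases "s = 0") (auto simp: ramp'_def)
      then show ?thesis by simp
    qed
    then show "AE s in lborel. (\<lambda>n. F (x + s / Suc n) * ramp' s) \<longlonglongrightarrow> F x * ramp' s" by simp
    show "AE s in lborel. norm (F (x + s / Suc n) * ramp' s) \<le> B * ramp' s" for n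
      using F(2) ramp'_nonneg by (auto simp: abs_mult intro!: mult_right_mono)
  qed auto
  ultimately show ?thesis using ramp'_integral by simp
qed

text \<open>This is a smoothed indicator of \<open>{x..y}\<close>: it rises just to the right of
  \<open>x\<close> and falls just to the right of \<open>y\<close>, hence the overshoot
  \<open>1 / Suc n\<close> in the support.\<close>

lemma test_fun_ramp:
  fixes n :: nat
  assumes "x < y" "{x..y + 1 / Suc n} \<subseteq> I"
  shows "test_fun I (\<lambda>t. ramp (Suc n * (t - x)) - ramp (Suc n * (t - y)))
     (\<lambda>t. Suc n * ramp' (Suc n * (t - x)) - Suc n * ramp' (Suc n * (t - y)))"
    (is "test_fun I ?\<phi> ?\<phi>'")
proof -
  have "((\<lambda>t. ramp (Suc n * (t - z))) has_real_derivative Suc n * ramp' (Suc n * (t - z))) (at t)" for z t :: real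
  proof -
    have "((\<lambda>t. Suc n * (t - z)) has_real_derivative Suc n) (at t)" by (auto intro!: derivative_eq_intros)
    from DERIV_chain2[OF ramp_has_derivative this] show ?thesis by (simp only: mult.commute)
  qed
  then have 1: "(?\<phi> has_real_derivative ?\<phi>' t) (at t)" for t by (intro DERIV_diff)
  have 2: "continuous_on UNIV ?\<phi>'"
    by (intro continuous_intros continuous_on_compose2[OF continuous_ramp'[of UNIV]]) auto
  have "{t. ?\<phi> t \<noteq> 0} \<subseteq> {x..y + 1 / Suc n}"
  proof (rule subsetI, rule ccontr)
    fix t assume t: "t \<in> {t. ?\<phi> t \<noteq> 0}" "t \<notin> {x..y + 1 / Suc n}"
    then consider "t < x" | "t > y + 1 / Suc n" by fastforce
    then show False
    proof cases
      case 1
      then have "Suc n * (t - x) \<le> 0" "Suc n * (t - y) \<le> 0" using assms(1) by (auto intro!: mult_nonneg_nonpos)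
      then show False using t(1) by (simp add: ramp_le0 del: of_nat_Suc)
    next
      case 2
      then have "Suc n * (t - y) \<ge> 1" by (simp add: field_simps del: of_nat_Suc)
      moreover have "Suc n * (t - x) \<ge> Suc n * (t - y)" using assms(1) by (intro mult_left_mono) auto
      ultimately have "ramp (Suc n * (t - y)) = 1" "ramp (Suc n * (t - x)) = 1" by (intro ramp_ge1; linarith)+
      then show False using t(1) by simp
    qed
  qed
  then have 3: "closure {t. ?\<phi> t \<noteq> 0} \<subseteq> {x..y + 1 / Suc n}" by (intro closure_minimal) auto
  then have "compact (closure {t. ?\<phi> t \<noteq> 0})"
    by (meson bounded_closed_interval bounded_subset closed_closure compact_eq_bounded_closed)
  with 1 2 3 assms(2) show ?thesis unfolding test_fun_def by blast
qed

lemma test_fun_eq_0: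
  assumes "test_fun I \<phi> \<phi>'" "closure {x. \<phi> x \<noteq> 0} \<subseteq> K" "t \<notin> K"
  shows "\<phi> t = 0" "\<phi>' t = 0"
proof -
  let ?C = "closure {x. \<phi> x \<noteq> 0}"
  have t: "t \<in> - ?C" using assms by auto
  have z: "\<phi> s = 0" if "s \<in> - ?C" for s
    using that closure_subset[of "{x. \<phi> x \<noteq> 0}"] by blast
  show "\<phi> t = 0" by (rule z[OF t])
  have "((\<lambda>_. 0) has_real_derivative 0) (at t)" by simp
  then have "(\<phi> has_real_derivative 0) (at t)"
    by (rule has_field_derivative_transform_within_open[of _ _ _ "- ?C"])
       (use t in \<open>simp_all only: z closed_closure open_Compl\<close>)
  moreover have "(\<phi> has_real_derivative \<phi>' t) (at t)" using assms(1) by (auto simp: test_fun_def)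
  ultimately show "\<phi>' t = 0" by (metis DERIV_unique)
qed

text \<open>Testing with the smoothed indicators of \<open>{x..y}\<close> gives the increment in the
  limit: their derivative is a difference of two approximate deltas, which turns the left side into
  \<open>f x - f y\<close>, and the right side tends to minus the integral of \<open>g\<close> over
  \<open>{x..y}\<close> by dominated convergence.\<close>

lemma is_weak_deriv_imp_ac_deriv:
  assumes w: "is_weak_deriv I f g" and I: "open I" "is_interval I" and f: "continuous_on I f"
  shows "ac_deriv I f g"
  unfolding ac_deriv_def
proof (intro ballI impI)
  fix x y assume xy: "x \<in> I" "y \<in> I" "x \<le> y"
  have sub: "{x..y} \<subseteq> I" using I(2) xy unfolding is_interval_1 by fastforce
  have gi: "set_integrable lborel {x..y} g"
    using w sub by (auto simp: is_weak_deriv_def locally_integrable_def)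
  have "f y - f x = (LINT t:{x..y}|lborel. g t)"
  proof (cases "x = y")
    case True then show ?thesis by (simp add: LINT_Icc_same)
  next
    case False
    then have "x < y" using xy by simp
    obtain e where e: "e > 0" "ball y e \<subseteq> I" using I(1) xy(2) openE by blast
    obtain N where N: "1 / real (Suc N) < e" using e(1) nat_approx_posE by blast
    \<comment> \<open>Openness of \<open>I\<close> leaves room to the right of \<open>y\<close>; all
      test functions with \<open>n \<ge> N\<close> are then supported in the fixed compact interval
      \<open>{x..b}\<close>.\<close>
    define b where "b = y + 1 / Suc N"
    have "b \<in> I" using e(2) N by (auto simp: b_def dist_real_def)
    have K: "{x..b} \<subseteq> I" using I(2) xy(1) \<open>b \<in> I\<close> unfolding is_interval_1 by fastforce
    have bn: "y + 1 / Suc n \<le> b" if "n \<ge> N" for n using that by (simp add: b_def field_simps)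
    define \<phi> where "\<phi> n t = ramp (Suc n * (t - x)) - ramp (Suc n * (t - y))" for n :: nat and t
    define \<phi>' where "\<phi>' n t = Suc n * ramp' (Suc n * (t - x)) - Suc n * ramp' (Suc n * (t - y))" for n :: nat and t
    have tf: "test_fun I (\<phi> n) (\<phi>' n)" if "n \<ge> N" for n
      unfolding \<phi>_def \<phi>'_def by (rule test_fun_ramp) (use \<open>x < y\<close> K bn[OF that] in auto)
    have tf': "test_fun {x..b} (\<phi> n) (\<phi>' n)" if "n \<ge> N" for n
      unfolding \<phi>_def \<phi>'_def by (rule test_fun_ramp) (use \<open>x < y\<close> bn[OF that] in auto)
    have out: "\<phi> n t = 0" "\<phi>' n t = 0" if "n \<ge> N" "t \<notin> {x..b}" for n t
      using test_fun_eq_0[OF tf'[OF that(1)] _ that(2)] tf'[OF that(1)] by (auto simp: test_fun_def)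
    define F where "F t = indicator {x..b} t *\<^sub>R f t" for t
    have cf: "continuous_on {x..b} f" using f K continuous_on_subset by blast
    have Fm: "F \<in> borel_measurable borel" unfolding F_def
      using cf by (intro borel_measurable_continuous_on_indicator) auto
    have "compact (f ` {x..b})" using cf by (intro compact_continuous_image) auto
    then obtain B where B: "\<And>t. t \<in> {x..b} \<Longrightarrow> \<bar>f t\<bar> \<le> B"
      by (fastforce simp: bounded_iff dest!: compact_imp_bounded)
    have Fb: "\<bar>F t\<bar> \<le> \<bar>B\<bar>" for t using B[of t] by (auto simp: F_def indicator_def)
    have Fc: "(F \<longlongrightarrow> F z) (at_right z)" if "z \<in> {x..<b}" for z
    proof -
      have "(f \<longlongrightarrow> f z) (at_right z)"
      proof -
        have "z \<in> I" using K that by auto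
        then have "isCont f z" using f I(1) by (simp add: continuous_on_eq_continuous_at)
        then show ?thesis by (simp add: isCont_def filterlim_at_split)
      qed
      moreover have "\<forall>\<^sub>F t in at_right z. f t = F t"
        unfolding eventually_at_right[of z b, OF that[simplified, THEN conjunct2]] 
        using that by (intro exI[of _ b]) (auto simp: F_def)
      ultimately have "(F \<longlongrightarrow> f z) (at_right z)" by (rule Lim_transform_eventually)
      moreover have "F z = f z" using that by (auto simp: F_def)
      ultimately show ?thesis by simp
    qed
    have "b > y" by (simp add: b_def)
    have lim1: "(\<lambda>n. (LINT t|lborel. F t * \<phi>' n t)) \<longlonglongrightarrow> F x - F y"
    proof -
      have i: "integrable lborel (\<lambda>t. F t * (real (Suc n) * ramp' (real (Suc n) * (t - z))))" for n z
      proof (rule Bochner_Integration.integrable_bound)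
        have "integrable lborel (\<lambda>t. ramp' (real (Suc n) * (t - z)))"
          using lborel_integrable_real_affine[OF ramp'_integral(1), of "real (Suc n)" "- real (Suc n) * z"]
          by (simp add: algebra_simps)
        then show "integrable lborel (\<lambda>t. \<bar>B\<bar> * (real (Suc n) * ramp' (real (Suc n) * (t - z))))"
          by simp
        have [measurable]: "ramp' \<in> borel_measurable borel"
          using continuous_ramp' by (intro borel_measurable_continuous_onI)
        show "(\<lambda>t. F t * (real (Suc n) * ramp' (real (Suc n) * (t - z)))) \<in> borel_measurable lborel"
          using Fm by measurable
        show "AE t in lborel. norm (F t * (real (Suc n) * ramp' (real (Suc n) * (t - z))))
           \<le> norm (\<bar>B\<bar> * (real (Suc n) * ramp' (real (Suc n) * (t - z))))"
          using Fb by (auto simp: abs_mult intro!: mult_right_mono)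
      qed
      have "(LINT t|lborel. F t * \<phi>' n t) = (LINT t|lborel. F t * (real (Suc n) * ramp' (real (Suc n) * (t - x))))
         - (LINT t|lborel. F t * (real (Suc n) * ramp' (real (Suc n) * (t - y))))" for n
        unfolding \<phi>'_def by (subst Bochner_Integration.integral_diff[OF i i, symmetric]) (simp only: right_diff_distrib)
      moreover have "(\<lambda>n. (LINT t|lborel. F t * (real (Suc n) * ramp' (real (Suc n) * (t - x))))
         - (LINT t|lborel. F t * (real (Suc n) * ramp' (real (Suc n) * (t - y))))) \<longlonglongrightarrow> F x - F y"
        by (intro tendsto_diff ramp'_approximates_delta[OF Fm Fb] Fc) (use \<open>x < y\<close> \<open>b > y\<close> in auto)
      ultimately show ?thesis by simp
    qed
    have gK: "set_integrable lborel {x..b} g"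
      using w K by (auto simp: is_weak_deriv_def locally_integrable_def)
    have lim2: "(\<lambda>n. (LINT t:{x..b}|lborel. g t * \<phi> n t)) \<longlonglongrightarrow> (LINT t:{x..y}|lborel. g t)"
      unfolding set_lebesgue_integral_def
    proof (rule integral_dominated_convergence[where w="\<lambda>t. \<bar>indicator {x..b} t *\<^sub>R g t\<bar>"])
      show "integrable lborel (\<lambda>t. \<bar>indicator {x..b} t *\<^sub>R g t\<bar>)"
        using gK by (simp add: set_integrable_def)
      have gm: "(\<lambda>t. indicator {x..b} t *\<^sub>R g t) \<in> borel_measurable lborel"
        using gK by (simp add: set_integrable_def)
      have rm: "ramp \<in> borel_measurable borel"
        using ramp_has_derivative by (intro borel_measurable_continuous_onI)
          (meson DERIV_isCont continuous_at_imp_continuous_on)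
      show "(\<lambda>t. indicator {x..b} t *\<^sub>R (g t * \<phi> n t)) \<in> borel_measurable lborel" for n
      proof -
        have "(\<lambda>t. ramp (real (Suc n) * (t - z))) \<in> borel_measurable lborel" for z
          by (rule measurable_compose[OF _ rm]) measurable
        then have "(\<lambda>t. (indicator {x..b} t *\<^sub>R g t) * \<phi> n t) \<in> borel_measurable lborel"
          unfolding \<phi>_def by (intro borel_measurable_times gm borel_measurable_diff)
        then show ?thesis by (simp add: mult.assoc)
      qed
      show "(\<lambda>t. indicator {x..y} t *\<^sub>R g t) \<in> borel_measurable lborel"
        using gi by (simp add: set_integrable_def)
      have \<phi>1: "\<bar>\<phi> n t\<bar> \<le> 1" for n t
        using ramp_bounds[of "Suc n * (t - x)"] ramp_bounds[of "Suc n * (t - y)"] by (auto simp: \<phi>_def)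
      show "AE t in lborel. norm (indicator {x..b} t *\<^sub>R (g t * \<phi> n t)) \<le> \<bar>indicator {x..b} t *\<^sub>R g t\<bar>" for n
        using \<phi>1 by (auto simp: abs_mult indicator_def intro!: mult_left_le)
      have "(\<lambda>n. indicator {x..b} t *\<^sub>R (g t * \<phi> n t)) \<longlonglongrightarrow> indicator {x..y} t *\<^sub>R g t" if "t \<noteq> x" for t
      proof -
        have r: "\<forall>\<^sub>F n in sequentially. ramp (Suc n * (t - z)) = (if t > z then 1 else 0)" for z
        proof (cases "t > z")
          case True
          obtain N where N: "1 / (t - z) < real N" using reals_Archimedean2 by blast
          have "ramp (Suc n * (t - z)) = 1" if "n \<ge> N" for n
          proof (rule ramp_ge1)
            have "1 / (t - z) < real (Suc n)" using N that by simp
            then show "1 \<le> Suc n * (t - z)" using True by (simp add: field_simps del: of_nat_Suc)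
          qed
          then show ?thesis using True unfolding eventually_sequentially by auto
        next
          case False
          then have "Suc n * (t - z) \<le> 0" for n by (intro mult_nonneg_nonpos) auto
          then show ?thesis using False by (simp add: ramp_le0 del: of_nat_Suc)
        qed
        have "\<forall>\<^sub>F n in sequentially. indicator {x..b} t *\<^sub>R (g t * \<phi> n t) = indicator {x..y} t *\<^sub>R g t"
          using r[of x] r[of y]
          by eventually_elim (use that \<open>x < y\<close> \<open>b > y\<close> in \<open>auto simp: \<phi>_def indicator_def\<close>)
        then show ?thesis by (rule tendsto_eventually)
      qed
      then show "AE t in lborel. (\<lambda>n. indicator {x..b} t *\<^sub>R (g t * \<phi> n t)) \<longlonglongrightarrow> indicator {x..y} t *\<^sub>R g t"
        using AE_lborel_singleton[of x] by (auto elim!: eventually_mono)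
    qed
    have eq: "(LINT t|lborel. F t * \<phi>' n t) = - (LINT t:{x..b}|lborel. g t * \<phi> n t)" if n: "n \<ge> N" for n
    proof -
      have "(LINT t:I|lborel. f t * \<phi>' n t) = - (LINT t:I|lborel. g t * \<phi> n t)"
        using w tf[OF n] by (auto simp: is_weak_deriv_def)
      moreover have "(LINT t:I|lborel. f t * \<phi>' n t) = (LINT t|lborel. F t * \<phi>' n t)"
        unfolding set_lebesgue_integral_def F_def
        by (intro Bochner_Integration.integral_cong) (use K out[OF n] in \<open>auto simp: indicator_def\<close>)
      moreover have "(LINT t:I|lborel. g t * \<phi> n t) = (LINT t:{x..b}|lborel. g t * \<phi> n t)"
        unfolding set_lebesgue_integral_def
        by (intro Bochner_Integration.integral_cong) (use K out[OF n] in \<open>auto simp: indicator_def\<close>)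
      ultimately show ?thesis by simp
    qed
    have "(\<lambda>n. (LINT t|lborel. F t * \<phi>' n t)) \<longlonglongrightarrow> - (LINT t:{x..y}|lborel. g t)"
      by (rule Lim_transform_eventually[OF tendsto_minus[OF lim2]])
         (unfold eventually_sequentially, use eq in metis)
    with lim1 have "F x - F y = - (LINT t:{x..y}|lborel. g t)" using LIMSEQ_unique by blast
    then show ?thesis using \<open>x < y\<close> \<open>b > y\<close> by (simp add: F_def)
  qed
  with gi show "set_integrable lborel {x..y} g \<and> f y - f x = (LINT t:{x..y}|lborel. g t)" by simp
qed

text \<open>Integration by parts over the convex hull \<open>{a..b}\<close> of the support of
  \<open>\<phi>\<close>. The boundary terms vanish because \<open>\<phi>\<close> is continuous and
  equals 0 outside \<open>{a..b}\<close>.\<close>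

lemma ac_deriv_imp_is_weak_deriv:
  assumes ac: "ac_deriv I f g" and I: "is_interval I" and f: "continuous_on I f"
  shows "is_weak_deriv I f g"
  unfolding is_weak_deriv_def
proof (intro conjI allI impI)
  have gi: "set_integrable lborel {a..b} g" if "{a..b} \<subseteq> I" for a b
    using ac_derivD(1)[OF ac, of a b] that by (cases "a \<le> b") (auto simp: subset_iff)
  show "locally_integrable I f" unfolding locally_integrable_def set_integrable_def
    by (intro allI impI borel_integrable_compact continuous_on_subset[OF f]) auto
  show "locally_integrable I g" unfolding locally_integrable_def using gi by auto
  fix \<phi> \<phi>' assume tf: "test_fun I \<phi> \<phi>'"
  let ?C = "closure {x. \<phi> x \<noteq> 0}"
  show "(LINT x:I|lborel. f x * \<phi>' x) = - (LINT x:I|lborel. g x * \<phi> x)"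
  proof (cases "?C = {}")
    case True
    then have "\<phi> x = 0" "\<phi>' x = 0" for x using test_fun_eq_0[OF tf, of "{}" x] by auto
    then show ?thesis by (simp add: set_lebesgue_integral_def)
  next
    case False
    have C: "compact ?C" "?C \<subseteq> I" using tf by (auto simp: test_fun_def)
    obtain a where a: "a \<in> ?C" "\<And>x. x \<in> ?C \<Longrightarrow> a \<le> x" using compact_attains_inf[OF C(1) False] by auto
    obtain b where b: "b \<in> ?C" "\<And>x. x \<in> ?C \<Longrightarrow> x \<le> b" using compact_attains_sup[OF C(1) False] by auto
    have ab: "a \<le> b" "?C \<subseteq> {a..b}" using a b by auto
    have "a \<in> I" "b \<in> I" using a b C by auto
    then have K: "{a..b} \<subseteq> I" using I unfolding is_interval_1 by fastforce
    have out: "\<phi> t = 0" "\<phi>' t = 0" if "t \<notin> {a..b}" for t using test_fun_eq_0[OF tf ab(2) that] by auto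
    have c\<phi>: "continuous_on UNIV \<phi>"
      using tf unfolding test_fun_def by (meson DERIV_isCont continuous_at_imp_continuous_on)
    have bdry: "\<phi> a = 0" "\<phi> b = 0"
    proof -
      have "(\<phi> \<longlongrightarrow> \<phi> a) (at_left a)" "(\<phi> \<longlongrightarrow> \<phi> b) (at_right b)"
        using c\<phi> by (metis UNIV_I continuous_on_def tendsto_within_subset top_greatest)+
      moreover have "(\<phi> \<longlongrightarrow> 0) (at_left a)" 
        by (rule tendsto_eventually) (auto simp: eventually_at_filter intro!: always_eventually out)
      moreover have "(\<phi> \<longlongrightarrow> 0) (at_right b)"
        by (rule tendsto_eventually) (auto simp: eventually_at_filter intro!: always_eventually out)
      ultimately show "\<phi> a = 0" "\<phi> b = 0"
        by (auto intro: tendsto_unique[rotated] trivial_limit_at_left_real trivial_limit_at_right_real)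
    qed
    have fc: "continuous_on {a..b} f" using f K continuous_on_subset by blast
    have "ac_deriv {a..b} \<phi> \<phi>'"
      using tf unfolding test_fun_def
      by (intro ac_deriv_C1) (auto intro: DERIV_subset continuous_on_subset is_interval_cc)
    from ac_deriv_mult[OF ac_deriv_subset[OF ac K] fc this continuous_on_subset[OF c\<phi>]]
    have "ac_deriv {a..b} (\<lambda>x. f x * \<phi> x) (\<lambda>x. f x * \<phi>' x + g x * \<phi> x)" by (auto simp: is_interval_cc)
    from ac_derivD(2)[OF this, of a b] ab bdry
    have "0 = (LINT x:{a..b}|lborel. f x * \<phi>' x + g x * \<phi> x)" by simp
    also have "\<dots> = (LINT x:{a..b}|lborel. f x * \<phi>' x) + (LINT x:{a..b}|lborel. g x * \<phi> x)"
    proof (rule set_integral_add)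
      show "set_integrable lborel {a..b} (\<lambda>x. f x * \<phi>' x)"
        unfolding set_integrable_def using tf fc
        by (intro borel_integrable_compact continuous_intros) (auto simp: test_fun_def intro: continuous_on_subset)
      show "set_integrable lborel {a..b} (\<lambda>x. g x * \<phi> x)"
        using set_integrable_continuous_mult[OF gi[OF K] continuous_on_subset[OF c\<phi>]] by (simp add: mult.commute)
    qed
    also have "(LINT x:{a..b}|lborel. f x * \<phi>' x) = (LINT x:I|lborel. f x * \<phi>' x)"
      unfolding set_lebesgue_integral_def
      by (intro Bochner_Integration.integral_cong) (use K out in \<open>auto simp: indicator_def\<close>)
    also have "(LINT x:{a..b}|lborel. g x * \<phi> x) = (LINT x:I|lborel. g x * \<phi> x)"
      unfolding set_lebesgue_integral_def
      by (intro Bochner_Integration.integral_cong) (use K out in \<open>auto simp: indicator_def\<close>)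
    finally show ?thesis by simp
  qed
qed

section \<open>Square integrable functions\<close>

lemma integrable_mult_of_squares:
  fixes f g :: "'a \<Rightarrow> real"
  assumes "f \<in> borel_measurable M" "g \<in> borel_measurable M"
    "integrable M (\<lambda>x. (f x)\<^sup>2)" "integrable M (\<lambda>x. (g x)\<^sup>2)"
  shows "integrable M (\<lambda>x. f x * g x)"
proof (rule Bochner_Integration.integrable_bound)
  show "integrable M (\<lambda>x. (f x)\<^sup>2 + (g x)\<^sup>2)" using assms by simp
  show "AE x in M. norm (f x * g x) \<le> norm ((f x)\<^sup>2 + (g x)\<^sup>2)"
  proof (intro always_eventually allI)
    fix x
    have "0 \<le> (\<bar>f x\<bar> - \<bar>g x\<bar>)\<^sup>2" by simp
    then have "2 * (\<bar>f x\<bar> * \<bar>g x\<bar>) \<le> (f x)\<^sup>2 + (g x)\<^sup>2" by (simp add: power2_diff)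
    moreover have "0 \<le> \<bar>f x\<bar> * \<bar>g x\<bar>" by simp
    ultimately have "\<bar>f x\<bar> * \<bar>g x\<bar> \<le> (f x)\<^sup>2 + (g x)\<^sup>2" by linarith
    then show "norm (f x * g x) \<le> norm ((f x)\<^sup>2 + (g x)\<^sup>2)" by (simp add: abs_mult)
  qed
qed (use assms in measurable)

lemma integrable_square_add:
  fixes f g :: "'a \<Rightarrow> real"
  assumes "f \<in> borel_measurable M" "g \<in> borel_measurable M"
    "integrable M (\<lambda>x. (f x)\<^sup>2)" "integrable M (\<lambda>x. (g x)\<^sup>2)"
  shows "integrable M (\<lambda>x. (f x + g x)\<^sup>2)" "integrable M (\<lambda>x. (f x - g x)\<^sup>2)"
  using integrable_mult_of_squares[OF assms] assms
  by (simp_all add: power2_sum power2_diff mult.assoc)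

lemma Fatou_integrable:
  fixes u :: "nat \<Rightarrow> 'a \<Rightarrow> real"
  assumes u: "\<And>n. integrable M (u n)" "\<And>n x. 0 \<le> u n x" "\<And>n. integral\<^sup>L M (u n) \<le> C"
    and v: "v \<in> borel_measurable M" "AE x in M. (\<lambda>n. u n x) \<longlonglongrightarrow> v x"
  shows "integrable M v" "integral\<^sup>L M v \<le> C"
proof -
  have "0 \<le> integral\<^sup>L M (u 0)" using u(2) by (intro Bochner_Integration.integral_nonneg)
  then have C: "0 \<le> C" using u(3)[of 0] by linarith
  have um: "u n \<in> borel_measurable M" for n using u(1) by simp
  have nn: "AE x in M. 0 \<le> v x" using v(2)
    by eventually_elim (use u(2) in \<open>auto intro: LIMSEQ_le_const\<close>)
  have "(\<integral>\<^sup>+x. ennreal (v x) \<partial>M) = (\<integral>\<^sup>+x. liminf (\<lambda>n. ennreal (u n x)) \<partial>M)"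
  proof (rule nn_integral_cong_AE)
    show "AE x in M. ennreal (v x) = liminf (\<lambda>n. ennreal (u n x))" using v(2)
    proof eventually_elim
      fix x assume "(\<lambda>n. u n x) \<longlonglongrightarrow> v x"
      then have "(\<lambda>n. ennreal (u n x)) \<longlonglongrightarrow> ennreal (v x)" by (intro tendsto_ennrealI)
      then show "ennreal (v x) = liminf (\<lambda>n. ennreal (u n x))"
        using lim_imp_Liminf[OF trivial_limit_sequentially] by fastforce
    qed
  qed
  also have "\<dots> \<le> liminf (\<lambda>n. \<integral>\<^sup>+x. ennreal (u n x) \<partial>M)"
    using um by (intro nn_integral_liminf) auto
  also have "\<dots> = liminf (\<lambda>n. ennreal (integral\<^sup>L M (u n)))"
    using u by (subst nn_integral_eq_integral) auto
  also have "\<dots> \<le> ennreal C"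
    using u(3) by (intro Liminf_le) (auto intro!: always_eventually ennreal_leI)
  finally have b: "(\<integral>\<^sup>+x. ennreal (v x) \<partial>M) \<le> ennreal C" .
  then have "(\<integral>\<^sup>+x. ennreal (v x) \<partial>M) < \<infinity>" by (simp add: order_le_less_trans ennreal_less_top)
  then show i: "integrable M v" using v(1) nn by (intro integrableI_nonneg) auto
  show "integral\<^sup>L M v \<le> C"
    using b C nn_integral_eq_integral[OF i nn] by simp
qed

text \<open>A rapidly Cauchy subsequence converges almost everywhere.\<close>

lemma L2_complete:
  fixes G :: "nat \<Rightarrow> 'a \<Rightarrow> real"
  assumes m: "\<And>n. G n \<in> borel_measurable M" and i: "\<And>n. integrable M (\<lambda>x. (G n x)\<^sup>2)"
    and C: "\<And>e. e > 0 \<Longrightarrow> \<exists>N. \<forall>m\<ge>N. \<forall>n\<ge>N. (LINT x|M. (G m x - G n x)\<^sup>2) < e"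
  obtains H where "H \<in> borel_measurable M" "integrable M (\<lambda>x. (H x)\<^sup>2)"
    "(\<lambda>n. LINT x|M. (G n x - H x)\<^sup>2) \<longlonglongrightarrow> 0"
proof -
  note [measurable] = m
  have di: "integrable M (\<lambda>x. (G a x - G b x)\<^sup>2)" for a b
    by (rule integrable_square_add) (use m i in auto)
  \<comment> \<open>The rate \<open>1/8\<close> is tuned to the weight \<open>4^k\<close> used next:
    the weighted integrals are bounded by \<open>(1/2)^k\<close> and summable, and finiteness of the
    weighted sum at a point forces \<open>\<bar>d k x\<bar>\<close> below a multiple of
    \<open>(1/2)^k\<close>.\<close>
  have "\<exists>N. \<forall>m\<ge>N. \<forall>n\<ge>N. (LINT x|M. (G m x - G n x)\<^sup>2) < (1/8)^k" for k :: nat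
    by (rule C) simp
  then obtain N where N: "\<And>k m n. m \<ge> N k \<Longrightarrow> n \<ge> N k \<Longrightarrow> (LINT x|M. (G m x - G n x)\<^sup>2) < (1/8)^k"
    by metis
  \<comment> \<open>The partial sum makes \<open>r\<close> monotone and at least \<open>N k\<close>;
    the summand \<open>k\<close> makes it tend to infinity.\<close>
  define r where "r k = (\<Sum>j\<le>k. N j) + k" for k
  have rN: "r k \<ge> N k" for k unfolding r_def using member_le_sum[of k "{..k}" N] by simp
  have rmono: "r k \<le> r (Suc k)" for k by (simp add: r_def)
  have rk: "r k \<ge> k" for k by (simp add: r_def)
  define d where "d k x = G (r (Suc k)) x - G (r k) x" for k x
  have dm [measurable]: "d k \<in> borel_measurable M" for k unfolding d_def by measurable
  have dint: "(LINT x|M. (d k x)\<^sup>2) \<le> (1/8)^k" for k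
    unfolding d_def using N[of k "r (Suc k)" "r k"] rN[of k] rmono[of k] by simp
  have "(\<integral>\<^sup>+x. (\<Sum>k. ennreal (4^k * (d k x)\<^sup>2)) \<partial>M) = (\<Sum>k. \<integral>\<^sup>+x. ennreal (4^k * (d k x)\<^sup>2) \<partial>M)"
    by (rule nn_integral_suminf) measurable
  also have "\<dots> \<le> (\<Sum>k. ennreal ((1/2)^k))"
  proof (rule suminf_le)
    fix k
    have "(\<integral>\<^sup>+x. ennreal (4^k * (d k x)\<^sup>2) \<partial>M) = ennreal (LINT x|M. 4^k * (d k x)\<^sup>2)"
      using di by (intro nn_integral_eq_integral) (auto simp: d_def)
    also have "(LINT x|M. 4^k * (d k x)\<^sup>2) = 4^k * (LINT x|M. (d k x)\<^sup>2)" by simp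
    also have "\<dots> \<le> 4^k * (1/8)^k" using dint[of k] by (intro mult_left_mono) auto
    also have "\<dots> = (1/2)^k" by (simp add: power_mult_distrib[symmetric])
    finally show "(\<integral>\<^sup>+x. ennreal (4^k * (d k x)\<^sup>2) \<partial>M) \<le> ennreal ((1/2)^k)" by (simp add: ennreal_leI)
  qed auto
  also have "\<dots> = ennreal (\<Sum>k. (1/2)^k)" by (rule suminf_ennreal2[OF _ summable_geometric]) auto
  also have "\<dots> < \<infinity>" by simp
  finally have fin: "(\<integral>\<^sup>+x. (\<Sum>k. ennreal (4^k * (d k x)\<^sup>2)) \<partial>M) \<noteq> \<infinity>" by simp
  have "AE x in M. (\<Sum>k. ennreal (4^k * (d k x)\<^sup>2)) \<noteq> \<infinity>"
    by (rule nn_integral_PInf_AE[OF _ fin]) measurable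
  then have conv: "AE x in M. convergent (\<lambda>k. G (r k) x)"
  proof eventually_elim
    fix x assume "(\<Sum>k. ennreal (4^k * (d k x)\<^sup>2)) \<noteq> \<infinity>"
    moreover have "\<exists>c\<ge>0. y = ennreal c" if "y \<noteq> \<infinity>" for y
      using that by (cases y) auto
    ultimately obtain c where c: "(\<Sum>k. ennreal (4^k * (d k x)\<^sup>2)) = ennreal c" "c \<ge> 0" by blast
    have "\<bar>d k x\<bar> \<le> sqrt c * (1/2)^k" for k
    proof -
      have "a k \<le> suminf a" for a :: "nat \<Rightarrow> ennreal" using sum_le_suminf[of a "{k}"] by simp
      from this[of "\<lambda>k. ennreal (4^k * (d k x)\<^sup>2)"] have "4^k * (d k x)\<^sup>2 \<le> c"
        unfolding c(1) ennreal_le_iff[OF c(2)] .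
      moreover have "(2^k)\<^sup>2 = ((2::real)\<^sup>2)^k" by (simp only: power_mult[symmetric] mult.commute)
      ultimately have "(2^k * \<bar>d k x\<bar>)\<^sup>2 \<le> c" by (simp add: power_mult_distrib)
      then have "2^k * \<bar>d k x\<bar> \<le> sqrt c" by (simp add: real_le_rsqrt)
      then show ?thesis by (simp add: field_simps power_divide)
    qed
    then have "summable (\<lambda>k. d k x)"
      by (intro summable_comparison_test[OF _ summable_mult[OF summable_geometric[of "1/2::real"], of "sqrt c"]]) auto
    then have "convergent (\<lambda>n. \<Sum>k<n. d k x)" by (simp add: summable_iff_convergent)
    moreover have "(\<Sum>k<n. d k x) = G (r n) x - G (r 0) x" for n
      unfolding d_def by (rule sum_lessThan_telescope)
    ultimately have "convergent (\<lambda>n. G (r n) x - G (r 0) x)" by simp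
    then have "convergent (\<lambda>n. G (r n) x - G (r 0) x + G (r 0) x)" by (intro convergent_add convergent_const)
    then show "convergent (\<lambda>k. G (r k) x)" by simp
  qed
  define H where "H x = lim (\<lambda>k. G (r k) x)" for x
  have Hm [measurable]: "H \<in> borel_measurable M" unfolding H_def by measurable
  have Hlim: "AE x in M. (\<lambda>k. G (r k) x) \<longlonglongrightarrow> H x"
    using conv by eventually_elim (simp add: H_def convergent_LIMSEQ_iff)
  \<comment> \<open>Fatou's lemma along the subsequence: the Cauchy bound between \<open>G n\<close>
    and \<open>G (r k)\<close> survives in the limit \<open>k\<close> to infinity.\<close>
  have est: "integrable M (\<lambda>x. (G n x - H x)\<^sup>2) \<and> (LINT x|M. (G n x - H x)\<^sup>2) \<le> e"
    if "\<forall>m\<ge>K. \<forall>n\<ge>K. (LINT x|M. (G m x - G n x)\<^sup>2) < e" "n \<ge> K" for n K e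
  proof -
    have "r (k + K) \<ge> K" for k using rk[of "k+K"] by linarith
    then have b: "(LINT x|M. (G n x - G (r (k + K)) x)\<^sup>2) \<le> e" for k using that by (simp add: less_imp_le)
    have "AE x in M. (\<lambda>k. (G n x - G (r (k + K)) x)\<^sup>2) \<longlonglongrightarrow> (G n x - H x)\<^sup>2"
      using Hlim
    proof eventually_elim
      fix x assume "(\<lambda>k. G (r k) x) \<longlonglongrightarrow> H x"
      then have "(\<lambda>k. G (r (k + K)) x) \<longlonglongrightarrow> H x" by (rule LIMSEQ_ignore_initial_segment)
      then show "(\<lambda>k. (G n x - G (r (k + K)) x)\<^sup>2) \<longlonglongrightarrow> (G n x - H x)\<^sup>2"
        by (intro tendsto_intros)
    qed
    from Fatou_integrable[OF _ _ b _ this] di show ?thesis by simp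
  qed
  have "integrable M (\<lambda>x. (H x)\<^sup>2)"
  proof -
    obtain K where "\<forall>m\<ge>K. \<forall>n\<ge>K. (LINT x|M. (G m x - G n x)\<^sup>2) < 1" using C[of 1] by auto
    from est[OF this, of K] have "integrable M (\<lambda>x. (G K x - H x)\<^sup>2)" by simp
    from integrable_square_add(2)[OF m[of K] _ i[of K] this] show ?thesis by simp
  qed
  moreover have "(\<lambda>n. LINT x|M. (G n x - H x)\<^sup>2) \<longlonglongrightarrow> 0"
  proof (rule LIMSEQ_I)
    fix e :: real assume "e > 0"
    then obtain K where K: "\<forall>m\<ge>K. \<forall>n\<ge>K. (LINT x|M. (G m x - G n x)\<^sup>2) < e/2" using C[of "e/2"] by auto
    have "norm ((LINT x|M. (G n x - H x)\<^sup>2) - 0) < e" if "n \<ge> K" for n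
      using est[OF K that] \<open>e > 0\<close> by (simp add: abs_of_nonneg Bochner_Integration.integral_nonneg)
    then show "\<exists>no. \<forall>n\<ge>no. norm ((LINT x|M. (G n x - H x)\<^sup>2) - 0) < e" by blast
  qed
  ultimately show thesis using that Hm by blast
qed

section \<open>Sobolev functions on an interval\<close>

lemma LINT_nonneg_mono_set:
  fixes f :: "'a \<Rightarrow> real"
  assumes "set_integrable M B f" "A \<subseteq> B" "A \<in> sets M" "\<And>x. x \<in> B \<Longrightarrow> 0 \<le> f x"
  shows "(LINT x:A|M. f x) \<le> (LINT x:B|M. f x)"
  unfolding set_lebesgue_integral_def
proof (rule integral_mono)
  show "integrable M (\<lambda>x. indicat_real A x *\<^sub>R f x)"
    using set_integrable_subset[OF assms(1,3,2)] by (simp add: set_integrable_def)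
  show "integrable M (\<lambda>x. indicat_real B x *\<^sub>R f x)" using assms(1) by (simp add: set_integrable_def)
  fix x show "indicat_real A x *\<^sub>R f x \<le> indicat_real B x *\<^sub>R f x"
    using assms(2,4) by (auto simp: indicator_def)
qed

lemma LINT_nonneg:
  fixes f :: "'a \<Rightarrow> real"
  assumes "\<And>x. x \<in> A \<Longrightarrow> 0 \<le> f x"
  shows "0 \<le> (LINT x:A|M. f x)"
  unfolding set_lebesgue_integral_def
  by (intro Bochner_Integration.integral_nonneg) (use assms in \<open>auto simp: indicator_def\<close>)

lemma set_borel_measurable_mult:
  fixes f g :: "'a \<Rightarrow> real"
  assumes "set_borel_measurable M A f" "set_borel_measurable M A g"
  shows "set_borel_measurable M A (\<lambda>x. f x * g x)"
proof -
  have "(\<lambda>x. (indicat_real A x *\<^sub>R f x) * (indicat_real A x *\<^sub>R g x)) \<in> borel_measurable M"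
    using assms unfolding set_borel_measurable_def by (rule borel_measurable_times)
  also have "(\<lambda>x. (indicat_real A x *\<^sub>R f x) * (indicat_real A x *\<^sub>R g x)) = (\<lambda>x. indicat_real A x *\<^sub>R (f x * g x))"
    by (auto simp: indicator_def)
  finally show ?thesis by (simp add: set_borel_measurable_def)
qed

lemma set_integrable_const_Icc: "set_integrable lborel {x..y::real} (\<lambda>t. c :: real)"
  and LINT_const_Icc: "x \<le> y \<Longrightarrow> (LINT t:{x..y::real}|lborel. c) = (y - x) * (c :: real)"
proof -
  have "integrable lborel (indicat_real {x..y})"
    by (intro integrable_real_indicator) (auto simp: emeasure_lborel_Icc_eq)
  then show "set_integrable lborel {x..y} (\<lambda>t. c)" "x \<le> y \<Longrightarrow> (LINT t:{x..y}|lborel. c) = (y - x) * c"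
    by (simp_all add: set_integrable_def set_lebesgue_integral_def)
qed

lemma set_integrable_of_square:
  fixes g :: "real \<Rightarrow> real"
  assumes "set_borel_measurable lborel {x..y} g" "set_integrable lborel {x..y} (\<lambda>t. (g t)\<^sup>2)"
  shows "set_integrable lborel {x..y} g"
proof (rule set_integrable_bound[where f="\<lambda>t. 1 + (g t)\<^sup>2"])
  show "set_integrable lborel {x..y} (\<lambda>t. 1 + (g t)\<^sup>2)"
    using assms by (intro set_integral_add set_integrable_const_Icc)
  show "AE t\<in>{x..y} in lborel. norm (g t) \<le> norm (1 + (g t)\<^sup>2)"
  proof (intro always_eventually allI impI)
    fix t
    have "0 \<le> (\<bar>g t\<bar> - 1)\<^sup>2" by simp
    then have "2 * \<bar>g t\<bar> \<le> (g t)\<^sup>2 + 1" by (simp add: power2_diff)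
    then have "\<bar>g t\<bar> \<le> 1 + (g t)\<^sup>2" using zero_le_power2[of "g t"] by linarith
    then show "norm (g t) \<le> norm (1 + (g t)\<^sup>2)" by simp
  qed
qed (use assms in auto)

text \<open>Cauchy-Schwarz against the constant 1, obtained from the nonnegative integral of
  \<open>(g t - s)\<^sup>2\<close> with \<open>s\<close> the mean of \<open>g\<close>.\<close>

lemma LINT_square_le:
  fixes g :: "real \<Rightarrow> real"
  assumes "x \<le> y" "set_integrable lborel {x..y} g" "set_integrable lborel {x..y} (\<lambda>t. (g t)\<^sup>2)"
  shows "(LINT t:{x..y}|lborel. g t)\<^sup>2 \<le> (y - x) * (LINT t:{x..y}|lborel. (g t)\<^sup>2)"
proof (cases "x = y")
  case True then show ?thesis by (simp add: LINT_Icc_same)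
next
  case False
  then have xy: "y - x > 0" using assms(1) by simp
  define A where "A = (LINT t:{x..y}|lborel. g t)"
  define s where "s = A / (y - x)"
  note ci = set_integrable_const_Icc[of x y] and cv = LINT_const_Icc[OF assms(1)]
  have "0 \<le> (LINT t:{x..y}|lborel. (g t - s)\<^sup>2)" by (rule LINT_nonneg) simp
  also have "(\<lambda>t. (g t - s)\<^sup>2) = (\<lambda>t. (g t)\<^sup>2 + s\<^sup>2 - (2 * s) * g t)" by (auto simp: power2_diff)
  also have "(LINT t:{x..y}|lborel. (g t)\<^sup>2 + s\<^sup>2 - (2 * s) * g t) = (LINT t:{x..y}|lborel. (g t)\<^sup>2) + (y - x) * s\<^sup>2 - 2 * s * A"
    using assms ci by (simp add: set_integral_diff set_integral_add cv A_def)
  finally have "0 \<le> (LINT t:{x..y}|lborel. (g t)\<^sup>2) + (y - x) * s\<^sup>2 - 2 * s * A" .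
  moreover have "(y - x) * s = A" using xy by (simp add: s_def)
  then have "(y - x) * s\<^sup>2 = A * s" by (metis mult.assoc power2_eq_square)
  moreover have "A\<^sup>2 / (y - x) = A * s" by (simp add: s_def power2_eq_square)
  ultimately have "A\<^sup>2 / (y - x) \<le> (LINT t:{x..y}|lborel. (g t)\<^sup>2)" by simp
  then show ?thesis using xy by (simp add: A_def field_simps)
qed

text \<open>The derivative is carried as a second function, so that competitors can be given with an
  explicit one. Measurability of \<open>g\<close> is a separate clause because integrability of its
  square does not imply it.\<close>

definition H1_on :: "real set \<Rightarrow> (real \<Rightarrow> real) \<Rightarrow> (real \<Rightarrow> real) \<Rightarrow> bool" where
  "H1_on D f g \<longleftrightarrow> ac_deriv D f g \<and> set_borel_measurable lborel D g \<and>
     set_integrable lborel D (\<lambda>x. (g x)\<^sup>2) \<and> set_integrable lborel D (\<lambda>x. (f x)\<^sup>2)"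

lemma H1_onD:
  assumes "H1_on D f g"
  shows "ac_deriv D f g" "set_borel_measurable lborel D g"
    "set_integrable lborel D (\<lambda>x. (g x)\<^sup>2)" "set_integrable lborel D (\<lambda>x. (f x)\<^sup>2)"
  using assms by (auto simp: H1_on_def)

lemma set_borel_measurable_mono:
  fixes f :: "'a \<Rightarrow> real"
  assumes "set_borel_measurable M B f" "A \<subseteq> B" "A \<in> sets M"
  shows "set_borel_measurable M A f"
  using set_borel_measurable_subset[of M B f A] assms by simp

lemma H1_on_subset:
  assumes "H1_on D f g" "D' \<subseteq> D" "D' \<in> sets borel"
  shows "H1_on D' f g"
  using assms ac_deriv_subset[of D f g D'] set_borel_measurable_mono[of lborel D g D']
    set_integrable_subset[of lborel D _ D'] by (auto simp: H1_on_def)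

lemma H1_on_cmult:
  assumes "H1_on D f g"
  shows "H1_on D (\<lambda>x. c * f x) (\<lambda>x. c * g x)"
  using assms ac_deriv_cmult[of D f g c] unfolding H1_on_def set_borel_measurable_def
  by (auto simp: power_mult_distrib mult.left_commute[of _ c])

lemma H1_on_Holder:
  assumes "H1_on D f g" "is_interval D" "x \<in> D" "y \<in> D" "x \<le> y"
  shows "(f y - f x)\<^sup>2 \<le> (y - x) * (LINT t:D|lborel. (g t)\<^sup>2)"
proof -
  have sub: "{x..y} \<subseteq> D" using assms unfolding is_interval_1 by fastforce
  note g = H1_onD[OF assms(1)]
  have "(f y - f x)\<^sup>2 = (LINT t:{x..y}|lborel. g t)\<^sup>2" using ac_derivD(2)[OF g(1)] assms by simp
  also have "\<dots> \<le> (y - x) * (LINT t:{x..y}|lborel. (g t)\<^sup>2)"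
    using assms sub by (intro LINT_square_le ac_derivD(1)[OF g(1)] set_integrable_subset[OF g(3)]) auto
  also have "\<dots> \<le> (y - x) * (LINT t:D|lborel. (g t)\<^sup>2)"
    using assms sub by (intro mult_left_mono LINT_nonneg_mono_set g) auto
  finally show ?thesis .
qed

text \<open>A common bound \<open>C\<close> for a family makes this an equicontinuity estimate; it
  upgrades convergence at rational points to convergence everywhere.\<close>

lemma H1_on_Holder':
  assumes "H1_on D f g" "is_interval D" "x \<in> D" "y \<in> D" "(LINT t:D|lborel. (g t)\<^sup>2) \<le> C"
  shows "(f y - f x)\<^sup>2 \<le> \<bar>y - x\<bar> * C"
proof -
  have "(f y - f x)\<^sup>2 \<le> \<bar>y - x\<bar> * (LINT t:D|lborel. (g t)\<^sup>2)"
  proof (cases "x \<le> y")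
    case True then show ?thesis using H1_on_Holder[OF assms(1-4)] by simp
  next
    case False then show ?thesis using H1_on_Holder[OF assms(1,2,4,3)] by (simp add: power2_commute)
  qed
  also have "\<dots> \<le> \<bar>y - x\<bar> * C" using assms(5) by (intro mult_left_mono) auto
  finally show ?thesis .
qed

lemma H1_on_continuous:
  assumes "H1_on D f g" "is_interval D"
  shows "continuous_on D f"
  unfolding continuous_on_def
proof
  fix x assume x: "x \<in> D"
  define T where "T = (LINT t:D|lborel. (g t)\<^sup>2)"
  have "((\<lambda>y. f y - f x) \<longlongrightarrow> 0) (at x within D)"
  proof (rule Lim_null_comparison)
    show "\<forall>\<^sub>F y in at x within D. norm (f y - f x) \<le> sqrt (\<bar>y - x\<bar> * T)"
      unfolding eventually_at_filter
    proof (intro always_eventually allI impI)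
      fix y assume "y \<in> D"
      from H1_on_Holder'[OF assms x this, of T] have "(f y - f x)\<^sup>2 \<le> \<bar>y - x\<bar> * T" by (simp add: T_def)
      then show "norm (f y - f x) \<le> sqrt (\<bar>y - x\<bar> * T)" by (simp add: real_le_rsqrt)
    qed
    have "((\<lambda>y. sqrt (\<bar>y - x\<bar> * T)) \<longlongrightarrow> sqrt (\<bar>x - x\<bar> * T)) (at x within D)"
      by (intro tendsto_intros)
    then show "((\<lambda>y. sqrt (\<bar>y - x\<bar> * T)) \<longlongrightarrow> 0) (at x within D)" by simp
  qed
  then show "(f \<longlongrightarrow> f x) (at x within D)" by (simp add: LIM_zero_iff)
qed

lemma set_borel_measurable_cont:
  fixes f :: "real \<Rightarrow> real"
  assumes "continuous_on D f" "D \<in> sets borel"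
  shows "set_borel_measurable lborel D f"
  using borel_measurable_continuous_on_indicator[OF assms(2,1)] by (simp add: set_borel_measurable_def)

text \<open>Weak compactness without weak convergence: all pairs \<open>(u, h)\<close> with \<open>u' = h\<close> and
  \<open>\<bar>u - F\<bar> \<le> e n\<close>, where \<open>e n\<close> is the tail supremum of \<open>\<bar>f k - F\<bar>\<close>, form a decreasing
  sequence of convex sets; by the parallelogram law, almost minimal elements \<open>h\<close> are Cauchy.\<close>

lemma H1_on_limit:
  assumes fg: "\<And>n. H1_on D (f n) (g n)" and D: "is_interval D" "D \<in> sets borel"
    and C: "\<And>n. (LINT t:D|lborel. (g n t)\<^sup>2) \<le> C" and C': "\<And>n. (LINT t:D|lborel. (f n t)\<^sup>2) \<le> C'"
    and lim: "\<And>x. x \<in> D \<Longrightarrow> (\<lambda>n. f n x) \<longlonglongrightarrow> F x"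
  obtains G where "H1_on D F G" "(LINT t:D|lborel. (G t)\<^sup>2) \<le> C"
proof -
  define e where "e n x = (SUP k\<in>{n..}. \<bar>f k x - F x\<bar>)" for n x
  have bdd: "bdd_above ((\<lambda>k. \<bar>f k x - F x\<bar>) ` {n..})" if "x \<in> D" for x n
  proof -
    have "(\<lambda>n. \<bar>f n x - F x\<bar>) \<longlonglongrightarrow> \<bar>F x - F x\<bar>" by (intro tendsto_intros lim that)
    then have "Bseq (\<lambda>n. \<bar>f n x - F x\<bar>)" by (intro convergent_imp_Bseq convergentI)
    then obtain K where "\<And>n. norm \<bar>f n x - F x\<bar> \<le> K" by (auto simp: Bseq_def)
    then show ?thesis by (intro bdd_aboveI2[of _ _ K]) simp
  qed
  have e_ub: "\<bar>f k x - F x\<bar> \<le> e n x" if "x \<in> D" "n \<le> k" for x n k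
    unfolding e_def using that by (intro cSUP_upper bdd) auto
  have e_anti: "e m x \<le> e n x" if "x \<in> D" "n \<le> m" for x n m
    unfolding e_def using that by (intro cSUP_subset_mono bdd) auto
  have e0: "(\<lambda>n. e n x) \<longlonglongrightarrow> 0" if x: "x \<in> D" for x
  proof (rule LIMSEQ_I)
    fix r :: real assume "r > 0"
    then obtain N where N: "\<And>k. k \<ge> N \<Longrightarrow> \<bar>f k x - F x\<bar> < r / 2"
      using LIMSEQ_D[OF lim[OF x], of "r/2"] by auto
    have "norm (e n x - 0) < r" if "n \<ge> N" for n
    proof -
      have "e n x \<le> r / 2" unfolding e_def
        by (rule cSUP_least) (use N that in \<open>auto intro: less_imp_le\<close>)
      moreover have "0 \<le> e n x" using e_ub[OF x, of n n] by simp
      ultimately show ?thesis using \<open>r > 0\<close> by simp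
    qed
    then show "\<exists>no. \<forall>n\<ge>no. norm (e n x - 0) < r" by blast
  qed
  define K where "K n = {(u, h). ac_deriv D u h \<and> set_borel_measurable lborel D h \<and>
     set_integrable lborel D (\<lambda>x. (h x)\<^sup>2) \<and> (\<forall>x\<in>D. \<bar>u x - F x\<bar> \<le> e n x)}" for n
  define E where "E n = (\<lambda>(u, h). LINT t:D|lborel. (h t :: real)\<^sup>2) ` K n" for n
  have fK: "(f k, g k) \<in> K n" if "n \<le> k" for n k
    using fg[of k] e_ub that by (auto simp: K_def H1_on_def)
  have K_anti: "K m \<subseteq> K n" if "n \<le> m" for m n
    unfolding K_def using e_anti[OF _ that] by (fastforce intro: order_trans)
  have E0: "0 \<le> y" if "y \<in> E n" for y n using that by (auto simp: E_def intro!: LINT_nonneg)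
  then have Ebdd: "bdd_below (E n)" for n by (meson bdd_belowI)
  have Ene: "E n \<noteq> {}" for n using fK[of n n] by (auto simp: E_def)
  define d where "d n = Inf (E n)" for n
  have d_le: "d n \<le> y" if "y \<in> E n" for n y unfolding d_def using that Ebdd by (rule cInf_lower)
  have dC: "d n \<le> C" for n
  proof -
    have "(LINT t:D|lborel. (g n t)\<^sup>2) \<in> E n" unfolding E_def using fK[of n n] by (force intro!: image_eqI[of _ _ "(f n, g n)"])
    then show ?thesis using d_le C[of n] by fastforce
  qed
  have "incseq d" unfolding incseq_def d_def
  proof (intro allI impI)
    fix m n :: nat assume "m \<le> n"
    then have "E n \<subseteq> E m" unfolding E_def by (intro image_mono K_anti)
    then show "Inf (E m) \<le> Inf (E n)" by (rule cInf_superset_mono[OF Ene Ebdd])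
  qed
  then obtain dl where dl: "d \<longlonglongrightarrow> dl" "\<And>n. d n \<le> dl"
    using incseq_convergent[of d C] dC by metis
  have "\<exists>p. p \<in> K n \<and> (LINT t:D|lborel. (snd p t)\<^sup>2) < d n + 1 / Suc n" for n
  proof -
    have "\<exists>y\<in>E n. y < d n + 1 / Suc n"
      unfolding d_def by (intro cInf_lessD Ene) simp
    then show ?thesis by (force simp: E_def)
  qed
  then obtain p where p: "\<And>n. p n \<in> K n" "\<And>n. (LINT t:D|lborel. (snd (p n) t)\<^sup>2) < d n + 1 / Suc n" by metis
  define u where "u n = fst (p n)" for n
  define h where "h n = snd (p n)" for n
  have uh: "ac_deriv D (u n) (h n)" "set_borel_measurable lborel D (h n)"
    "set_integrable lborel D (\<lambda>x. (h n x)\<^sup>2)" "\<And>x. x \<in> D \<Longrightarrow> \<bar>u n x - F x\<bar> \<le> e n x" for n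
    using p(1)[of n] by (auto simp: K_def u_def h_def case_prod_unfold)
  define H where "H n t = indicator D t *\<^sub>R h n t" for n t
  have Hm: "H n \<in> borel_measurable lborel" for n using uh(2)[of n] unfolding H_def[abs_def] set_borel_measurable_def .
  have Hsq: "(\<lambda>t. (H n t)\<^sup>2) = (\<lambda>t. indicator D t *\<^sub>R (h n t)\<^sup>2)" for n by (auto simp: H_def indicator_def)
  have Hi: "integrable lborel (\<lambda>t. (H n t)\<^sup>2)" for n using uh(3)[of n] unfolding Hsq set_integrable_def .
  have HE: "(LINT t|lborel. (H n t)\<^sup>2) < d n + 1 / Suc n" for n
    using p(2)[of n] unfolding Hsq set_lebesgue_integral_def h_def[symmetric] .
  \<comment> \<open>Convexity enters here: the midpoint of two elements of \<open>K N\<close> is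
    again in \<open>K N\<close>, so its energy is at least \<open>d N\<close>. This is the lower
    bound that the parallelogram identity \<open>par\<close> needs.\<close>
  have mid: "4 * d N \<le> (LINT t|lborel. (H m t + H n t)\<^sup>2)" if "N \<le> m" "N \<le> n" for N m n
  proof -
    let ?w = "\<lambda>x. 1/2 * (u m x + u n x)" and ?k = "\<lambda>x. 1/2 * (h m x + h n x)"
    have sq: "(\<lambda>t. (H m t + H n t)\<^sup>2) = (\<lambda>t. 4 * (indicator D t *\<^sub>R (?k t)\<^sup>2))"
      by (auto simp: H_def indicator_def power_mult_distrib power_divide)
    have si: "integrable lborel (\<lambda>t. (H m t + H n t)\<^sup>2)" by (rule integrable_square_add) (use Hm Hi in auto)
    have "(?w, ?k) \<in> K N"
    proof -
      have "ac_deriv D ?w ?k" by (intro ac_deriv_cmult ac_deriv_add uh)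
      moreover have "set_borel_measurable lborel D ?k"
      proof -
        have "(\<lambda>t. 1/2 * (H m t + H n t)) \<in> borel_measurable lborel" using Hm by (intro borel_measurable_times borel_measurable_add) auto
        moreover have "(\<lambda>t. 1/2 * (H m t + H n t)) = (\<lambda>t. indicator D t *\<^sub>R ?k t)" by (auto simp: H_def algebra_simps)
        ultimately show ?thesis by (simp add: set_borel_measurable_def)
      qed
      moreover have "set_integrable lborel D (\<lambda>t. (?k t)\<^sup>2)"
        using si unfolding sq set_integrable_def by simp
      moreover have "\<bar>?w x - F x\<bar> \<le> e N x" if "x \<in> D" for x
      proof -
        have "\<bar>u m x - F x\<bar> \<le> e N x" "\<bar>u n x - F x\<bar> \<le> e N x"
          using uh(4)[OF that] e_anti[OF that \<open>N \<le> m\<close>] e_anti[OF that \<open>N \<le> n\<close>] order_trans by blast+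
        then have "\<bar>(u m x - F x) + (u n x - F x)\<bar> \<le> 2 * e N x" by linarith
        moreover have "?w x - F x = ((u m x - F x) + (u n x - F x)) / 2" by (simp add: field_simps)
        moreover have "\<bar>a / 2\<bar> \<le> c" if "\<bar>a\<bar> \<le> 2 * c" for a c :: real using that by (simp add: abs_le_iff)
        ultimately show ?thesis by metis
      qed
      ultimately show ?thesis by (simp add: K_def)
    qed
    then have "(LINT t:D|lborel. (?k t)\<^sup>2) \<in> E N" unfolding E_def by (force intro!: image_eqI[of _ _ "(?w, ?k)"])
    from d_le[OF this] show ?thesis unfolding sq by (simp add: set_lebesgue_integral_def)
  qed
  have par: "(LINT t|lborel. (H m t - H n t)\<^sup>2) = 2 * (LINT t|lborel. (H m t)\<^sup>2) + 2 * (LINT t|lborel. (H n t)\<^sup>2)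
     - (LINT t|lborel. (H m t + H n t)\<^sup>2)" for m n
  proof -
    have si: "integrable lborel (\<lambda>t. (H m t + H n t)\<^sup>2)" by (rule integrable_square_add) (use Hm Hi in auto)
    have "(\<lambda>t. (H m t - H n t)\<^sup>2) = (\<lambda>t. 2 * (H m t)\<^sup>2 + 2 * (H n t)\<^sup>2 - (H m t + H n t)\<^sup>2)"
      by (auto simp: power2_sum power2_diff)
    then show ?thesis using Hi si by simp
  qed
  have Cauchy: "\<exists>N. \<forall>m\<ge>N. \<forall>n\<ge>N. (LINT t|lborel. (H m t - H n t)\<^sup>2) < r" if "r > 0" for r
  proof -
    \<comment> \<open>The eight shares of \<open>r\<close>: each of the two excesses
      \<open>1 / Suc n\<close> enters with factor 2, and the gap between \<open>d N\<close> and
      \<open>dl\<close> with factor 4.\<close>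
    obtain N1 where N1: "\<And>n. n \<ge> N1 \<Longrightarrow> \<bar>d n - dl\<bar> < r / 8" using LIMSEQ_D[OF dl(1), of "r/8"] \<open>r > 0\<close> by auto
    obtain N2 where N2: "1 / real (Suc N2) < r / 8" using nat_approx_posE[of "r/8"] \<open>r > 0\<close> by auto
    define N where "N = max N1 N2"
    have "(LINT t|lborel. (H m t - H n t)\<^sup>2) < r" if mn: "m \<ge> N" "n \<ge> N" for m n
    proof -
      have "1 / real (Suc k) \<le> 1 / real (Suc N2)" if "k \<ge> N" for k using that by (simp add: N_def field_simps)
      from this[OF mn(1)] this[OF mn(2)] N2 have "1 / real (Suc m) < r / 8" "1 / real (Suc n) < r / 8" by auto
      moreover have "\<bar>d N - dl\<bar> < r / 8" by (rule N1) (simp add: N_def)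
      then have "d N > dl - r / 8" by linarith
      ultimately show ?thesis
        using par[of m n] mid[OF mn] HE[of m] HE[of n] dl(2)[of m] dl(2)[of n] by linarith
    qed
    then show ?thesis by blast
  qed
  obtain G where G: "G \<in> borel_measurable lborel" "integrable lborel (\<lambda>t. (G t)\<^sup>2)"
    "(\<lambda>n. LINT t|lborel. (H n t - G t)\<^sup>2) \<longlonglongrightarrow> 0"
    using L2_complete[OF Hm Hi Cauchy] by blast
  have dGi: "integrable lborel (\<lambda>t. (H n t - G t)\<^sup>2)" for n by (rule integrable_square_add) (use Hm Hi G in auto)
  have si: "set_integrable lborel A k" if "integrable lborel k" "A \<in> sets borel" for A and k :: "real \<Rightarrow> real"
    unfolding set_integrable_def using that by (intro integrable_mult_indicator) auto
  have "ac_deriv D F G"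
    unfolding ac_deriv_def
  proof (intro ballI impI)
    fix x y assume xy: "x \<in> D" "y \<in> D" "x \<le> y"
    have sub: "{x..y} \<subseteq> D" using D(1) xy unfolding is_interval_1 by fastforce
    have gi: "set_integrable lborel {x..y} k" if "k \<in> borel_measurable lborel" "integrable lborel (\<lambda>t. (k t)\<^sup>2)" for k :: "real \<Rightarrow> real"
    proof (rule set_integrable_of_square)
      show "set_borel_measurable lborel {x..y} k"
        unfolding set_borel_measurable_def using that(1) by measurable
    qed (rule si[OF that(2)], simp)
    have Hh: "(LINT t:{x..y}|lborel. H n t) = u n y - u n x" for n
    proof -
      have "(LINT t:{x..y}|lborel. H n t) = (LINT t:{x..y}|lborel. h n t)"
        unfolding set_lebesgue_integral_def
        by (intro Bochner_Integration.integral_cong) (use sub in \<open>auto simp: H_def indicator_def\<close>)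
      then show ?thesis using ac_derivD(2)[OF uh(1) xy, of n] by simp
    qed
    have "(\<lambda>n. u n y - u n x - (LINT t:{x..y}|lborel. G t)) \<longlonglongrightarrow> 0"
    proof (rule Lim_null_comparison)
      show "\<forall>\<^sub>F n in sequentially. norm (u n y - u n x - (LINT t:{x..y}|lborel. G t)) \<le> sqrt ((y - x) * (LINT t|lborel. (H n t - G t)\<^sup>2))"
      proof (intro always_eventually allI)
        fix n
        have "u n y - u n x - (LINT t:{x..y}|lborel. G t) = (LINT t:{x..y}|lborel. H n t - G t)"
          unfolding Hh[symmetric] using gi[OF Hm Hi] gi[OF G(1,2)] by (simp add: set_integral_diff)
        moreover have "(LINT t:{x..y}|lborel. H n t - G t)\<^sup>2 \<le> (y - x) * (LINT t:{x..y}|lborel. (H n t - G t)\<^sup>2)"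
          using xy Hm[of n] G(1) by (intro LINT_square_le gi si dGi) (auto intro!: borel_measurable_diff)
        moreover have "(LINT t:{x..y}|lborel. (H n t - G t)\<^sup>2) \<le> (LINT t:UNIV|lborel. (H n t - G t)\<^sup>2)"
          by (intro LINT_nonneg_mono_set si dGi) auto
        then have "(y - x) * (LINT t:{x..y}|lborel. (H n t - G t)\<^sup>2) \<le> (y - x) * (LINT t|lborel. (H n t - G t)\<^sup>2)"
          using xy by (intro mult_left_mono) (auto simp: set_lebesgue_integral_def)
        ultimately show "norm (u n y - u n x - (LINT t:{x..y}|lborel. G t)) \<le> sqrt ((y - x) * (LINT t|lborel. (H n t - G t)\<^sup>2))"
          by (simp add: real_le_rsqrt)
      qed
      have "(\<lambda>n. sqrt ((y - x) * (LINT t|lborel. (H n t - G t)\<^sup>2))) \<longlonglongrightarrow> sqrt ((y - x) * 0)"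
        by (intro tendsto_real_sqrt tendsto_mult tendsto_const G(3))
      then show "(\<lambda>n. sqrt ((y - x) * (LINT t|lborel. (H n t - G t)\<^sup>2))) \<longlonglongrightarrow> 0" by simp
    qed
    then have "(\<lambda>n. u n y - u n x) \<longlonglongrightarrow> (LINT t:{x..y}|lborel. G t)" by (simp add: LIM_zero_iff)
    moreover have "(\<lambda>n. u n z) \<longlonglongrightarrow> F z" if "z \<in> D" for z
    proof -
      have "(\<lambda>n. u n z - F z) \<longlonglongrightarrow> 0"
        by (rule Lim_null_comparison[OF _ e0[OF that]]) (use uh(4)[OF that] in auto)
      then show ?thesis by (simp add: LIM_zero_iff)
    qed
    then have "(\<lambda>n. u n y - u n x) \<longlonglongrightarrow> F y - F x" using xy by (intro tendsto_diff) auto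
    ultimately have "F y - F x = (LINT t:{x..y}|lborel. G t)" using LIMSEQ_unique by blast
    with gi[OF G(1,2)] show "set_integrable lborel {x..y} G \<and> F y - F x = (LINT t:{x..y}|lborel. G t)" by simp
  qed
  moreover have "set_borel_measurable lborel D G"
    unfolding set_borel_measurable_def using G(1) D(2) by measurable
  moreover have "set_integrable lborel D (\<lambda>t. (G t)\<^sup>2)" using si[OF G(2) D(2)] .
  moreover have "set_integrable lborel D (\<lambda>t. (F t)\<^sup>2)"
    unfolding set_integrable_def
  proof (rule Fatou_integrable(1)[where u="\<lambda>n t. indicator D t *\<^sub>R (f n t)\<^sup>2" and C=C'])
    show "integrable lborel (\<lambda>t. indicat_real D t *\<^sub>R (f n t)\<^sup>2)" for n
      using H1_onD(4)[OF fg[of n]] by (simp add: set_integrable_def)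
    show "integral\<^sup>L lborel (\<lambda>t. indicat_real D t *\<^sub>R (f n t)\<^sup>2) \<le> C'" for n
      using C'[of n] by (simp add: set_lebesgue_integral_def)
    show "AE x in lborel. (\<lambda>n. indicat_real D x *\<^sub>R (f n x)\<^sup>2) \<longlonglongrightarrow> indicat_real D x *\<^sub>R (F x)\<^sup>2"
      using lim by (auto intro!: tendsto_intros simp: indicator_def)
    show "(\<lambda>x. indicat_real D x *\<^sub>R (F x)\<^sup>2) \<in> borel_measurable lborel"
    proof (rule borel_measurable_LIMSEQ_real)
      show "(\<lambda>n. indicat_real D x *\<^sub>R (f n x)\<^sup>2) \<longlonglongrightarrow> indicat_real D x *\<^sub>R (F x)\<^sup>2" for x
        using lim by (auto intro!: tendsto_intros simp: indicator_def)
      show "(\<lambda>t. indicat_real D t *\<^sub>R (f n t)\<^sup>2) \<in> borel_measurable lborel" for n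
        using H1_onD(4)[OF fg[of n]] by (simp add: set_integrable_def)
    qed
  qed auto
  ultimately have H1: "H1_on D F G" by (simp add: H1_on_def)
  \<comment> \<open>A weighted triangle inequality for squares: the error term has weight
    \<open>1 + 1 / s\<close> but tends to 0 with \<open>n\<close>, after which \<open>s\<close> is
    sent to 0.\<close>
  have key: "(LINT t|lborel. (G t)\<^sup>2) \<le> (1 + s) * C" if s: "s > 0" for s
  proof -
    have b: "(LINT t|lborel. (G t)\<^sup>2) \<le> (1 + s) * (C + 1 / Suc n) + (1 + 1 / s) * (LINT t|lborel. (H n t - G t)\<^sup>2)" for n
    proof -
      have pw: "(G t)\<^sup>2 \<le> (1 + s) * (H n t)\<^sup>2 + (1 + 1 / s) * (H n t - G t)\<^sup>2" for t
      proof -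
        have "(1 + s) * (H n t)\<^sup>2 + (1 + 1 / s) * (H n t - G t)\<^sup>2 - (G t)\<^sup>2 = (s * H n t + (H n t - G t))\<^sup>2 / s"
          using s by (simp add: field_simps power2_eq_square)
        also have "\<dots> \<ge> 0" using s by simp
        finally show ?thesis by simp
      qed
      have "(LINT t|lborel. (G t)\<^sup>2) \<le> (LINT t|lborel. (1 + s) * (H n t)\<^sup>2 + (1 + 1 / s) * (H n t - G t)\<^sup>2)"
        using G(2) Hi dGi pw by (intro integral_mono) auto
      also have "\<dots> = (1 + s) * (LINT t|lborel. (H n t)\<^sup>2) + (1 + 1 / s) * (LINT t|lborel. (H n t - G t)\<^sup>2)"
        using Hi dGi by simp
      also have "(1 + s) * (LINT t|lborel. (H n t)\<^sup>2) \<le> (1 + s) * (C + 1 / Suc n)"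
        using HE[of n] dC[of n] s by (intro mult_left_mono) auto
      finally show ?thesis by simp
    qed
    have "(\<lambda>n. 1 / real (Suc n)) \<longlonglongrightarrow> 0" using LIMSEQ_inverse_real_of_nat by (simp add: inverse_eq_divide)
    then have "(\<lambda>n. (1 + s) * (C + 1 / real (Suc n)) + (1 + 1 / s) * (LINT t|lborel. (H n t - G t)\<^sup>2)) \<longlonglongrightarrow> (1 + s) * (C + 0) + (1 + 1 / s) * 0"
      by (intro tendsto_add tendsto_mult tendsto_const G(3))
    then show ?thesis using b LIMSEQ_le_const[of _ "(1 + s) * (C + 0) + (1 + 1 / s) * 0" "(LINT t|lborel. (G t)\<^sup>2)"] by auto
  qed
  have C0: "C \<ge> 0" using C[of 0] LINT_nonneg[of D "\<lambda>t. (g 0 t)\<^sup>2"] by (smt (verit) zero_le_power2)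
  have "(LINT t|lborel. (G t)\<^sup>2) \<le> C"
  proof (rule field_le_epsilon)
    fix r :: real assume r: "r > 0"
    have "(LINT t|lborel. (G t)\<^sup>2) \<le> (1 + r / (C + 1)) * C" using r C0 by (intro key) auto
    also have "\<dots> \<le> C + r" using r C0 by (simp add: field_simps)
    finally show "(LINT t|lborel. (G t)\<^sup>2) \<le> C + r" .
  qed
  moreover have "(LINT t:D|lborel. (G t)\<^sup>2) \<le> (LINT t:UNIV|lborel. (G t)\<^sup>2)"
    using D G by (intro LINT_nonneg_mono_set si) auto
  ultimately have "(LINT t:D|lborel. (G t)\<^sup>2) \<le> C" by (simp add: set_lebesgue_integral_def)
  with H1 show thesis by (rule that)
qed

lemma ac_deriv_Icc_unique:
  assumes "ac_deriv {a..b} f g" "ac_deriv {a..b} f h"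
  shows "AE x in lborel. x \<in> {a..b} \<longrightarrow> g x = h x"
proof (cases "a \<le> b")
  case True
  have ac: "ac_deriv {a..b} (\<lambda>x. 0) (\<lambda>x. g x - h x)" using ac_deriv_diff[OF assms] by simp
  have "AE x in lborel. x \<in> {a..b} \<longrightarrow> g x - h x = 0"
  proof (rule AE_zero_of_LINT_Icc_zero)
    show "set_integrable lborel {a..b} (\<lambda>x. g x - h x)" using ac_derivD(1)[OF ac, of a b] True by auto
    fix x y assume "a \<le> x" "x \<le> y" "y \<le> b"
    then show "(LINT t:{x..y}|lborel. g t - h t) = 0" using ac_derivD(2)[OF ac, of x y] by auto
  qed
  then show ?thesis by simp
qed auto

text \<open>Along a tail the kinetic integrals are at most \<open>T + r\<close>, so the compactness
  lemma yields some density of \<open>F\<close> with that bound; by uniqueness it agrees with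
  \<open>G\<close> almost everywhere.\<close>

lemma H1_on_Icc_lsc:
  assumes F: "H1_on {a..b} F G" and fg: "\<And>n. H1_on {a..b} (f n) (g n)"
    and C': "\<And>n. (LINT t:{a..b}|lborel. (f n t)\<^sup>2) \<le> C'"
    and lim: "\<And>x. x \<in> {a..b} \<Longrightarrow> (\<lambda>n. f n x) \<longlonglongrightarrow> F x"
    and T: "(\<lambda>n. LINT t:{a..b}|lborel. (g n t)\<^sup>2) \<longlonglongrightarrow> T"
  shows "(LINT t:{a..b}|lborel. (G t)\<^sup>2) \<le> T"
proof (rule field_le_epsilon)
  fix r :: real assume "r > 0"
  then obtain N where N: "\<And>n. n \<ge> N \<Longrightarrow> \<bar>(LINT t:{a..b}|lborel. (g n t)\<^sup>2) - T\<bar> < r"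
    using LIMSEQ_D[OF T] by auto
  have b: "(LINT t:{a..b}|lborel. (g (n + N) t)\<^sup>2) \<le> T + r" for n using N[of "n + N"] by auto
  have l: "(\<lambda>n. f (n + N) x) \<longlonglongrightarrow> F x" if "x \<in> {a..b}" for x
    using lim[OF that] by (rule LIMSEQ_ignore_initial_segment)
  obtain H where H: "H1_on {a..b} F H" "(LINT t:{a..b}|lborel. (H t)\<^sup>2) \<le> T + r"
    using H1_on_limit[where f="\<lambda>n. f (n + N)" and g="\<lambda>n. g (n + N)" and D="{a..b}", OF fg _ _ b C' l]
    by (auto simp: is_interval_cc)
  have ae: "AE x in lborel. x \<in> {a..b} \<longrightarrow> G x = H x"
    by (rule ac_deriv_Icc_unique[OF H1_onD(1)[OF F] H1_onD(1)[OF H(1)]])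
  have "(LINT t:{a..b}|lborel. (G t)\<^sup>2) = (LINT t:{a..b}|lborel. (H t)\<^sup>2)"
    unfolding set_lebesgue_integral_def
  proof (rule integral_cong_AE)
    show "(\<lambda>x. indicat_real {a..b} x *\<^sub>R (G x)\<^sup>2) \<in> borel_measurable lborel"
      using H1_onD(3)[OF F] by (simp add: set_integrable_def)
    show "(\<lambda>x. indicat_real {a..b} x *\<^sub>R (H x)\<^sup>2) \<in> borel_measurable lborel"
      using H1_onD(3)[OF H(1)] by (simp add: set_integrable_def)
    show "AE x in lborel. indicat_real {a..b} x *\<^sub>R (G x)\<^sup>2 = indicat_real {a..b} x *\<^sub>R (H x)\<^sup>2"
      using ae by eventually_elim (auto simp: indicator_def)
  qed
  with H(2) show "(LINT t:{a..b}|lborel. (G t)\<^sup>2) \<le> T + r" by simp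
qed

section \<open>Edges as intervals, and the Sobolev space of the graph\<close>

definition cdom :: "ereal \<Rightarrow> real set" where
  "cdom L = {x. 0 \<le> x \<and> ereal x \<le> L}"

definition odom :: "ereal \<Rightarrow> real set" where
  "odom L = {x. 0 < x \<and> ereal x < L}"

lemma edge_dom_eq: "edge_dom G e = cdom (len G e)"
  and edge_interior_eq: "edge_interior G e = odom (len G e)"
  by (auto simp: edge_dom_def cdom_def edge_interior_def odom_def)

lemma dom_cases [consumes 1]:
  assumes "0 < L"
  obtains "L = \<infinity>" "cdom L = {0..}" "odom L = {0<..}"
  | l where "0 < l" "L = ereal l" "cdom L = {0..l}" "odom L = {0<..<l}"
proof (cases L)
  case (real l)
  have "cdom L = {0..l}" "odom L = {0<..<l}" by (auto simp: real cdom_def odom_def)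
  then show thesis using that(2)[of l] real assms by simp
next
  case PInf
  have "cdom L = {0..}" "odom L = {0<..}" by (auto simp: PInf cdom_def odom_def)
  then show thesis using that(1) PInf by simp
qed (use assms in auto)

lemma dom_facts:
  assumes "0 < L"
  shows "is_interval (cdom L)" "is_interval (odom L)" "cdom L \<in> sets borel" "odom L \<in> sets borel"
    "open (odom L)" "odom L \<subseteq> cdom L" "cdom L - odom L \<subseteq> {0, real_of_ereal L}" "0 \<in> cdom L"
  using assms by (cases rule: dom_cases; auto simp: is_interval_1)+

text \<open>Local integrability only speaks about compact intervals; measurability and uniqueness on
  the whole open edge are obtained along this countable exhaustion.\<close>

lemma odom_exhaust:
  assumes "0 < L"
  obtains a b :: "nat \<Rightarrow> real" where "\<And>n. {a n..b n} \<subseteq> odom L"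
    "\<And>x. x \<in> odom L \<Longrightarrow> \<forall>\<^sub>F n in sequentially. x \<in> {a n..b n}"
proof -
  have inv: "\<forall>\<^sub>F n in sequentially. c / real (Suc n) < x" if "x > 0" for x c :: real
  proof -
    have "(\<lambda>n. c * inverse (real (Suc n))) \<longlonglongrightarrow> c * 0"
      by (intro tendsto_mult tendsto_const LIMSEQ_inverse_real_of_nat)
    then show ?thesis using that by (auto simp: divide_inverse dest: order_tendstoD(2))
  qed
  from assms show thesis
  proof (cases rule: dom_cases)
    case 1
    show thesis
    proof (rule that[of "\<lambda>n. 1 / real (Suc n)" real])
      show "{1 / real (Suc n)..real n} \<subseteq> odom L" for n
      proof
        fix x assume "x \<in> {1 / real (Suc n)..real n}"
        moreover have "0 < 1 / real (Suc n)" by simp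
        ultimately have "0 < x" unfolding atLeastAtMost_iff by linarith
        then show "x \<in> odom L" using 1 by auto
      qed
      fix x assume "x \<in> odom L"
      then have "x > 0" using 1 by auto
      obtain N where N: "x < real N" using reals_Archimedean2 by blast
      have "\<forall>\<^sub>F n in sequentially. n \<ge> N" by (rule eventually_ge_at_top)
      with inv[OF \<open>x > 0\<close>, of 1] show "\<forall>\<^sub>F n in sequentially. x \<in> {1 / real (Suc n)..real n}"
        by eventually_elim (use N in \<open>auto simp: less_imp_le\<close>)
    qed
  next
    case (2 l)
    show thesis
    proof (rule that[of "\<lambda>n. l / real (Suc n)" "\<lambda>n. l - l / real (Suc n)"])
      show "{l / real (Suc n)..l - l / real (Suc n)} \<subseteq> odom L" for n
      proof
        fix x assume "x \<in> {l / real (Suc n)..l - l / real (Suc n)}"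
        moreover have "0 < l / real (Suc n)" using 2 by simp
        ultimately have "0 < x" "x < l" unfolding atLeastAtMost_iff by linarith+
        then show "x \<in> odom L" using 2 by auto
      qed
      fix x assume "x \<in> odom L"
      then have "x > 0" "l - x > 0" using 2 by auto
      from inv[OF this(1), of l] inv[OF this(2), of l]
      show "\<forall>\<^sub>F n in sequentially. x \<in> {l / real (Suc n)..l - l / real (Suc n)}"
        by eventually_elim auto
    qed
  qed
qed

lemma AE_odom_cdom:
  assumes "0 < L" "AE x in lborel. x \<in> odom L \<longrightarrow> P x"
  shows "AE x in lborel. x \<in> cdom L \<longrightarrow> P x"
  using assms(2) AE_lborel_singleton[of 0] AE_lborel_singleton[of "real_of_ereal L"]
  by eventually_elim (use dom_facts(7)[OF assms(1)] in auto)

text \<open>The truncations to the exhausting compact intervals are measurable and converge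
  pointwise on the open edge; the closed edge differs from it by at most two points.\<close>

lemma weak_deriv_measurable:
  assumes L: "0 < L" and w: "is_weak_deriv (odom L) f g"
  shows "set_borel_measurable lborel (cdom L) g"
proof -
  obtain a b where ab: "\<And>n. {a n..b n} \<subseteq> odom L"
    "\<And>x. x \<in> odom L \<Longrightarrow> \<forall>\<^sub>F n in sequentially. x \<in> {a n..b n}" using odom_exhaust[OF L] by blast
  have "(\<lambda>x. indicator (odom L) x *\<^sub>R g x) \<in> borel_measurable lborel"
  proof (rule borel_measurable_LIMSEQ_real)
    show "(\<lambda>x. indicat_real {a n..b n} x *\<^sub>R g x) \<in> borel_measurable lborel" for n
    proof -
      have "set_integrable lborel {a n..b n} g" using w ab(1) by (auto simp: is_weak_deriv_def locally_integrable_def)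
      then show ?thesis by (simp add: set_integrable_def)
    qed
    fix x
    show "(\<lambda>n. indicat_real {a n..b n} x *\<^sub>R g x) \<longlonglongrightarrow> indicat_real (odom L) x *\<^sub>R g x"
    proof (cases "x \<in> odom L")
      case True
      have "\<forall>\<^sub>F n in sequentially. indicat_real {a n..b n} x *\<^sub>R g x = indicat_real (odom L) x *\<^sub>R g x"
        using ab(2)[OF True] by eventually_elim (use True in auto)
      then show ?thesis by (rule tendsto_eventually)
    next
      case False
      then have "x \<notin> {a n..b n}" for n using ab(1)[of n] by blast
      then have "indicat_real {a n..b n} x = 0" for n by (rule indicator_simps(2))
      then show ?thesis using False by (simp only: indicator_simps) simp
    qed
  qed
  then have "(\<lambda>x. indicator (cdom L) x *\<^sub>R g x) \<in> borel_measurable lborel"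
    by (rule measurable_discrete_difference[where X="{0, real_of_ereal L}"])
       (use dom_facts(6,7)[OF L] in \<open>auto simp: indicator_def\<close>)
  then show ?thesis by (simp add: set_borel_measurable_def)
qed

text \<open>The open edge is settled by testing. The end points are reached by shrinking
  \<open>{x..y}\<close> from both sides: the increment converges because \<open>f\<close> is
  continuous up to the boundary, the integral because a square integrable \<open>g\<close> is
  integrable on bounded intervals.\<close>

lemma weak_deriv_imp_H1_on:
  assumes L: "0 < L" and c: "continuous_on (cdom L) f" and w: "is_weak_deriv (odom L) f g"
    and i: "set_integrable lborel (cdom L) (\<lambda>x. \<bar>g x\<bar>\<^sup>2 + \<bar>f x\<bar>\<^sup>2)"
  shows "H1_on (cdom L) f g"
proof -
  note d = dom_facts[OF L]
  have gm: "set_borel_measurable lborel (cdom L) g" by (rule weak_deriv_measurable[OF L w])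
  have fm: "set_borel_measurable lborel (cdom L) f" by (rule set_borel_measurable_cont[OF c d(3)])
  have g2: "set_integrable lborel (cdom L) (\<lambda>x. (g x)\<^sup>2)"
    by (rule set_integrable_bound[OF i]) (use set_borel_measurable_mult[OF gm gm] in \<open>auto simp: power2_eq_square\<close>)
  have f2: "set_integrable lborel (cdom L) (\<lambda>x. (f x)\<^sup>2)"
    by (rule set_integrable_bound[OF i]) (use set_borel_measurable_mult[OF fm fm] in \<open>auto simp: power2_eq_square\<close>)
  have aco: "ac_deriv (odom L) f g"
    using is_weak_deriv_imp_ac_deriv[OF w d(5,2)] c d(6) continuous_on_subset by blast
  have "ac_deriv (cdom L) f g"
    unfolding ac_deriv_def
  proof (intro ballI impI)
    fix x y assume xy: "x \<in> cdom L" "y \<in> cdom L" "x \<le> y"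
    have sub: "{x..y} \<subseteq> cdom L" using d(1) xy unfolding is_interval_1 by fastforce
    have gi: "set_integrable lborel {x..y} g"
      by (rule set_integrable_of_square[OF set_borel_measurable_mono[OF gm sub] set_integrable_subset[OF g2 _ sub]]) auto
    have "f y - f x = (LINT t:{x..y}|lborel. g t)"
    proof (cases "x = y")
      case True then show ?thesis by (simp add: LINT_Icc_same)
    next
      case False
      then have lt: "x < y" using xy by simp
      have inn: "{x<..<y} \<subseteq> odom L" using L sub lt
        by (cases rule: dom_cases) (use xy in \<open>auto simp: subset_iff\<close>)
      \<comment> \<open>The shift by 3 keeps \<open>2 * r n\<close> strictly below
        \<open>y - x\<close>, so the shrunken interval is never empty.\<close>
      define r where "r n = (y - x) / real (n + 3)" for n :: nat
      have r: "0 < r n" "2 * r n < y - x" for n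
      proof -
        show "0 < r n" using lt by (simp add: r_def)
        have "(y - x) * 2 < (y - x) * real (n + 3)" using lt by (intro mult_strict_left_mono) auto
        then have "(y - x) * 2 / real (n + 3) < y - x" by (subst pos_divide_less_eq) auto
        then show "2 * r n < y - x" by (simp add: r_def mult.commute)
      qed
      have "(\<lambda>n. (y - x) * inverse (real (Suc (n + 2)))) \<longlonglongrightarrow> (y - x) * 0"
        by (intro tendsto_mult tendsto_const LIMSEQ_ignore_initial_segment[OF LIMSEQ_inverse_real_of_nat])
      then have r0: "r \<longlonglongrightarrow> 0" unfolding r_def by (simp add: divide_inverse eval_nat_numeral)
      have x_r: "(\<lambda>n. x + r n) \<longlonglongrightarrow> x + 0" and y_r: "(\<lambda>n. y - r n) \<longlonglongrightarrow> y - 0"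
        by (intro tendsto_add tendsto_diff tendsto_const r0)+
      have eq: "f (y - r n) - f (x + r n) = (LINT t:{x + r n..y - r n}|lborel. g t)" for n
        by (rule ac_derivD(2)[OF aco]) (use inn r[of n] lt in \<open>auto simp: subset_iff\<close>)
      have fx: "(\<lambda>n. f (x + r n)) \<longlonglongrightarrow> f x" "(\<lambda>n. f (y - r n)) \<longlonglongrightarrow> f y"
      proof -
        have "x + r n \<in> {x..y}" "y - r n \<in> {x..y}" for n using r[of n] lt by auto
        then have "x + r n \<in> cdom L" "y - r n \<in> cdom L" for n using sub by blast+
        then show "(\<lambda>n. f (x + r n)) \<longlonglongrightarrow> f x" "(\<lambda>n. f (y - r n)) \<longlonglongrightarrow> f y"
          using x_r y_r xy by (auto intro!: continuous_on_tendsto_compose[OF c])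
      qed
      have "(\<lambda>n. LINT t:{x + r n..y - r n}|lborel. g t) \<longlonglongrightarrow> (LINT t:{x..y}|lborel. g t)"
        unfolding set_lebesgue_integral_def
      proof (rule integral_dominated_convergence[where w="\<lambda>t. \<bar>indicator {x..y} t *\<^sub>R g t\<bar>"])
        show "(\<lambda>t. indicat_real {x..y} t *\<^sub>R g t) \<in> borel_measurable lborel"
          using gi by (simp add: set_integrable_def)
        show "integrable lborel (\<lambda>t. \<bar>indicator {x..y} t *\<^sub>R g t\<bar>)" using gi by (simp add: set_integrable_def)
        show "(\<lambda>t. indicat_real {x + r n..y - r n} t *\<^sub>R g t) \<in> borel_measurable lborel" for n
          using set_integrable_subset[OF gi, of "{x + r n..y - r n}"] r(1)[of n] by (auto simp: set_integrable_def)
        show "AE t in lborel. norm (indicator {x + r n..y - r n} t *\<^sub>R g t) \<le> \<bar>indicator {x..y} t *\<^sub>R g t\<bar>" for n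
          using r(1)[of n] by (auto simp: indicator_def)
        have "(\<lambda>n. indicat_real {x + r n..y - r n} t *\<^sub>R g t) \<longlonglongrightarrow> indicat_real {x..y} t *\<^sub>R g t" if nxy: "t \<noteq> x" "t \<noteq> y" for t
        proof (rule tendsto_eventually)
          consider "t \<notin> {x..y}" | "x < t" "t < y"
            using nxy by fastforce
          then show "\<forall>\<^sub>F n in sequentially. indicat_real {x + r n..y - r n} t *\<^sub>R g t = indicat_real {x..y} t *\<^sub>R g t"
          proof cases
            case 1
            then have "t \<notin> {x + r n..y - r n}" for n using r(1)[of n] by auto
            then have "indicat_real {x + r n..y - r n} t = 0" for n by (rule indicator_simps(2))
            moreover have "indicat_real {x..y} t = 0" using 1 by (rule indicator_simps(2))
            ultimately show ?thesis by simp
          next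
            case 2
            have "\<forall>\<^sub>F n in sequentially. x + r n < t" using order_tendstoD(2)[OF x_r] 2 by simp
            moreover have "\<forall>\<^sub>F n in sequentially. y - r n > t" using order_tendstoD(1)[OF y_r] 2 by simp
            ultimately show ?thesis by eventually_elim (use 2 in \<open>auto simp: indicator_def\<close>)
          qed
        qed
        then show "AE t in lborel. (\<lambda>n. indicat_real {x + r n..y - r n} t *\<^sub>R g t) \<longlonglongrightarrow> indicat_real {x..y} t *\<^sub>R g t"
          using AE_lborel_singleton[of x] AE_lborel_singleton[of y] by (auto elim: eventually_elim2)
      qed
      then have "(\<lambda>n. f (y - r n) - f (x + r n)) \<longlonglongrightarrow> (LINT t:{x..y}|lborel. g t)" by (simp add: eq)
      with tendsto_diff[OF fx(2,1)] show ?thesis using LIMSEQ_unique by blast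
    qed
    with gi show "set_integrable lborel {x..y} g \<and> f y - f x = (LINT t:{x..y}|lborel. g t)" by simp
  qed
  with gm g2 f2 show ?thesis by (simp add: H1_on_def)
qed

lemma H1_on_imp_weak_deriv:
  assumes "0 < L" "H1_on (cdom L) f g"
  shows "is_weak_deriv (odom L) f g"
proof (rule ac_deriv_imp_is_weak_deriv)
  note d = dom_facts[OF assms(1)]
  show "ac_deriv (odom L) f g" using H1_onD(1)[OF assms(2)] d(6) ac_deriv_subset by blast
  show "is_interval (odom L)" by (rule d)
  show "continuous_on (odom L) f" using H1_on_continuous[OF assms(2) d(1)] d(6) continuous_on_subset by blast
qed

lemma weak_deriv_unique:
  assumes L: "0 < L" and w: "is_weak_deriv (odom L) f g" "is_weak_deriv (odom L) f h" and c: "continuous_on (odom L) f"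
  shows "AE x in lborel. x \<in> cdom L \<longrightarrow> g x = h x"
proof (rule AE_odom_cdom[OF L])
  note d = dom_facts[OF L]
  obtain a b where ab: "\<And>n. {a n..b n} \<subseteq> odom L"
    "\<And>x. x \<in> odom L \<Longrightarrow> \<forall>\<^sub>F n in sequentially. x \<in> {a n..b n}" using odom_exhaust[OF L] by blast
  have "AE x in lborel. \<forall>n. x \<in> {a n..b n} \<longrightarrow> g x = h x"
    unfolding AE_all_countable
  proof
    fix n
    show "AE x in lborel. x \<in> {a n..b n} \<longrightarrow> g x = h x"
      by (rule ac_deriv_Icc_unique[OF ac_deriv_subset[OF is_weak_deriv_imp_ac_deriv[OF w(1) d(5,2) c] ab(1)]
            ac_deriv_subset[OF is_weak_deriv_imp_ac_deriv[OF w(2) d(5,2) c] ab(1)]])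
  qed
  then show "AE x in lborel. x \<in> odom L \<longrightarrow> g x = h x"
  proof eventually_elim
    fix x assume *: "\<forall>n. x \<in> {a n..b n} \<longrightarrow> g x = h x"
    show "x \<in> odom L \<longrightarrow> g x = h x"
    proof
      assume "x \<in> odom L"
      from eventually_happens[OF ab(2)[OF this]] * show "g x = h x" by auto
    qed
  qed
qed

lemma set_integral_square_cong_AE:
  fixes g h :: "real \<Rightarrow> real"
  assumes "set_borel_measurable lborel D g" "set_borel_measurable lborel D h"
    and "AE x in lborel. x \<in> D \<longrightarrow> g x = h x"
  shows "set_integrable lborel D (\<lambda>x. (g x)\<^sup>2) \<longleftrightarrow> set_integrable lborel D (\<lambda>x. (h x)\<^sup>2)"
    "(LINT x:D|lborel. (g x)\<^sup>2) = (LINT x:D|lborel. (h x)\<^sup>2)"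
proof -
  have m: "(\<lambda>x. indicat_real D x *\<^sub>R (k x)\<^sup>2) \<in> borel_measurable lborel" if "set_borel_measurable lborel D k" for k :: "real \<Rightarrow> real"
    using set_borel_measurable_mult[OF that that] by (simp add: set_borel_measurable_def power2_eq_square)
  have ae: "AE x in lborel. indicat_real D x *\<^sub>R (g x)\<^sup>2 = indicat_real D x *\<^sub>R (h x)\<^sup>2"
    using assms(3) by eventually_elim (auto simp: indicator_def)
  show "set_integrable lborel D (\<lambda>x. (g x)\<^sup>2) \<longleftrightarrow> set_integrable lborel D (\<lambda>x. (h x)\<^sup>2)"
    unfolding set_integrable_def by (rule integrable_cong_AE[OF m m ae]) (use assms in auto)
  show "(LINT x:D|lborel. (g x)\<^sup>2) = (LINT x:D|lborel. (h x)\<^sup>2)"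
    unfolding set_lebesgue_integral_def by (rule integral_cong_AE[OF m m ae]) (use assms in auto)
qed

text \<open>The representative \<open>edge_deriv\<close> is an arbitrary choice, but it agrees
  almost everywhere with any known weak derivative \<open>g\<close>. Kinetic energies of competitors
  can therefore be computed from an explicit \<open>g\<close>.\<close>

lemma H1_on_edge_deriv:
  assumes L: "0 < len G e" and H: "H1_on (edge_dom G e) (on_edge G u e) g"
  shows "\<exists>g. is_weak_deriv (edge_interior G e) (on_edge G u e) g"
    "H1_on (edge_dom G e) (on_edge G u e) (edge_deriv G u e)"
    "(LINT x:edge_dom G e|lborel. (edge_deriv G u e x)\<^sup>2) = (LINT x:edge_dom G e|lborel. (g x)\<^sup>2)"
proof -
  note d = dom_facts[OF L]
  let ?f = "on_edge G u e" and ?h = "edge_deriv G u e"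
  have H': "H1_on (cdom (len G e)) ?f g" using H by (simp add: edge_dom_eq)
  have w: "is_weak_deriv (odom (len G e)) ?f g" by (rule H1_on_imp_weak_deriv[OF L H'])
  then show ex: "\<exists>g. is_weak_deriv (edge_interior G e) ?f g" by (auto simp: edge_interior_eq)
  have w': "is_weak_deriv (odom (len G e)) ?f ?h"
    using someI_ex[OF ex] by (simp add: edge_deriv_def edge_interior_eq)
  have c: "continuous_on (cdom (len G e)) ?f" by (rule H1_on_continuous[OF H' d(1)])
  have ae: "AE x in lborel. x \<in> cdom (len G e) \<longrightarrow> ?h x = g x"
    by (rule weak_deriv_unique[OF L w' w continuous_on_subset[OF c d(6)]])
  note m = weak_deriv_measurable[OF L w'] H1_onD(2)[OF H']
  note sq = set_integral_square_cong_AE[OF m ae]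
  have "set_integrable lborel (cdom (len G e)) (\<lambda>x. \<bar>?h x\<bar>\<^sup>2 + \<bar>?f x\<bar>\<^sup>2)"
    using H1_onD(3,4)[OF H'] sq(1) by (simp add: set_integral_add)
  from weak_deriv_imp_H1_on[OF L c w' this] show "H1_on (edge_dom G e) ?f ?h" by (simp add: edge_dom_eq)
  show "(LINT x:edge_dom G e|lborel. (?h x)\<^sup>2) = (LINT x:edge_dom G e|lborel. (g x)\<^sup>2)"
    using sq(2) by (simp add: edge_dom_eq)
qed

lemma H1_iff:
  assumes "is_metric_graph G"
  shows "u \<in> H1 G \<longleftrightarrow> (\<forall>e\<in>edges G. H1_on (edge_dom G e) (on_edge G u e) (edge_deriv G u e))"
proof
  assume u: "u \<in> H1 G"
  show "\<forall>e\<in>edges G. H1_on (edge_dom G e) (on_edge G u e) (edge_deriv G u e)"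
  proof
    fix e assume e: "e \<in> edges G"
    have L: "0 < len G e" using assms e by (auto simp: is_metric_graph_def)
    have "\<exists>g. is_weak_deriv (edge_interior G e) (on_edge G u e) g" using u e by (auto simp: H1_def)
    then have w: "is_weak_deriv (odom (len G e)) (on_edge G u e) (edge_deriv G u e)"
      unfolding edge_deriv_def edge_interior_eq by (rule someI_ex)
    from weak_deriv_imp_H1_on[OF L _ w] u e
    show "H1_on (edge_dom G e) (on_edge G u e) (edge_deriv G u e)"
      by (simp add: edge_dom_eq H1_def continuous_on_graph_def)
  qed
next
  assume *: "\<forall>e\<in>edges G. H1_on (edge_dom G e) (on_edge G u e) (edge_deriv G u e)"
  have L: "0 < len G e" if "e \<in> edges G" for e using assms that by (auto simp: is_metric_graph_def)
  show "u \<in> H1 G"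
    unfolding H1_def continuous_on_graph_def
  proof (intro CollectI conjI ballI)
    fix e assume e: "e \<in> edges G"
    then have H: "H1_on (edge_dom G e) (on_edge G u e) (edge_deriv G u e)" using * by blast
    show "continuous_on (edge_dom G e) (on_edge G u e)"
      using H1_on_continuous[OF H] dom_facts(1)[OF L[OF e]] by (simp add: edge_dom_eq)
    show "\<exists>g. is_weak_deriv (edge_interior G e) (on_edge G u e) g" by (rule H1_on_edge_deriv(1)[OF L[OF e] H])
    show "set_integrable lborel (edge_dom G e) (\<lambda>x. \<bar>edge_deriv G u e x\<bar>\<^sup>2 + \<bar>on_edge G u e x\<bar>\<^sup>2)"
      using H1_onD(3,4)[OF H] by (simp add: set_integral_add)
  qed
qed

lemma H1_onI_graph:
  assumes "is_metric_graph G" "\<And>e. e \<in> edges G \<Longrightarrow> H1_on (edge_dom G e) (on_edge G u e) (g e)"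
  shows "u \<in> H1 G"
    "graph_integral G (\<lambda>e x. \<bar>edge_deriv G u e x\<bar>\<^sup>2) = (\<Sum>e\<in>edges G. LINT x:edge_dom G e|lborel. (g e x)\<^sup>2)"
proof -
  have L: "0 < len G e" if "e \<in> edges G" for e using assms that by (auto simp: is_metric_graph_def)
  note * = H1_on_edge_deriv[OF L assms(2)]
  show "u \<in> H1 G" using H1_iff[OF assms(1)] *(2) by blast
  show "graph_integral G (\<lambda>e x. \<bar>edge_deriv G u e x\<bar>\<^sup>2) = (\<Sum>e\<in>edges G. LINT x:edge_dom G e|lborel. (g e x)\<^sup>2)"
    unfolding graph_integral_def using *(3) by (intro sum.cong) auto
qed

definition glue :: "('v \<Rightarrow> real) \<Rightarrow> ('e \<Rightarrow> real \<Rightarrow> real) \<Rightarrow> ('v, 'e) point \<Rightarrow> real" where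
  "glue a f = (\<lambda>P. case P of Vertex v \<Rightarrow> a v | Inner e x \<Rightarrow> f e x)"

lemma on_edge_glue:
  assumes "f e 0 = a (src G e)" "\<And>l. len G e = ereal l \<Longrightarrow> f e l = a (tgt G e)"
  shows "on_edge G (glue a f) e x = f e x"
  using assms(1) assms(2)[of x] by (auto simp: on_edge_def glue_def chart_def)

section \<open>Pointwise estimates\<close>

lemma exists_value_le_mean:
  fixes f :: "real \<Rightarrow> real"
  assumes "set_integrable lborel D (\<lambda>x. (f x)\<^sup>2)" "{a..b} \<subseteq> D" "a < b" "(LINT x:D|lborel. (f x)\<^sup>2) < (b - a) * c"
  obtains y where "y \<in> {a..b}" "(f y)\<^sup>2 < c"
proof -
  have "\<exists>y\<in>{a..b}. (f y)\<^sup>2 < c"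
  proof (rule ccontr)
    assume n: "\<not> ?thesis"
    have i: "set_integrable lborel {a..b} (\<lambda>x. (f x)\<^sup>2)" by (rule set_integrable_subset[OF assms(1)]) (use assms in auto)
    have "(b - a) * c = (LINT x:{a..b}|lborel. c)" using assms by (simp add: LINT_const_Icc)
    also have "\<dots> \<le> (LINT x:{a..b}|lborel. (f x)\<^sup>2)"
      by (rule set_integral_mono[OF set_integrable_const_Icc i]) (use n in \<open>auto simp: not_less\<close>)
    also have "\<dots> \<le> (LINT x:D|lborel. (f x)\<^sup>2)"
      by (rule LINT_nonneg_mono_set[OF assms(1)]) (use assms in auto)
    finally show False using assms(4) by simp
  qed
  then show thesis using that by blast
qed

text \<open>The density of the square is \<open>2 * f t * g t\<close>, and \<open>2 * \<bar>f t * g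
  t\<bar> \<le> s * (f t)\<^sup>2 + (g t)\<^sup>2 / s\<close>. The weight \<open>s\<close> stays
  free: it is balanced against the kinetic energy for coercivity, and sent to infinity when the mass
  is 0.\<close>

lemma H1_on_square_diff_le:
  assumes H: "H1_on D f g" and D: "is_interval D" and xy: "x \<in> D" "y \<in> D" and s: "s > 0"
  shows "\<bar>(f y)\<^sup>2 - (f x)\<^sup>2\<bar> \<le> s * (LINT t:D|lborel. (f t)\<^sup>2) + (LINT t:D|lborel. (g t)\<^sup>2) / s"
proof -
  have main: "\<bar>(f y)\<^sup>2 - (f x)\<^sup>2\<bar> \<le> s * (LINT t:D|lborel. (f t)\<^sup>2) + (LINT t:D|lborel. (g t)\<^sup>2) / s"
    if xy: "x \<in> D" "y \<in> D" "x \<le> y" for x y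
  proof -
    have sub: "{x..y} \<subseteq> D" using D xy unfolding is_interval_1 by fastforce
    note h = H1_onD[OF H]
    have ac: "ac_deriv D (\<lambda>x. (f x)\<^sup>2) (\<lambda>x. 2 * f x * g x)"
      by (rule ac_deriv_square[OF h(1) H1_on_continuous[OF H D] D])
    have i: "set_integrable lborel {x..y} (\<lambda>t. (f t)\<^sup>2)" "set_integrable lborel {x..y} (\<lambda>t. (g t)\<^sup>2)"
      by (rule set_integrable_subset[OF h(4)] set_integrable_subset[OF h(3)]; use sub in auto)+
    note fg = ac_derivD[OF ac xy]
    have "\<bar>(f y)\<^sup>2 - (f x)\<^sup>2\<bar> = \<bar>LINT t:{x..y}|lborel. 2 * f t * g t\<bar>" using fg(2) by simp
    also have "\<dots> \<le> (LINT t:{x..y}|lborel. \<bar>2 * f t * g t\<bar>)"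
      using set_integral_norm_bound[OF fg(1)] by simp
    also have "\<dots> \<le> (LINT t:{x..y}|lborel. s * (f t)\<^sup>2 + (1 / s) * (g t)\<^sup>2)"
    proof (rule set_integral_mono)
      show "set_integrable lborel {x..y} (\<lambda>t. s * (f t)\<^sup>2 + (1 / s) * (g t)\<^sup>2)" using i by (intro set_integral_add) auto
      show "set_integrable lborel {x..y} (\<lambda>t. \<bar>2 * f t * g t\<bar>)" by (rule set_integrable_abs[OF fg(1)])
      fix t
      have "0 \<le> (s * \<bar>f t\<bar> - \<bar>g t\<bar>)\<^sup>2 / s" using s by simp
      also have "\<dots> = s * (f t)\<^sup>2 + (1 / s) * (g t)\<^sup>2 - 2 * \<bar>f t\<bar> * \<bar>g t\<bar>"
        using s by (simp add: power2_eq_square field_simps abs_mult_self_eq)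
      finally show "\<bar>2 * f t * g t\<bar> \<le> s * (f t)\<^sup>2 + (1 / s) * (g t)\<^sup>2" by (simp add: abs_mult)
    qed
    also have "\<dots> = s * (LINT t:{x..y}|lborel. (f t)\<^sup>2) + (1 / s) * (LINT t:{x..y}|lborel. (g t)\<^sup>2)"
      using i by (simp add: set_integral_add)
    also have "\<dots> \<le> s * (LINT t:D|lborel. (f t)\<^sup>2) + (1 / s) * (LINT t:D|lborel. (g t)\<^sup>2)"
      using s sub h by (intro add_mono mult_left_mono LINT_nonneg_mono_set) auto
    finally show ?thesis by simp
  qed
  show ?thesis
  proof (cases "x \<le> y")
    case True then show ?thesis using main xy by blast
  next
    case False then show ?thesis using main[of y x] xy by (simp add: abs_minus_commute)
  qed
qed

text \<open>Somewhere in \<open>{0..l}\<close> the square of \<open>f\<close> does not exceed its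
  mean up to \<open>r\<close>; from that point the variation of the square is controlled by the
  previous estimate.\<close>

lemma H1_on_sup_bound:
  assumes H: "H1_on D f g" and D: "is_interval D" "{0..l} \<subseteq> D" "0 < l" and x: "x \<in> D" and s: "s > 0"
  shows "(f x)\<^sup>2 \<le> (LINT t:D|lborel. (f t)\<^sup>2) / l + s * (LINT t:D|lborel. (f t)\<^sup>2) + (LINT t:D|lborel. (g t)\<^sup>2) / s"
proof (rule field_le_epsilon)
  fix r :: real assume "r > 0"
  have "(LINT t:D|lborel. (f t)\<^sup>2) < (l - 0) * ((LINT t:D|lborel. (f t)\<^sup>2) / l + r)"
    using D(3) \<open>r > 0\<close> by (simp add: distrib_left)
  then obtain y where y: "y \<in> {0..l}" "(f y)\<^sup>2 < (LINT t:D|lborel. (f t)\<^sup>2) / l + r"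
    using exists_value_le_mean[OF H1_onD(4)[OF H] D(2)] D(3) by blast
  have "\<bar>(f x)\<^sup>2 - (f y)\<^sup>2\<bar> \<le> s * (LINT t:D|lborel. (f t)\<^sup>2) + (LINT t:D|lborel. (g t)\<^sup>2) / s"
    using y D x by (intro H1_on_square_diff_le[OF H D(1) _ _ s]) auto
  then show "(f x)\<^sup>2 \<le> (LINT t:D|lborel. (f t)\<^sup>2) / l + s * (LINT t:D|lborel. (f t)\<^sup>2) + (LINT t:D|lborel. (g t)\<^sup>2) / s + r"
    using y(2) by linarith
qed

lemma small_value_at_infinity:
  fixes f :: "real \<Rightarrow> real"
  assumes "set_integrable lborel {R..} (\<lambda>x. (f x)\<^sup>2)" "R \<le> x" "e > 0"
  obtains y where "x \<le> y" "(f y)\<^sup>2 < e"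
proof -
  define I where "I = (LINT x:{R..}|lborel. (f x)\<^sup>2)"
  have "I \<ge> 0" unfolding I_def by (rule LINT_nonneg) simp
  \<comment> \<open>An interval of this length beyond \<open>x\<close> is long enough for the mean
    of the square to be below \<open>e\<close>.\<close>
  define n where "n = I / e + 1"
  have "n > 0" "I < n * e" using \<open>I \<ge> 0\<close> assms(3) by (simp_all add: n_def field_simps add_pos_nonneg)
  then have "I < (x + n - x) * e" by simp
  moreover have "{x..x + n} \<subseteq> {R..}" using assms(2) by auto
  ultimately obtain y where "y \<in> {x..x + n}" "(f y)\<^sup>2 < e"
    using exists_value_le_mean[OF assms(1), of x "x + n" e] \<open>n > 0\<close> unfolding I_def by force
  then show thesis using that by auto
qed

text \<open>Comparing \<open>x\<close> with far points \<open>y\<close> where \<open>f\<close> is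
  arbitrarily small, with weight \<open>s = 1\<close>, bounds \<open>(f x)\<^sup>2\<close> by the
  tail of the \<open>H\<^sup>1\<close> integral beyond \<open>x\<close>.\<close>

lemma H1_on_tendsto_0:
  assumes H: "H1_on {R..} f g"
  shows "(f \<longlongrightarrow> 0) at_top"
proof -
  have iv: "is_interval {x..}" for x :: real by (auto simp: is_interval_1)
  let ?F = "\<lambda>t. (f t)\<^sup>2 + (g t)\<^sup>2"
  have i: "set_integrable lborel {R..} ?F" using H1_onD[OF H] by (intro set_integral_add) auto
  have lim: "((\<lambda>x. LINT t:{R..x}|lborel. ?F t) \<longlongrightarrow> (LINT t:{R..}|lborel. ?F t)) at_top"
    by (rule tendsto_set_lebesgue_integral_at_top[OF _ i]) auto
  define tl where "tl x = (LINT t:{R..}|lborel. ?F t) - (LINT t:{R..x}|lborel. ?F t)" for x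
  have tl0: "(tl \<longlongrightarrow> 0) at_top" using tendsto_diff[OF tendsto_const[of "LINT t:{R..}|lborel. ?F t"] lim]
    unfolding tl_def[abs_def] by simp
  have b: "(f x)\<^sup>2 \<le> tl x" if x: "x \<ge> R" for x
  proof -
    have ix: "set_integrable lborel {x..} ?F" "set_integrable lborel {R..x} ?F" by (rule set_integrable_subset[OF i]; use x in auto)+
    have "(LINT t:{R..x} \<union> {x..}|lborel. ?F t) = (LINT t:{R..x}|lborel. ?F t) + (LINT t:{x..}|lborel. ?F t)"
      using ix by (intro set_integral_Un_AE AE_I[where N="{x}"]) auto
    moreover have "{R..x} \<union> {x..} = {R..}" using x by auto
    ultimately have tl: "tl x = (LINT t:{x..}|lborel. ?F t)" by (simp add: tl_def)
    have Hx: "H1_on {x..} f g" by (rule H1_on_subset[OF H]) (use x in auto)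
    have "(LINT t:{x..}|lborel. ?F t) = (LINT t:{x..}|lborel. (f t)\<^sup>2) + (LINT t:{x..}|lborel. (g t)\<^sup>2)"
      using H1_onD[OF Hx] by (intro set_integral_add) auto
    then have t: "tl x = 1 * (LINT t:{x..}|lborel. (f t)\<^sup>2) + (LINT t:{x..}|lborel. (g t)\<^sup>2) / 1" using tl by simp
    show ?thesis
    proof (rule field_le_epsilon)
      fix r :: real assume "r > 0"
      then obtain y where y: "x \<le> y" "(f y)\<^sup>2 < r"
        using small_value_at_infinity[OF H1_onD(4)[OF Hx], of x r] by auto
      have "\<bar>(f y)\<^sup>2 - (f x)\<^sup>2\<bar> \<le> tl x" unfolding t
        by (rule H1_on_square_diff_le[OF Hx iv]) (use y in auto)
      then show "(f x)\<^sup>2 \<le> tl x + r" using y(2) by linarith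
    qed
  qed
  have "((\<lambda>x. (f x)\<^sup>2) \<longlongrightarrow> 0) at_top"
  proof (rule Lim_null_comparison[OF _ tl0])
    show "\<forall>\<^sub>F x in at_top. norm ((f x)\<^sup>2) \<le> tl x"
      using eventually_ge_at_top[of R] by eventually_elim (use b in simp)
  qed
  from tendsto_real_sqrt[OF this] show ?thesis by (simp add: tendsto_rabs_zero_iff)
qed

lemma powr_split_square:
  fixes x :: real
  assumes "2 < p"
  shows "\<bar>x\<bar> powr p = \<bar>x\<bar> powr (p - 2) * x\<^sup>2"
proof (cases "x = 0")
  case False
  have "\<bar>x\<bar> powr p = \<bar>x\<bar> powr (p - 2) * \<bar>x\<bar> powr 2" by (simp only: powr_add[symmetric]) simp
  also have "\<bar>x\<bar> powr 2 = x\<^sup>2" using False by simp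
  finally show ?thesis .
qed (use assms in simp)

lemma powr_set_integrable:
  fixes f :: "real \<Rightarrow> real"
  assumes c: "continuous_on D f" "D \<in> sets borel" and i: "set_integrable lborel D (\<lambda>x. (f x)\<^sup>2)"
    and p: "2 < p" and B: "\<And>x. x \<in> D \<Longrightarrow> \<bar>f x\<bar> \<le> B"
  shows "set_integrable lborel D (\<lambda>x. \<bar>f x\<bar> powr p)"
    "(LINT x:D|lborel. \<bar>f x\<bar> powr p) \<le> B powr (p - 2) * (LINT x:D|lborel. (f x)\<^sup>2)"
proof -
  have le: "\<bar>f x\<bar> powr p \<le> B powr (p - 2) * (f x)\<^sup>2" if "x \<in> D" for x
    unfolding powr_split_square[OF p] using B[OF that] p by (intro mult_right_mono powr_mono2) auto
  have cont: "continuous_on D (\<lambda>x. \<bar>f x\<bar> powr p)"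
    using c p by (intro continuous_on_powr' continuous_intros) auto
  show 1: "set_integrable lborel D (\<lambda>x. \<bar>f x\<bar> powr p)"
  proof (rule set_integrable_bound[where f="\<lambda>x. B powr (p - 2) * (f x)\<^sup>2"])
    show "AE x\<in>D in lborel. norm (\<bar>f x\<bar> powr p) \<le> norm (B powr (p - 2) * (f x)\<^sup>2)"
      using le by (intro always_eventually) auto
  qed (use i set_borel_measurable_cont[OF cont c(2)] in auto)
  have "(LINT x:D|lborel. \<bar>f x\<bar> powr p) \<le> (LINT x:D|lborel. B powr (p - 2) * (f x)\<^sup>2)"
    using 1 i le by (intro set_integral_mono) auto
  then show "(LINT x:D|lborel. \<bar>f x\<bar> powr p) \<le> B powr (p - 2) * (LINT x:D|lborel. (f x)\<^sup>2)" by simp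
qed

text \<open>\<open>R\<close> is where \<open>B powr a\<close> and \<open>\<eta> * B^4\<close>
  coincide. Since the fourth power of the supremum is controlled by the kinetic energy, this absorbs
  the two nonlinear terms, with exponents \<open>p - 2\<close> and \<open>q\<close>; both are below
  4 exactly because \<open>p < 6\<close> and \<open>q < 4\<close>.\<close>

lemma powr_le_quartic:
  fixes a \<eta> :: real
  assumes "0 \<le> a" "a < 4" "\<eta> > 0"
  obtains C where "C \<ge> 0" "\<And>B. B \<ge> 0 \<Longrightarrow> B powr a \<le> \<eta> * B^4 + C"
proof
  define R where "R = (1 / \<eta>) powr (1 / (4 - a))"
  show "0 \<le> R powr a" by simp
  fix B :: real assume B: "B \<ge> 0"
  have R: "R > 0" using assms by (simp add: R_def)
  show "B powr a \<le> \<eta> * B^4 + R powr a"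
  proof (cases "B \<le> R")
    case True
    then have "B powr a \<le> R powr a" using B assms by (intro powr_mono2) auto
    moreover have "0 \<le> \<eta> * B^4" using assms by simp
    ultimately show ?thesis by linarith
  next
    case False
    then have B0: "B > 0" using R by simp
    have "1 / \<eta> = R powr (4 - a)" using assms by (simp add: R_def powr_powr)
    also have "\<dots> \<le> B powr (4 - a)" using False R assms by (intro powr_mono2) auto
    finally have "1 \<le> \<eta> * B powr (4 - a)" using assms by (simp add: field_simps)
    then have "B powr a * 1 \<le> B powr a * (\<eta> * B powr (4 - a))" by (intro mult_left_mono) auto
    also have "\<dots> = \<eta> * (B powr a * B powr (4 - a))" by simp
    also have "B powr a * B powr (4 - a) = B powr 4" by (simp add: powr_add[symmetric])
    also have "B powr 4 = B^4" using B0 powr_realpow[of B 4] by simp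
    finally show ?thesis using powr_ge_zero[of R a] by linarith
  qed
qed

section \<open>Calibration at infinity\<close>

text \<open>\<open>calW p M\<close> below is nonnegative on \<open>[- M, M]\<close>, and \<open>calib p M\<close> is an antiderivative of its square root,
  obtained by scaling from \<open>M = 1\<close>.\<close>

definition cal_w :: "real \<Rightarrow> real \<Rightarrow> real" where
  "cal_w p r = sqrt (max 0 (r\<^sup>2 - \<bar>r\<bar> powr p))"

definition cal :: "real \<Rightarrow> real \<Rightarrow> real" where
  "cal p t = (LBINT y=0..t. cal_w p y)"

lemma continuous_cal_w: "2 < p \<Longrightarrow> continuous_on A (cal_w p)"
  unfolding cal_w_def[abs_def] by (intro continuous_intros continuous_on_powr') auto

lemma cal_0: "cal p 0 = 0" by (simp add: cal_def zero_ereal_def[symmetric])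

lemma cal_has_derivative:
  assumes "2 < p"
  shows "(cal p has_real_derivative cal_w p t) (at t)"
proof -
  define a where "a = min 0 t - 1"
  define b where "b = max 0 t + 1"
  have ab: "a \<le> 0" "0 \<le> b" "a < t" "t < b" by (auto simp: a_def b_def)
  have "((\<lambda>u. LBINT y=ereal 0..ereal u. cal_w p y) has_vector_derivative (cal_w p t)) (at t within {a..b})"
    using ab by (intro interval_integral_FTC2 continuous_cal_w assms) auto
  then show ?thesis using ab
    by (simp add: at_within_Icc_at has_real_derivative_iff_has_vector_derivative cal_def[abs_def] zero_ereal_def)
qed

lemma cal_w_nonneg: "0 \<le> cal_w p r" by (simp add: cal_w_def)

lemma cal_w_le: "cal_w p r \<le> \<bar>r\<bar>"
proof -
  have "max 0 (r\<^sup>2 - \<bar>r\<bar> powr p) \<le> r\<^sup>2" by simp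
  then have "cal_w p r \<le> sqrt (r\<^sup>2)" unfolding cal_w_def by (rule real_sqrt_le_mono)
  then show ?thesis by simp
qed

lemma cal_minus:
  assumes "2 < p" shows "cal p (- t) = - cal p t"
proof -
  have "((\<lambda>t. cal p t + cal p (- t)) has_real_derivative cal_w p t + cal_w p (- t) * (- 1)) (at t)" for t
    by (intro DERIV_add cal_has_derivative assms DERIV_chain2[OF cal_has_derivative[OF assms]] DERIV_minus DERIV_ident)
  then have "((\<lambda>t. cal p t + cal p (- t)) has_real_derivative 0) (at t)" for t by (simp add: cal_w_def)
  from DERIV_isconst_all[OF allI[OF this], of t 0] show ?thesis by (simp add: cal_0)
qed

lemma cal_mono: "2 < p \<Longrightarrow> s \<le> t \<Longrightarrow> cal p s \<le> cal p t"
  using cal_has_derivative cal_w_nonneg by (meson DERIV_nonneg_imp_nondecreasing)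

lemma cal_abs_le: assumes "2 < p" shows "\<bar>cal p t\<bar> \<le> t\<^sup>2 / 2"
proof -
  have main: "cal p t \<le> t\<^sup>2 / 2" if "t \<ge> 0" for t
  proof -
    have "(\<lambda>t. t\<^sup>2 / 2 - cal p t) 0 \<le> (\<lambda>t. t\<^sup>2 / 2 - cal p t) t"
    proof (rule DERIV_nonneg_imp_nondecreasing[OF that])
      fix x :: real assume "0 \<le> x"
      have "((\<lambda>t. t\<^sup>2 / 2 - cal p t) has_real_derivative x - cal_w p x) (at x)"
        by (rule derivative_eq_intros cal_has_derivative[OF assms] refl | simp)+
      moreover have "x - cal_w p x \<ge> 0" using cal_w_le[of p x] \<open>0 \<le> x\<close> by simp
      ultimately show "\<exists>y. ((\<lambda>t. t\<^sup>2 / 2 - cal p t) has_real_derivative y) (at x) \<and> y \<ge> 0" by blast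
    qed
    then show ?thesis by (simp add: cal_0)
  qed
  show ?thesis
  proof (cases "t \<ge> 0")
    case True
    then have "cal p 0 \<le> cal p t" by (intro cal_mono assms)
    then show ?thesis using main[OF True] by (simp add: cal_0)
  next
    case False
    then have "cal p 0 \<le> cal p (-t)" by (intro cal_mono assms) simp
    then show ?thesis using main[of "-t"] False cal_minus[OF assms, of t] by (simp add: cal_0)
  qed
qed

lemma cal_abs: assumes "2 < p" "\<bar>t\<bar> = M" shows "\<bar>cal p t\<bar> = cal p M"
proof -
  have "M \<ge> 0" using assms(2) by auto
  then have "cal p M \<ge> 0" using cal_mono[OF assms(1), of 0 M] by (simp add: cal_0)
  moreover have "t = M \<or> t = - M" using assms(2) by auto
  ultimately show ?thesis using cal_minus[OF assms(1), of M] by auto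
qed

lemma cal_1_pos: assumes "2 < p" shows "0 < cal p 1"
proof -
  have "cal p 0 < cal p 1"
  proof (rule DERIV_pos_imp_increasing_open[of 0 1 "cal p"])
    show "(0::real) < 1" by simp
    show "continuous_on {0..1} (cal p)"
      using cal_has_derivative[OF assms] by (meson DERIV_isCont continuous_at_imp_continuous_on)
    fix x :: real assume x: "0 < x" "x < 1"
    have "x powr p < x powr 2" using x assms by (intro powr_less_mono') auto
    then have "cal_w p x > 0" using x by (simp add: cal_w_def)
    then show "\<exists>y. (cal p has_real_derivative y) (at x) \<and> 0 < y" using cal_has_derivative[OF assms] by blast
  qed
  then show ?thesis by (simp add: cal_0)
qed

definition calib :: "real \<Rightarrow> real \<Rightarrow> real \<Rightarrow> real" where
  "calib p M s = sqrt (2 / p) * M powr (p / 2 + 1) * cal p (s / M)"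

definition calW :: "real \<Rightarrow> real \<Rightarrow> real \<Rightarrow> real" where
  "calW p M s = 2 / p * (M powr (p - 2) * s\<^sup>2 - \<bar>s\<bar> powr p)"

lemma calW_nonneg:
  assumes "2 < p" "\<bar>s\<bar> \<le> M" shows "0 \<le> calW p M s"
proof -
  have "\<bar>s\<bar> powr (p - 2) \<le> M powr (p - 2)" using assms by (intro powr_mono2) auto
  then have "\<bar>s\<bar> powr p \<le> M powr (p - 2) * s\<^sup>2"
    unfolding powr_split_square[OF assms(1)] by (intro mult_right_mono) auto
  then show ?thesis using assms by (simp add: calW_def)
qed

definition calib' :: "real \<Rightarrow> real \<Rightarrow> real \<Rightarrow> real" where
  "calib' p M s = sqrt (2 / p) * M powr (p / 2) * cal_w p (s / M)"

lemma calib_has_derivative: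
  assumes "2 < p" "0 < M"
  shows "(calib p M has_real_derivative calib' p M s) (at s)"
proof -
  have d: "((\<lambda>s. s / M) has_real_derivative 1 / M) (at s)" using assms by (auto intro!: derivative_eq_intros)
  have "(calib p M has_real_derivative sqrt (2 / p) * M powr (p / 2 + 1) * (cal_w p (s / M) * (1 / M))) (at s)"
    unfolding calib_def[abs_def] by (intro DERIV_cmult DERIV_chain2[OF cal_has_derivative[OF assms(1)]] d)
  moreover have "M powr (p / 2 + 1) = M powr (p / 2) * M" using assms by (simp add: powr_add)
  ultimately show ?thesis using assms by (simp add: calib'_def mult.assoc)
qed

lemma calib'_square:
  assumes "2 < p" "0 < M" "\<bar>s\<bar> \<le> M"
  shows "(calib' p M s)\<^sup>2 = calW p M s"
proof -
  have "\<bar>s / M\<bar> powr p \<le> (s / M)\<^sup>2"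
  proof -
    have "\<bar>s / M\<bar> powr (p - 2) \<le> 1" using assms by (intro powr_le1) auto
    then show ?thesis unfolding powr_split_square[OF assms(1)] by (simp add: mult_left_le_one_le)
  qed
  then have "(cal_w p (s / M))\<^sup>2 = (s / M)\<^sup>2 - \<bar>s / M\<bar> powr p" by (simp add: cal_w_def)
  also have "\<bar>s / M\<bar> powr p = \<bar>s\<bar> powr p / M powr p" using assms by (simp add: powr_divide)
  finally have "(calib' p M s)\<^sup>2 = 2 / p * (M powr (p / 2))\<^sup>2 * (s\<^sup>2 / M\<^sup>2 - \<bar>s\<bar> powr p / M powr p)"
    using assms by (simp add: calib'_def power_mult_distrib power_divide)
  also have "(M powr (p / 2))\<^sup>2 = M powr p" using assms by (simp add: powr_power)
  also have "2 / p * M powr p * (s\<^sup>2 / M\<^sup>2 - \<bar>s\<bar> powr p / M powr p) = 2 / p * (M powr p / M\<^sup>2 * s\<^sup>2 - \<bar>s\<bar> powr p)"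
    using assms by (simp add: field_simps)
  also have "M powr p / M\<^sup>2 = M powr (p - 2)" using assms by (simp add: powr_diff)
  finally show ?thesis by (simp add: calW_def)
qed

text \<open>The price of cutting a half-line at a point is the value of \<open>calib\<close> there;
  being quadratic in that value, it disappears as the cut moves to infinity.\<close>

lemma calib_abs_le:
  assumes "2 < p" "0 < M"
  shows "\<bar>calib p M s\<bar> \<le> sqrt (2 / p) * M powr (p / 2 - 1) * s\<^sup>2 / 2"
proof -
  have "\<bar>calib p M s\<bar> = sqrt (2 / p) * M powr (p / 2 + 1) * \<bar>cal p (s / M)\<bar>"
    using assms by (simp add: calib_def abs_mult)
  also have "\<dots> \<le> sqrt (2 / p) * M powr (p / 2 + 1) * ((s / M)\<^sup>2 / 2)"
    using assms by (intro mult_left_mono cal_abs_le) auto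
  also have "\<dots> = sqrt (2 / p) * (M powr (p / 2 + 1) / M\<^sup>2) * s\<^sup>2 / 2" by (simp add: power_divide)
  also have "M powr (p / 2 + 1) / M\<^sup>2 = M powr (p / 2 + 1 - 2)" using assms by (subst powr_diff) auto
  finally show ?thesis by (simp add: algebra_simps)
qed

lemma calib_estimate:
  assumes H: "H1_on D f g" and D: "is_interval D" "D \<in> sets borel" and p: "2 < p" and M: "0 < M" "\<And>x. x \<in> D \<Longrightarrow> \<bar>f x\<bar> \<le> M"
    and xy: "x \<in> D" "y \<in> D" "x \<le> y"
  shows "set_integrable lborel D (\<lambda>t. ((g t)\<^sup>2 + calW p M (f t)) / 2)"
    "\<bar>calib p M (f y) - calib p M (f x)\<bar> \<le> (LINT t:{x..y}|lborel. ((g t)\<^sup>2 + calW p M (f t)) / 2)"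
proof -
  have sub: "{x..y} \<subseteq> D" using D(1) xy unfolding is_interval_1 by fastforce
  note h = H1_onD[OF H] and c = H1_on_continuous[OF H D(1)]
  have "set_integrable lborel D (\<lambda>t. calW p M (f t))"
    unfolding calW_def using h powr_set_integrable(1)[OF c D(2) h(4) p M(2)]
    by (intro set_integrable_mult_right set_integral_diff) auto
  then show i: "set_integrable lborel D (\<lambda>t. ((g t)\<^sup>2 + calW p M (f t)) / 2)"
    using h by (intro set_integrable_divide set_integral_add) auto
  have "ac_deriv D (\<lambda>x. calib p M (f x)) (\<lambda>x. calib' p M (f x) * g x)"
    by (rule ac_deriv_chain[OF h(1) c D(1) calib_has_derivative[OF p M(1)]])
       (unfold calib'_def, intro continuous_intros continuous_on_compose2[OF continuous_cal_w[OF p, of UNIV]], use M in auto)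
  note ac = ac_derivD[OF this xy]
  have "\<bar>calib p M (f y) - calib p M (f x)\<bar> \<le> (LINT t:{x..y}|lborel. \<bar>calib' p M (f t) * g t\<bar>)"
    unfolding ac(2) using set_integral_norm_bound[OF ac(1)] by simp
  also have "\<dots> \<le> (LINT t:{x..y}|lborel. ((g t)\<^sup>2 + calW p M (f t)) / 2)"
  proof (rule set_integral_mono[OF set_integrable_abs[OF ac(1)]])
    show "set_integrable lborel {x..y} (\<lambda>t. ((g t)\<^sup>2 + calW p M (f t)) / 2)"
      by (rule set_integrable_subset[OF i]) (use sub in auto)
    fix t assume "t \<in> {x..y}"
    then have "\<bar>f t\<bar> \<le> M" using sub M(2) by blast
    note sq = calib'_square[OF p M(1) this]
    have "0 \<le> (\<bar>calib' p M (f t)\<bar> - \<bar>g t\<bar>)\<^sup>2" by simp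
    then show "\<bar>calib' p M (f t) * g t\<bar> \<le> ((g t)\<^sup>2 + calW p M (f t)) / 2"
      by (simp add: power2_diff abs_mult sq)
  qed
  finally show "\<bar>calib p M (f y) - calib p M (f x)\<bar> \<le> (LINT t:{x..y}|lborel. ((g t)\<^sup>2 + calW p M (f t)) / 2)" .
qed

text \<open>The factor 2 counts two passages: up from the cut \<open>R\<close> to the maximum at
  \<open>x0\<close>, and down again to a far point \<open>y\<close> where \<open>f\<close> is nearly
  0. Only the first passage starts at a value that need not be small, hence the correction in
  \<open>f R\<close>.\<close>

lemma half_line_estimate:
  assumes H: "H1_on {R..} f g" and p: "2 < p" and M: "0 < M" "\<And>x. x \<ge> R \<Longrightarrow> \<bar>f x\<bar> \<le> M"
  shows "0 \<le> (LINT t:{R..}|lborel. ((g t)\<^sup>2 + calW p M (f t)) / 2)"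
    "x0 \<ge> R \<Longrightarrow> \<bar>f x0\<bar> = M \<Longrightarrow> 2 * calib p M M - sqrt (2 / p) * M powr (p / 2 - 1) * (f R)\<^sup>2 / 2 \<le>
       (LINT t:{R..}|lborel. ((g t)\<^sup>2 + calW p M (f t)) / 2)"
proof -
  have iv: "is_interval {R..}" by (auto simp: is_interval_1)
  have M': "\<bar>f x\<bar> \<le> M" if "x \<in> {R..}" for x using M(2) that by simp
  note ce = calib_estimate[OF H iv _ p M(1) M']
  let ?Q = "\<lambda>t. ((g t)\<^sup>2 + calW p M (f t)) / 2"
  have Q0: "0 \<le> ?Q t" if "t \<ge> R" for t using calW_nonneg[OF p M(2)[OF that]] by simp
  show "0 \<le> (LINT t:{R..}|lborel. ?Q t)" by (rule LINT_nonneg) (use Q0 in auto)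
  assume x0: "x0 \<ge> R" "\<bar>f x0\<bar> = M"
  define K where "K = sqrt (2 / p) * M powr (p / 2 - 1) / 2"
  have K: "K > 0" using p M by (simp add: K_def)
  have cK: "\<bar>calib p M s\<bar> \<le> K * s\<^sup>2" for s using calib_abs_le[OF p M(1), of s] by (simp add: K_def)
  \<comment> \<open>The maximum of \<open>\<bar>f\<bar>\<close> may be attained with a negative
    sign; \<open>cal\<close> is odd.\<close>
  have cM: "\<bar>calib p M (f x0)\<bar> = calib p M M"
  proof -
    have "\<bar>f x0 / M\<bar> = 1" using x0 M by simp
    from cal_abs[OF p this] show ?thesis using M p by (simp add: calib_def abs_mult)
  qed
  have "2 * calib p M M - K * (f R)\<^sup>2 \<le> (LINT t:{R..}|lborel. ?Q t)"
  proof (rule field_le_epsilon)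
    fix r :: real assume r: "r > 0"
    obtain y where y: "x0 \<le> y" "(f y)\<^sup>2 < r / K"
      using small_value_at_infinity[OF H1_onD(4)[OF H] x0(1), of "r / K"] r K by auto
    have 1: "\<bar>calib p M (f x0) - calib p M (f R)\<bar> \<le> (LINT t:{R..x0}|lborel. ?Q t)"
      by (rule ce(2)) (use x0 in auto)
    have 2: "\<bar>calib p M (f y) - calib p M (f x0)\<bar> \<le> (LINT t:{x0..y}|lborel. ?Q t)"
      by (rule ce(2)) (use x0 y in auto)
    have i: "set_integrable lborel {R..} ?Q" using ce(1)[of R R] by simp
    have "(LINT t:{R..x0}|lborel. ?Q t) + (LINT t:{x0..y}|lborel. ?Q t) = (LINT t:{R..y}|lborel. ?Q t)"
      by (rule LINT_Icc_split[symmetric, OF x0(1) y(1) set_integrable_subset[OF i]]) auto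
    also have "\<dots> \<le> (LINT t:{R..}|lborel. ?Q t)"
      by (rule LINT_nonneg_mono_set[OF i]) (use Q0 in auto)
    finally have 3: "(LINT t:{R..x0}|lborel. ?Q t) + (LINT t:{x0..y}|lborel. ?Q t) \<le> (LINT t:{R..}|lborel. ?Q t)" .
    have "K * (f y)\<^sup>2 \<le> r" using y(2) K by (simp add: field_simps)
    then show "2 * calib p M M - K * (f R)\<^sup>2 \<le> (LINT t:{R..}|lborel. ?Q t) + r"
      using 1 2 3 cM cK[of "f R"] cK[of "f y"] by linarith
  qed
  then show "2 * calib p M M - sqrt (2 / p) * M powr (p / 2 - 1) * (f R)\<^sup>2 / 2 \<le> (LINT t:{R..}|lborel. ?Q t)"
    by (simp add: K_def)
qed

lemma attains_max_abs:
  fixes f :: "real \<Rightarrow> real"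
  assumes c: "continuous_on {R..} f" and l: "(f \<longlongrightarrow> 0) at_top"
  obtains x where "x \<ge> R" "\<And>y. y \<ge> R \<Longrightarrow> \<bar>f y\<bar> \<le> \<bar>f x\<bar>"
proof (cases "\<exists>z\<ge>R. f z \<noteq> 0")
  case False
  then show thesis using that[of R] by auto
next
  case True
  then obtain z where z: "z \<ge> R" "f z \<noteq> 0" by blast
  have "\<forall>\<^sub>F y in at_top. \<bar>f y\<bar> < \<bar>f z\<bar>"
    using order_tendstoD(2)[OF tendsto_rabs_zero[OF l], of "\<bar>f z\<bar>"] z by simp
  then obtain X where X: "\<And>y. y \<ge> X \<Longrightarrow> \<bar>f y\<bar> < \<bar>f z\<bar>" by (auto simp: eventually_at_top_linorder)
  have "continuous_on {R..max z X} (\<lambda>y. \<bar>f y\<bar>)" using c by (intro continuous_intros) (auto intro: continuous_on_subset)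
  moreover have "{R..max z X} \<noteq> {}" using z by auto
  ultimately obtain x where x: "x \<in> {R..max z X}" "\<And>y. y \<in> {R..max z X} \<Longrightarrow> \<bar>f y\<bar> \<le> \<bar>f x\<bar>"
    using continuous_attains_sup[of "{R..max z X}" "\<lambda>y. \<bar>f y\<bar>"] by auto
  show thesis
  proof (rule that)
    show "x \<ge> R" using x by simp
    fix y assume "y \<ge> R"
    show "\<bar>f y\<bar> \<le> \<bar>f x\<bar>"
    proof (cases "y \<le> max z X")
      case True then show ?thesis using x(2) \<open>y \<ge> R\<close> by simp
    next
      case False
      then have "\<bar>f y\<bar> < \<bar>f z\<bar>" by (intro X) simp
      also have "\<bar>f z\<bar> \<le> \<bar>f x\<bar>" using z by (intro x) simp
      finally show ?thesis by simp
    qed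
  qed
qed

text \<open>Only the half-line carrying the maximum \<open>M\<close> contributes to the lower bound; the calibration
  with the common parameter \<open>M\<close> is nonnegative on all others.\<close>

lemma outer_estimate:
  fixes f g :: "'e \<Rightarrow> real \<Rightarrow> real"
  assumes fin: "finite H" and H: "\<And>h. h \<in> H \<Longrightarrow> H1_on {R..} (f h) (g h)"
    and p: "2 < p" and B: "\<And>h x. h \<in> H \<Longrightarrow> x \<ge> R \<Longrightarrow> \<bar>f h x\<bar> \<le> B"
    and m: "m = (\<Sum>h\<in>H. LINT x:{R..}|lborel. (f h x)\<^sup>2)" "m \<le> \<mu>" "\<mu> > 0"
    and e: "\<And>M. M \<ge> 0 \<Longrightarrow> e \<le> 2 * sqrt (2 / p) * cal p 1 * M powr (p / 2 + 1) - \<mu> / p * M powr (p - 2)"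
  shows "m / \<mu> * e - sqrt (2 / p) * B powr (p / 2 - 1) / 2 * (\<Sum>h\<in>H. (f h R)\<^sup>2) \<le>
    (\<Sum>h\<in>H. 1 / 2 * (LINT x:{R..}|lborel. (g h x)\<^sup>2) - 1 / p * (LINT x:{R..}|lborel. \<bar>f h x\<bar> powr p))"
proof -
  have iv: "is_interval {R..}" by (auto simp: is_interval_1)
  have m0: "m \<ge> 0" unfolding m by (intro sum_nonneg LINT_nonneg) auto
  define \<kappa> where "\<kappa> M = sqrt (2 / p) * M powr (p / 2 - 1) / 2" for M
  have \<kappa>0: "\<kappa> M \<ge> 0" for M using p by (simp add: \<kappa>_def)
  have "\<exists>x\<ge>R. \<forall>y\<ge>R. \<bar>f h y\<bar> \<le> \<bar>f h x\<bar>" if "h \<in> H" for h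
    using attains_max_abs[OF H1_on_continuous[OF H[OF that] iv] H1_on_tendsto_0[OF H[OF that]]] by metis
  then obtain z where z: "\<And>h. h \<in> H \<Longrightarrow> z h \<ge> R" "\<And>h y. h \<in> H \<Longrightarrow> y \<ge> R \<Longrightarrow> \<bar>f h y\<bar> \<le> \<bar>f h (z h)\<bar>"
    by metis
  show ?thesis
  \<comment> \<open>The calibration divides by \<open>M\<close>, so the case in which all functions
    vanish is treated apart.\<close>
  proof (cases "\<forall>h\<in>H. f h (z h) = 0")
    case True
    then have 0: "f h x = 0" if "h \<in> H" "x \<ge> R" for h x using z(2)[OF that] that by simp
    have "(LINT x:{R..}|lborel. \<bar>f h x\<bar> powr p) = 0" "(LINT x:{R..}|lborel. (f h x)\<^sup>2) = 0" if "h \<in> H" for h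
    proof -
      have "(LINT x:{R..}|lborel. \<bar>f h x\<bar> powr p) = (LINT x:{R..}|lborel. 0)"
        by (rule set_lebesgue_integral_cong) (use 0[OF that] p in auto)
      moreover have "(LINT x:{R..}|lborel. (f h x)\<^sup>2) = (LINT x:{R..}|lborel. 0)"
        by (rule set_lebesgue_integral_cong) (use 0[OF that] p in auto)
      ultimately show "(LINT x:{R..}|lborel. \<bar>f h x\<bar> powr p) = 0" "(LINT x:{R..}|lborel. (f h x)\<^sup>2) = 0"
        by (simp_all add: set_lebesgue_integral_def)
    qed
    then have "m = 0" "0 \<le> (\<Sum>h\<in>H. 1 / 2 * (LINT x:{R..}|lborel. (g h x)\<^sup>2) - 1 / p * (LINT x:{R..}|lborel. \<bar>f h x\<bar> powr p))"
      unfolding m by (auto intro!: sum_nonneg LINT_nonneg)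
    moreover have "0 \<le> \<kappa> B * (\<Sum>h\<in>H. (f h R)\<^sup>2)" by (intro mult_nonneg_nonneg \<kappa>0 sum_nonneg) auto
    ultimately show ?thesis by (simp add: \<kappa>_def)
  next
    case False
    then have ne: "H \<noteq> {}" by auto
    define M where "M = Max ((\<lambda>h. \<bar>f h (z h)\<bar>) ` H)"
    have "M \<in> (\<lambda>h. \<bar>f h (z h)\<bar>) ` H" unfolding M_def using fin ne by (intro Max_in) auto
    then obtain h0 where h0: "h0 \<in> H" "\<bar>f h0 (z h0)\<bar> = M" by auto
    have Mub: "\<bar>f h (z h)\<bar> \<le> M" if "h \<in> H" for h unfolding M_def using fin that by (intro Max_ge) auto
    have fM: "\<bar>f h x\<bar> \<le> M" if "h \<in> H" "x \<ge> R" for h x using z(2)[OF that] Mub[OF that(1)] by linarith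
    have M0: "M > 0" using False Mub by fastforce
    have MB: "M \<le> B" using B[OF h0(1) z(1)[OF h0(1)]] h0(2) by simp
    define S where "S = calib p M M"
    have S: "S = sqrt (2 / p) * cal p 1 * M powr (p / 2 + 1)" using M0 by (simp add: S_def calib_def)
    have S0: "S \<ge> 0" unfolding S using cal_1_pos[OF p] p by simp
    define Q where "Q h = (LINT t:{R..}|lborel. ((g h t)\<^sup>2 + calW p M (f h t)) / 2)" for h
    have Q: "Q h = 1 / 2 * (LINT x:{R..}|lborel. (g h x)\<^sup>2) - 1 / p * (LINT x:{R..}|lborel. \<bar>f h x\<bar> powr p)
       + M powr (p - 2) / p * (LINT x:{R..}|lborel. (f h x)\<^sup>2)" if h: "h \<in> H" for h
    proof -
      note hd = H1_onD[OF H[OF h]]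
      have ip: "set_integrable lborel {R..} (\<lambda>x. \<bar>f h x\<bar> powr p)"
        by (rule powr_set_integrable(1)[OF H1_on_continuous[OF H[OF h] iv] _ hd(4) p]) (use fM[OF h] in auto)
      have "(\<lambda>t. ((g h t)\<^sup>2 + calW p M (f h t)) / 2) =
        (\<lambda>t. 1 / 2 * (g h t)\<^sup>2 - 1 / p * (\<bar>f h t\<bar> powr p) + M powr (p - 2) / p * (f h t)\<^sup>2)"
        using p by (auto simp: calW_def field_simps)
      then show ?thesis unfolding Q_def using ip hd
        by (simp add: set_integral_add set_integral_diff)
    qed
    have Q0: "Q h \<ge> 0" if "h \<in> H" for h
      unfolding Q_def by (rule half_line_estimate(1)[OF H[OF that] p M0 fM[OF that]])
    have Qh0: "2 * S - \<kappa> M * (f h0 R)\<^sup>2 \<le> Q h0"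
      using half_line_estimate(2)[OF H[OF h0(1)] p M0 fM[OF h0(1)] z(1)[OF h0(1)] h0(2)]
      by (simp add: Q_def S_def \<kappa>_def)
    have "Q h0 \<le> (\<Sum>h\<in>H. Q h)" using Q0 fin h0(1) by (intro member_le_sum) auto
    moreover have "(\<Sum>h\<in>H. Q h) = (\<Sum>h\<in>H. 1 / 2 * (LINT x:{R..}|lborel. (g h x)\<^sup>2) - 1 / p * (LINT x:{R..}|lborel. \<bar>f h x\<bar> powr p))
       + M powr (p - 2) / p * m"
      unfolding m by (simp add: Q sum.distrib sum_distrib_left)
    moreover have "\<kappa> M * (f h0 R)\<^sup>2 \<le> \<kappa> B * (\<Sum>h\<in>H. (f h R)\<^sup>2)"
    proof (rule mult_mono)
      show "\<kappa> M \<le> \<kappa> B" using M0 MB p by (auto simp: \<kappa>_def intro!: mult_left_mono powr_mono2)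
      show "(f h0 R)\<^sup>2 \<le> (\<Sum>h\<in>H. (f h R)\<^sup>2)" using fin h0(1) by (intro member_le_sum) auto
    qed (use \<kappa>0 in auto)
    \<comment> \<open>The bound \<open>e\<close> belongs to the full mass \<open>\<mu>\<close>.
      Multiplying it by \<open>m / \<mu> \<le> 1\<close> turns the mass term into the right one and
      loses only on the nonnegative term \<open>2 * S\<close>.\<close>
    moreover have "m / \<mu> * e \<le> 2 * S - M powr (p - 2) / p * m"
    proof -
      have "m / \<mu> * e \<le> m / \<mu> * (2 * S - \<mu> / p * M powr (p - 2))"
        using e[of M] M0 m0 m(3) by (intro mult_left_mono) (auto simp: S)
      also have "\<dots> = m / \<mu> * (2 * S) - M powr (p - 2) / p * m" using m(3) by (simp add: field_simps)
      also have "m / \<mu> * (2 * S) \<le> 1 * (2 * S)" using m S0 by (intro mult_right_mono) auto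
      finally show ?thesis by simp
    qed
    ultimately show ?thesis using Qh0 by (simp add: \<kappa>_def)
  qed
qed

section \<open>The energy on a graph\<close>

locale nls_graph =
  fixes G :: "('v, 'e) metric_graph" and p q :: real
  assumes G: "is_metric_graph G" and nc: "noncompact G"
    and p: "2 < p" "p < 6" and q: "2 < q" "q < 4"
begin

abbreviation "D \<equiv> edge_dom G"
abbreviation "f u \<equiv> on_edge G u"
abbreviation "g u \<equiv> edge_deriv G u"

definition "kin u = graph_integral G (\<lambda>e x. \<bar>g u e x\<bar>\<^sup>2)"
definition "mass u = graph_integral G (\<lambda>e x. \<bar>f u e x\<bar>\<^sup>2)"
definition "pot u = graph_integral G (\<lambda>e x. \<bar>f u e x\<bar> powr p)"
definition "vpot u = (\<Sum>v\<in>verts G. \<bar>u (Vertex v)\<bar> powr q)"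

lemma energy_eq: "energy p q G u = 1 / 2 * kin u - 1 / p * pot u - 1 / q * vpot u"
  by (simp add: energy_def kin_def pot_def vpot_def)

lemma H1_mass_iff: "u \<in> H1_mass G \<mu> \<longleftrightarrow> u \<in> H1 G \<and> mass u = \<mu>"
  by (simp add: H1_mass_def mass_def)

lemma fin: "finite (edges G)" "finite (verts G)" "finite (half_lines G)"
  using G by (auto simp: is_metric_graph_def half_lines_def)

lemma len_pos: "e \<in> edges G \<Longrightarrow> 0 < len G e"
  using G by (auto simp: is_metric_graph_def)

lemma D_facts:
  assumes "e \<in> edges G"
  shows "is_interval (D e)" "D e \<in> sets borel"
  using dom_facts[OF len_pos[OF assms]] by (auto simp: edge_dom_eq)

lemma H1_edge: "u \<in> H1 G \<Longrightarrow> e \<in> edges G \<Longrightarrow> H1_on (D e) (f u e) (g u e)"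
  using H1_iff[OF G] by blast

text \<open>The factor 2 gives every edge room for an interval of length \<open>l\<close> at each of
  its ends.\<close>

lemma min_len: obtains l where "l > 0" "\<And>e. e \<in> edges G \<Longrightarrow> ereal (2 * l) \<le> len G e"
proof -
  have "\<exists>l>0. \<forall>e\<in>A. ereal (2 * l) \<le> len G e" if "finite A" "A \<subseteq> edges G" for A
    using that
  proof (induction A rule: finite_induct)
    case empty show ?case by (auto intro: exI[of _ 1])
  next
    case (insert a A)
    then obtain l where l: "l > 0" "\<forall>e\<in>A. ereal (2 * l) \<le> len G e" by auto
    have "0 < len G a" using insert len_pos by auto
    then obtain k where k: "k > 0" "ereal (2 * k) \<le> len G a"
    proof (cases "len G a")
      case (real r)
      then show thesis using that[of "r / 2"] \<open>0 < len G a\<close> by simp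
    qed (use that[of 1] in auto)
    have le: "ereal (2 * min l k) \<le> ereal (2 * l)" "ereal (2 * min l k) \<le> ereal (2 * k)" by simp_all
    have "\<forall>e\<in>insert a A. ereal (2 * min l k) \<le> len G e"
      using l(2) k(2) le order_trans by blast
    then show ?case using l(1) k(1) by (intro exI[of _ "min l k"]) auto
  qed
  from this[OF fin(1) order_refl] show thesis using that by blast
qed

text \<open>Bounds and limits are known along edges, while the energy also evaluates
  \<open>u\<close> at vertices. There is no isolated vertex: the origin of a half-line lies on an
  edge, and any other vertex is joined to it by bounded edges.\<close>

lemma vertex_on_edge:
  assumes "v \<in> verts G"
  obtains e x where "e \<in> edges G" "x \<in> D e" "chart G e x = Vertex v"
proof -
  note out = that
  obtain h where h: "h \<in> half_lines G" using nc by (auto simp: noncompact_def)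
  then have h': "h \<in> edges G" "src G h \<in> verts G" using G by (auto simp: half_lines_def is_metric_graph_def)
  have at_src: thesis if e: "e \<in> edges G" "src G e = v" for e
    using len_pos[OF e(1)] e
    by (intro out[of e 0]) (auto simp: chart_def edge_dom_def zero_ereal_def[symmetric])
  have at_tgt: thesis if e: "e \<in> bounded_edges G" "tgt G e = v" for e
  proof -
    have e': "e \<in> edges G" "len G e \<noteq> \<infinity>" using e by (auto simp: bounded_edges_def)
    obtain l where l: "len G e = ereal l" "l > 0" using e' len_pos[OF e'(1)] by (cases "len G e") auto
    show thesis using e e' l by (intro out[of e l]) (auto simp: chart_def edge_dom_def)
  qed
  show thesis
  proof (cases "v = src G h")
    case True then show ?thesis using at_src h' by blast
  next
    case False
    have "(v, src G h) \<in> (adjacency G)\<^sup>*" using G assms h' by (auto simp: is_metric_graph_def)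
    then obtain w where "(v, w) \<in> adjacency G" using False by (meson converse_rtranclE)
    then obtain e where "e \<in> bounded_edges G" "v = src G e \<or> v = tgt G e" by (auto simp: adjacency_def)
    then show ?thesis using at_src at_tgt by (auto simp: bounded_edges_def)
  qed
qed

lemma mass_edge_le:
  assumes "u \<in> H1 G" "e \<in> edges G"
  shows "(LINT x:D e|lborel. (f u e x)\<^sup>2) \<le> mass u" "(LINT x:D e|lborel. (g u e x)\<^sup>2) \<le> kin u"
proof -
  have le: "(LINT x:D e|lborel. (k e x)\<^sup>2) \<le> (\<Sum>e\<in>edges G. LINT x:D e|lborel. (k e x)\<^sup>2)" for k :: "'e \<Rightarrow> real \<Rightarrow> real"
    by (rule member_le_sum[OF assms(2) _ fin(1)]) (auto intro: LINT_nonneg)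
  show "(LINT x:D e|lborel. (f u e x)\<^sup>2) \<le> mass u" "(LINT x:D e|lborel. (g u e x)\<^sup>2) \<le> kin u"
    using le[of "f u"] le[of "g u"] by (simp_all add: mass_def kin_def graph_integral_def)
qed

lemma nonneg: "0 \<le> mass u" "0 \<le> kin u" "0 \<le> pot u" "0 \<le> vpot u"
  by (auto simp: mass_def kin_def pot_def vpot_def graph_integral_def intro!: sum_nonneg LINT_nonneg)

lemma sup_estimate:
  assumes "l > 0" "\<And>e. e \<in> edges G \<Longrightarrow> ereal (2 * l) \<le> len G e"
    and "u \<in> H1 G" "e \<in> edges G" "x \<in> D e" "s > 0"
  shows "(f u e x)\<^sup>2 \<le> mass u / l + s * mass u + kin u / s"
proof -
  have sub: "{0..l} \<subseteq> D e"
  proof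
    fix x assume "x \<in> {0..l}"
    then have "0 \<le> x" "ereal x \<le> ereal (2 * l)" using assms(1) by auto
    then show "x \<in> D e" using order_trans[OF _ assms(2)[OF assms(4)]] by (auto simp: edge_dom_def)
  qed
  have "(f u e x)\<^sup>2 \<le> (LINT t:D e|lborel. (f u e t)\<^sup>2) / l + s * (LINT t:D e|lborel. (f u e t)\<^sup>2) + (LINT t:D e|lborel. (g u e t)\<^sup>2) / s"
    by (rule H1_on_sup_bound[OF H1_edge[OF assms(3,4)] D_facts(1)[OF assms(4)] sub assms(1,5,6)])
  also have "\<dots> \<le> mass u / l + s * mass u + kin u / s"
    using assms mass_edge_le[OF assms(3,4)] by (intro add_mono divide_right_mono mult_left_mono) auto
  finally show ?thesis .
qed

text \<open>The choice \<open>s = sqrt (1 + kin u)\<close> balances \<open>s * \<mu>\<close> against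
  \<open>kin u / s\<close>, so that the squared supremum grows at most like the root of the kinetic
  energy.\<close>

lemma quartic_bound:
  assumes "\<mu> \<ge> 0"
  obtains K where "K > 0" "\<And>u e x. u \<in> H1_mass G \<mu> \<Longrightarrow> e \<in> edges G \<Longrightarrow> x \<in> D e \<Longrightarrow> (f u e x)^4 \<le> K * (1 + kin u)"
proof -
  obtain l where l: "l > 0" "\<And>e. e \<in> edges G \<Longrightarrow> ereal (2 * l) \<le> len G e" using min_len by blast
  show thesis
  proof (rule that)
    have "\<mu> / l + \<mu> + 1 > 0" using assms l(1) by (intro add_nonneg_pos add_nonneg_nonneg) auto
    then show "(\<mu> / l + \<mu> + 1)\<^sup>2 > 0" by (rule zero_less_power)
    fix u e x assume u: "u \<in> H1_mass G \<mu>" and e: "e \<in> edges G" "x \<in> D e"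
    define s where "s = sqrt (1 + kin u)"
    have T: "kin u \<ge> 0" by (rule nonneg)
    then have s: "s \<ge> 1" "s\<^sup>2 = 1 + kin u" by (auto simp: s_def)
    have "(f u e x)\<^sup>2 \<le> \<mu> / l + s * \<mu> + kin u / s"
      using sup_estimate[OF l _ e, of u s] u s by (simp add: H1_mass_iff)
    also have "kin u / s \<le> s" using s T by (simp add: field_simps power2_eq_square)
    also have "\<mu> / l \<le> s * (\<mu> / l)" using s assms l(1) mult_right_mono[of 1 s "\<mu> / l"] by simp
    finally have "(f u e x)\<^sup>2 \<le> s * (\<mu> / l + \<mu> + 1)" by (simp add: algebra_simps)
    then have "((f u e x)\<^sup>2)\<^sup>2 \<le> (s * (\<mu> / l + \<mu> + 1))\<^sup>2" by (intro power_mono) auto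
    then show "(f u e x)^4 \<le> (\<mu> / l + \<mu> + 1)\<^sup>2 * (1 + kin u)"
      using s(2) by (simp add: power_mult_distrib power_mult[symmetric] mult.commute)
  qed
qed

lemma abs_le_root4: "x^4 \<le> y \<Longrightarrow> \<bar>x\<bar> \<le> root 4 y" for x y :: real
proof -
  assume "x^4 \<le> y"
  then have "root 4 (\<bar>x\<bar>^4) \<le> root 4 y" by (intro real_root_le_mono) auto
  moreover have "root 4 (\<bar>x\<bar>^4) = \<bar>x\<bar>" by (rule real_root_power_cancel) auto
  ultimately show ?thesis by linarith
qed

lemma pot_le:
  assumes "u \<in> H1 G" "\<And>e x. e \<in> edges G \<Longrightarrow> x \<in> D e \<Longrightarrow> \<bar>f u e x\<bar> \<le> B"
  shows "pot u \<le> B powr (p - 2) * mass u"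
proof -
  have "(LINT x:D e|lborel. \<bar>f u e x\<bar> powr p) \<le> B powr (p - 2) * (LINT x:D e|lborel. \<bar>f u e x\<bar>\<^sup>2)" if e: "e \<in> edges G" for e
    using powr_set_integrable(2)[OF H1_on_continuous[OF H1_edge[OF assms(1) e] D_facts(1)[OF e]] D_facts(2)[OF e] 
        H1_onD(4)[OF H1_edge[OF assms(1) e]] p(1) assms(2)[OF e]] by simp
  then show ?thesis unfolding pot_def mass_def graph_integral_def sum_distrib_left by (rule sum_mono)
qed

lemma vpot_le:
  assumes "\<And>e x. e \<in> edges G \<Longrightarrow> x \<in> D e \<Longrightarrow> \<bar>f u e x\<bar> \<le> B"
  shows "vpot u \<le> card (verts G) * B powr q"
proof -
  have "\<bar>u (Vertex v)\<bar> powr q \<le> B powr q" if v: "v \<in> verts G" for v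
  proof -
    obtain e x where "e \<in> edges G" "x \<in> D e" "chart G e x = Vertex v" by (rule vertex_on_edge[OF v])
    then have "\<bar>u (Vertex v)\<bar> \<le> B" using assms[of e x] by (simp add: on_edge_def)
    then show ?thesis using q by (intro powr_mono2) auto
  qed
  then have "vpot u \<le> (\<Sum>v\<in>verts G. B powr q)" unfolding vpot_def by (rule sum_mono)
  then show ?thesis by simp
qed

lemma coercive:
  assumes "\<mu> > 0"
  obtains C where "\<And>u. u \<in> H1_mass G \<mu> \<Longrightarrow> kin u / 4 - C \<le> energy p q G u"
proof -
  obtain K where K: "K > 0" "\<And>u e x. u \<in> H1_mass G \<mu> \<Longrightarrow> e \<in> edges G \<Longrightarrow> x \<in> D e \<Longrightarrow> (f u e x)^4 \<le> K * (1 + kin u)"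
    using quartic_bound[of \<mu>] assms by (metis less_imp_le)
  define a where "a = \<mu> / p"
  define b where "b = real (card (verts G)) / q"
  have ab: "a > 0" "b \<ge> 0" using assms p q by (auto simp: a_def b_def)
  \<comment> \<open>With this \<open>\<eta>\<close> the two nonlinear terms together absorb
    \<open>kin u / 4\<close> up to constants, which is half of the kinetic part of the
    energy.\<close>
  define \<eta> where "\<eta> = 1 / (4 * K * (a + b))"
  have \<eta>: "\<eta> > 0" using ab K by (simp add: \<eta>_def add_pos_nonneg)
  obtain C1 where C1: "C1 \<ge> 0" "\<And>B. B \<ge> 0 \<Longrightarrow> B powr (p - 2) \<le> \<eta> * B^4 + C1"
    using powr_le_quartic[of "p - 2" \<eta>] p \<eta> by auto
  obtain C2 where C2: "C2 \<ge> 0" "\<And>B. B \<ge> 0 \<Longrightarrow> B powr q \<le> \<eta> * B^4 + C2"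
    using powr_le_quartic[of q \<eta>] q \<eta> by auto
  show thesis
  proof (rule that)
    fix u assume u: "u \<in> H1_mass G \<mu>"
    define B where "B = root 4 (K * (1 + kin u))"
    have T: "kin u \<ge> 0" by (rule nonneg)
    have B: "B \<ge> 0" "B^4 = K * (1 + kin u)" using K T by (auto simp: B_def)
    have fB: "\<bar>f u e x\<bar> \<le> B" if "e \<in> edges G" "x \<in> D e" for e x
      unfolding B_def by (rule abs_le_root4[OF K(2)[OF u that]])
    have "pot u \<le> B powr (p - 2) * \<mu>" using pot_le[OF _ fB] u by (auto simp: H1_mass_iff)
    also have "\<dots> \<le> (\<eta> * B^4 + C1) * \<mu>" using C1(2)[OF B(1)] assms by (intro mult_right_mono) simp_all
    finally have 1: "1 / p * pot u \<le> a * (\<eta> * B^4 + C1)" using p by (simp add: a_def field_simps)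
    have "vpot u \<le> card (verts G) * B powr q" by (rule vpot_le[OF fB])
    also have "\<dots> \<le> card (verts G) * (\<eta> * B^4 + C2)" using C2(2)[OF B(1)] by (intro mult_left_mono) simp_all
    finally have 2: "1 / q * vpot u \<le> b * (\<eta> * B^4 + C2)" using q by (simp add: b_def field_simps)
    have e1: "\<eta> * K * (a + b) = 1 / 4" using ab K by (simp add: \<eta>_def)
    have "(a + b) * (\<eta> * B^4) = (\<eta> * K * (a + b)) * (1 + kin u)" unfolding B(2) by (simp only: mult_ac)
    then have "(a + b) * (\<eta> * B^4) = (1 + kin u) / 4" unfolding e1 by simp
    then have "a * (\<eta> * B^4 + C1) + b * (\<eta> * B^4 + C2) = (1 + kin u) / 4 + a * C1 + b * C2"
      by (simp add: algebra_simps)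
    with 1 2 show "kin u / 4 - (1 / 4 + a * C1 + b * C2) \<le> energy p q G u"
      unfolding energy_eq by argo
  qed
qed

lemma scaled:
  assumes u: "u \<in> H1 G" and c: "c \<ge> 0"
  shows "(\<lambda>P. c * u P) \<in> H1 G" "mass (\<lambda>P. c * u P) = c\<^sup>2 * mass u" "kin (\<lambda>P. c * u P) = c\<^sup>2 * kin u"
    "pot (\<lambda>P. c * u P) = c powr p * pot u" "vpot (\<lambda>P. c * u P) = c powr q * vpot u"
proof -
  have fc: "f (\<lambda>P. c * u P) e x = c * f u e x" for e x by (simp add: on_edge_def)
  have H: "H1_on (D e) (f (\<lambda>P. c * u P) e) (\<lambda>x. c * g u e x)" if "e \<in> edges G" for e
    unfolding fc[abs_def] by (rule H1_on_cmult[OF H1_edge[OF u that]])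
  from H1_onI_graph[OF G this] show "(\<lambda>P. c * u P) \<in> H1 G" "kin (\<lambda>P. c * u P) = c\<^sup>2 * kin u"
    by (simp_all add: kin_def graph_integral_def power_mult_distrib sum_distrib_left)
  show "mass (\<lambda>P. c * u P) = c\<^sup>2 * mass u" "pot (\<lambda>P. c * u P) = c powr p * pot u" "vpot (\<lambda>P. c * u P) = c powr q * vpot u"
    using c by (simp_all add: mass_def pot_def vpot_def graph_integral_def fc power_mult_distrib sum_distrib_left abs_mult powr_mult)
qed

lemma energy_scaled_le:
  assumes u: "u \<in> H1 G" and c: "c \<ge> 1"
  shows "energy p q G (\<lambda>P. c * u P) \<le> c\<^sup>2 * energy p q G u"
proof -
  have "c powr 2 \<le> c powr p" "c powr 2 \<le> c powr q" using c p q by (intro powr_mono; simp)+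
  then have "c\<^sup>2 \<le> c powr p" "c\<^sup>2 \<le> c powr q" using c by simp_all
  then have "c\<^sup>2 * (1 / p * pot u) \<le> c powr p * (1 / p * pot u)" "c\<^sup>2 * (1 / q * vpot u) \<le> c powr q * (1 / q * vpot u)"
    using p q nonneg[of u] by (intro mult_right_mono; simp)+
  then show ?thesis unfolding energy_eq using scaled[OF u, of c] c by (simp add: algebra_simps)
qed

lemma ground_stateI:
  assumes "u \<in> H1_mass G \<mu>" "\<And>w. w \<in> H1_mass G \<mu> \<Longrightarrow> energy p q G u \<le> energy p q G w"
  shows "ground_state p q G \<mu> u"
  unfolding ground_state_def using assms by (auto intro!: antisym INF_greatest INF_lower)

text \<open>Sending the weight \<open>s\<close> of \<open>sup_estimate\<close> to infinity shows
  that mass 0 forces \<open>u\<close> to vanish. This covers the case in which a function cannot be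
  rescaled to mass \<open>\<mu>\<close>.\<close>

lemma energy_ge_of_mass_0:
  assumes u: "u \<in> H1 G" "mass u = 0"
  shows "energy p q G u \<ge> 0"
proof -
  obtain l where l: "l > 0" "\<And>e. e \<in> edges G \<Longrightarrow> ereal (2 * l) \<le> len G e" using min_len by blast
  have z: "f u e x = 0" if e: "e \<in> edges G" "x \<in> D e" for e x
  proof -
    have "(f u e x)\<^sup>2 \<le> 0"
    proof (rule field_le_epsilon)
      fix r :: real assume r: "r > 0"
      have k: "kin u \<ge> 0" by (rule nonneg)
      have "(f u e x)\<^sup>2 \<le> kin u / ((kin u + 1) / r)"
        using sup_estimate[OF l u(1) e, of "(kin u + 1) / r"] u(2) r k by simp
      also have "\<dots> \<le> r" using r k by (simp add: field_simps)
      finally show "(f u e x)\<^sup>2 \<le> 0 + r" by simp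
    qed
    then show ?thesis by simp
  qed
  have "pot u \<le> 0 powr (p - 2) * mass u" by (rule pot_le[OF u(1)]) (use z in auto)
  moreover have "vpot u \<le> card (verts G) * 0 powr q" by (rule vpot_le) (use z in auto)
  ultimately have "pot u = 0" "vpot u = 0" using nonneg[of u] q u(2) by auto
  then show ?thesis using nonneg[of u] by (simp add: energy_eq)
qed

end

section \<open>Compactness of minimizing sequences\<close>

lemma LINT_Icc_tendsto:
  fixes h :: "nat \<Rightarrow> real \<Rightarrow> real"
  assumes "\<And>n. continuous_on {a..b} (h n)" "continuous_on {a..b} k"
    and "\<And>n x. x \<in> {a..b} \<Longrightarrow> \<bar>h n x\<bar> \<le> C" and "\<And>x. x \<in> {a..b} \<Longrightarrow> (\<lambda>n. h n x) \<longlonglongrightarrow> k x"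
  shows "(\<lambda>n. LINT x:{a..b}|lborel. h n x) \<longlonglongrightarrow> (LINT x:{a..b}|lborel. k x)"
  unfolding set_lebesgue_integral_def
proof (rule integral_dominated_convergence[where w="\<lambda>x. indicat_real {a..b} x *\<^sub>R C"])
  show "integrable lborel (\<lambda>x. indicat_real {a..b} x *\<^sub>R C)"
    using set_integrable_const_Icc[of a b C] by (simp add: set_integrable_def)
  show "(\<lambda>x. indicat_real {a..b} x *\<^sub>R k x) \<in> borel_measurable lborel"
    "(\<lambda>x. indicat_real {a..b} x *\<^sub>R h n x) \<in> borel_measurable lborel" for n
    using set_borel_measurable_cont assms(1,2) by (auto simp: set_borel_measurable_def)
  show "AE x in lborel. (\<lambda>n. indicat_real {a..b} x *\<^sub>R h n x) \<longlonglongrightarrow> indicat_real {a..b} x *\<^sub>R k x"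
    using assms(4) by (intro always_eventually) (auto simp: indicator_def)
  show "AE x in lborel. norm (indicat_real {a..b} x *\<^sub>R h n x) \<le> indicat_real {a..b} x *\<^sub>R C" for n
    using assms(3) by (intro always_eventually) (auto simp: indicator_def)
qed

lemma rational_near:
  assumes "0 < L" "x \<in> cdom L" "\<delta> > 0"
  obtains r where "r \<in> \<rat>" "r \<in> cdom L" "\<bar>x - r\<bar> < \<delta>"
proof (cases "x = 0")
  case True
  then show thesis using that[of 0] assms by simp
next
  case False
  then have "max 0 (x - \<delta>) < x" using assms by (auto simp: cdom_def)
  then obtain r where r: "r \<in> \<rat>" "max 0 (x - \<delta>) < r" "r < x" using Rats_dense_in_real by blast
  have "ereal r \<le> ereal x" using r by simp
  moreover have "ereal x \<le> L" using assms(2) by (simp add: cdom_def)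
  ultimately have "ereal r \<le> L" by (rule order_trans)
  then show thesis using r that[of r] by (auto simp: cdom_def)
qed

context nls_graph
begin

text \<open>\<open>e\<close> bounds the energy level of the real line at mass \<open>\<mu>\<close> from below, whatever the maximum \<open>M\<close>.\<close>

definition "infinity_bound \<mu> e \<longleftrightarrow>
  (\<forall>M\<ge>0. e \<le> 2 * sqrt (2 / p) * cal p 1 * M powr (p / 2 + 1) - \<mu> / p * M powr (p - 2))"

definition cut :: "'e \<Rightarrow> nat \<Rightarrow> real" where
  "cut e k = (if len G e = \<infinity> then real k else real_of_ereal (len G e))"

lemma edge_cases:
  assumes "e \<in> edges G"
  obtains "e \<in> half_lines G" "D e = {0..}" "\<And>k. cut e k = real k"
  | "e \<notin> half_lines G" "\<And>k. D e = {0..cut e k}"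
  using len_pos[OF assms]
proof (cases rule: dom_cases)
  case 1
  then show thesis using that(1) assms by (simp add: half_lines_def edge_dom_eq cut_def)
next
  case (2 l)
  then show thesis using that(2) by (simp add: half_lines_def edge_dom_eq cut_def)
qed

lemma cut_sub: "e \<in> edges G \<Longrightarrow> {0..cut e k} \<subseteq> D e"
  by (erule edge_cases[where thesis="{0..cut e k} \<subseteq> D e"]) auto

lemma LINT_cut_tendsto:
  fixes F :: "real \<Rightarrow> real"
  assumes "e \<in> edges G" "set_integrable lborel (D e) F"
  shows "(\<lambda>k. LINT x:{0..cut e k}|lborel. F x) \<longlonglongrightarrow> (LINT x:D e|lborel. F x)"
  using assms(1)
proof (cases rule: edge_cases)
  case 1
  have "((\<lambda>b. LINT x:{0..b}|lborel. F x) \<longlongrightarrow> (LINT x:{0..}|lborel. F x)) at_top"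
    by (rule tendsto_set_lebesgue_integral_at_top) (use assms 1 in auto)
  from filterlim_compose[OF this filterlim_real_sequentially] show ?thesis using 1 by simp
next
  case 2
  have "(LINT x:{0..cut e k}|lborel. F x) = (LINT x:D e|lborel. F x)" for k using 2(2)[of k] by simp
  then show ?thesis by simp
qed

lemma LINT_split_half_lines:
  fixes F :: "'e \<Rightarrow> real \<Rightarrow> real"
  assumes "\<And>e. e \<in> edges G \<Longrightarrow> set_integrable lborel (D e) (F e)"
  shows "graph_integral G F = (\<Sum>e\<in>edges G. LINT x:{0..cut e k}|lborel. F e x) + (\<Sum>e\<in>half_lines G. LINT x:{real k..}|lborel. F e x)"
proof -
  have "(LINT x:D e|lborel. F e x) = (LINT x:{0..cut e k}|lborel. F e x) + (if e \<in> half_lines G then LINT x:{real k..}|lborel. F e x else 0)"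
    if e: "e \<in> edges G" for e
    using e
  proof (cases rule: edge_cases)
    case 1
    have i: "set_integrable lborel {0..} (F e)" using assms[OF e] 1 by simp
    have "(LINT x:{0..real k} \<union> {real k..}|lborel. F e x) = (LINT x:{0..real k}|lborel. F e x) + (LINT x:{real k..}|lborel. F e x)"
      by (intro set_integral_Un_AE AE_I[where N="{real k}"]) (auto intro: set_integrable_subset[OF i])
    moreover have "{0..real k} \<union> {real k..} = {0..}" by auto
    ultimately show ?thesis using 1 by simp
  next
    case 2
    from 2(2)[of k] 2(1) show ?thesis by simp
  qed
  then have "graph_integral G F = (\<Sum>e\<in>edges G. (LINT x:{0..cut e k}|lborel. F e x) + (if e \<in> half_lines G then LINT x:{real k..}|lborel. F e x else 0))"
    unfolding graph_integral_def by (intro sum.cong) auto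
  also have "\<dots> = (\<Sum>e\<in>edges G. LINT x:{0..cut e k}|lborel. F e x) + (\<Sum>e\<in>edges G. if e \<in> half_lines G then LINT x:{real k..}|lborel. F e x else 0)"
    by (rule sum.distrib)
  also have "(\<Sum>e\<in>edges G. if e \<in> half_lines G then LINT x:{real k..}|lborel. F e x else 0) = (\<Sum>e\<in>half_lines G. LINT x:{real k..}|lborel. F e x)"
    using fin(1) by (subst sum.inter_restrict[symmetric]) (auto simp: half_lines_def intro!: sum.cong)
  finally show ?thesis .
qed

lemma integrable_on_edge:
  assumes "u \<in> H1 G" "e \<in> edges G"
  shows "set_integrable lborel (D e) (\<lambda>x. (f u e x)\<^sup>2)" "set_integrable lborel (D e) (\<lambda>x. (g u e x)\<^sup>2)"
    "set_integrable lborel (D e) (\<lambda>x. \<bar>f u e x\<bar> powr p)" "continuous_on (D e) (f u e)"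
proof -
  note H = H1_edge[OF assms]
  show "set_integrable lborel (D e) (\<lambda>x. (f u e x)\<^sup>2)" "set_integrable lborel (D e) (\<lambda>x. (g u e x)\<^sup>2)"
    using H1_onD[OF H] by auto
  show c: "continuous_on (D e) (f u e)" by (rule H1_on_continuous[OF H D_facts(1)[OF assms(2)]])
  obtain K where K: "K > 0" "\<And>w e x. w \<in> H1_mass G (mass u) \<Longrightarrow> e \<in> edges G \<Longrightarrow> x \<in> D e \<Longrightarrow> (f w e x)^4 \<le> K * (1 + kin w)"
    using quartic_bound[OF nonneg(1)[of u]] by blast
  have "\<bar>f u e x\<bar> \<le> root 4 (K * (1 + kin u))" if "x \<in> D e" for x
    by (intro abs_le_root4 K(2)[OF _ assms(2) that]) (simp add: H1_mass_iff assms)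
  from powr_set_integrable(1)[OF c D_facts(2)[OF assms(2)] H1_onD(4)[OF H] p(1) this]
  show "set_integrable lborel (D e) (\<lambda>x. \<bar>f u e x\<bar> powr p)" .
qed

text \<open>All vertices belong to the inner part, so it carries the whole vertex term; what lies
  beyond the cuts only sees the energy of a line.\<close>

definition "inner_energy k u = 1 / 2 * (\<Sum>e\<in>edges G. LINT x:{0..cut e k}|lborel. (g u e x)\<^sup>2)
   - 1 / p * (\<Sum>e\<in>edges G. LINT x:{0..cut e k}|lborel. \<bar>f u e x\<bar> powr p) - 1 / q * vpot u"

definition "inner_mass k u = (\<Sum>e\<in>edges G. LINT x:{0..cut e k}|lborel. (f u e x)\<^sup>2)"

lemma inner_tendsto:
  assumes "u \<in> H1 G"
  shows "(\<lambda>k. inner_energy k u) \<longlonglongrightarrow> energy p q G u" "(\<lambda>k. inner_mass k u) \<longlonglongrightarrow> mass u"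
  unfolding inner_energy_def energy_eq inner_mass_def mass_def kin_def pot_def graph_integral_def power2_abs
  by (intro tendsto_intros LINT_cut_tendsto integrable_on_edge[OF assms]; assumption)+

text \<open>The pieces beyond the cuts are estimated jointly by \<open>outer_estimate\<close>; their
  total mass is what \<open>inner_mass\<close> leaves over.\<close>

lemma energy_ge_inner:
  assumes u: "u \<in> H1_mass G \<mu>" and \<mu>: "\<mu> > 0" and e: "infinity_bound \<mu> e"
    and B: "\<And>e x. e \<in> edges G \<Longrightarrow> x \<in> D e \<Longrightarrow> \<bar>f u e x\<bar> \<le> B"
  shows "inner_energy k u + (\<mu> - inner_mass k u) / \<mu> * e
     - sqrt (2 / p) * B powr (p / 2 - 1) / 2 * (\<Sum>h\<in>half_lines G. (f u h (real k))\<^sup>2) \<le> energy p q G u"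
proof -
  have u': "u \<in> H1 G" "mass u = \<mu>" using u by (auto simp: H1_mass_iff)
  define m where "m = (\<Sum>h\<in>half_lines G. LINT x:{real k..}|lborel. (f u h x)\<^sup>2)"
  have hl: "h \<in> edges G" "D h = {0..}" if "h \<in> half_lines G" for h
    using that by (auto simp: half_lines_def edge_dom_def)
  have "mass u = inner_mass k u + m"
    unfolding mass_def inner_mass_def m_def power2_abs by (rule LINT_split_half_lines[OF integrable_on_edge(1)[OF u'(1)]])
  then have m: "m = \<mu> - inner_mass k u" using u' by simp
  have im: "0 \<le> inner_mass k u" unfolding inner_mass_def by (intro sum_nonneg LINT_nonneg) simp
  have "m / \<mu> * e - sqrt (2 / p) * B powr (p / 2 - 1) / 2 * (\<Sum>h\<in>half_lines G. (f u h (real k))\<^sup>2) \<le>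
    (\<Sum>h\<in>half_lines G. 1 / 2 * (LINT x:{real k..}|lborel. (g u h x)\<^sup>2) - 1 / p * (LINT x:{real k..}|lborel. \<bar>f u h x\<bar> powr p))"
  proof (rule outer_estimate[OF fin(3) _ p(1)])
    fix h assume h: "h \<in> half_lines G"
    show "H1_on {real k..} (f u h) (g u h)"
      by (rule H1_on_subset[OF H1_edge[OF u'(1) hl(1)[OF h]]]) (use hl(2)[OF h] in auto)
    fix x assume "real k \<le> x"
    then show "\<bar>f u h x\<bar> \<le> B" using B[OF hl(1)[OF h]] hl(2)[OF h] by (auto intro: order_trans[of 0 "real k"])
  qed (use m im \<mu> e in \<open>auto simp: m_def infinity_bound_def\<close>)
  moreover have "kin u = (\<Sum>e\<in>edges G. LINT x:{0..cut e k}|lborel. (g u e x)\<^sup>2) + (\<Sum>h\<in>half_lines G. LINT x:{real k..}|lborel. (g u h x)\<^sup>2)"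
    unfolding kin_def power2_abs by (rule LINT_split_half_lines[OF integrable_on_edge(2)[OF u'(1)]])
  moreover have "pot u = (\<Sum>e\<in>edges G. LINT x:{0..cut e k}|lborel. \<bar>f u e x\<bar> powr p) + (\<Sum>h\<in>half_lines G. LINT x:{real k..}|lborel. \<bar>f u h x\<bar> powr p)"
    unfolding pot_def by (rule LINT_split_half_lines[OF integrable_on_edge(3)[OF u'(1)]])
  moreover have "(\<Sum>h\<in>half_lines G. 1 / 2 * (LINT x:{real k..}|lborel. (g u h x)\<^sup>2) - 1 / p * (LINT x:{real k..}|lborel. \<bar>f u h x\<bar> powr p))
    = 1 / 2 * (\<Sum>h\<in>half_lines G. LINT x:{real k..}|lborel. (g u h x)\<^sup>2) - 1 / p * (\<Sum>h\<in>half_lines G. LINT x:{real k..}|lborel. \<bar>f u h x\<bar> powr p)"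
    by (simp only: sum_subtractf sum_distrib_left)
  ultimately show ?thesis unfolding energy_eq inner_energy_def m[symmetric] by (simp only: distrib_left)
qed

lemma half_line_value_tendsto_0:
  assumes "u \<in> H1 G" "h \<in> half_lines G"
  shows "(\<lambda>k. f u h (real k)) \<longlonglongrightarrow> 0"
proof -
  have "h \<in> edges G" "D h = {0..}" using assms(2) by (auto simp: half_lines_def edge_dom_def)
  then have "H1_on {0..} (f u h) (g u h)" using H1_edge[OF assms(1), of h] by simp
  from filterlim_compose[OF H1_on_tendsto_0[OF this] filterlim_real_sequentially] show ?thesis .
qed

text \<open>A three-epsilon argument: the common kinetic bound makes the sequence equicontinuous on
  each edge, and \<open>\<delta>\<close> is chosen so that the oscillation over that distance stays
  below \<open>\<epsilon> / 3\<close>.\<close>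

lemma convergent_everywhere:
  assumes u: "\<And>n. u n \<in> H1 G" "\<And>n. kin (u n) \<le> T"
    and r: "\<And>e r. e \<in> edges G \<Longrightarrow> r \<in> \<rat> \<Longrightarrow> r \<in> D e \<Longrightarrow> convergent (\<lambda>n. f (u n) e r)"
    and e: "e \<in> edges G" and x: "x \<in> D e"
  shows "convergent (\<lambda>n. f (u n) e x)"
  unfolding Cauchy_convergent_iff[symmetric]
proof (rule CauchyI)
  fix \<epsilon> :: real assume \<epsilon>: "\<epsilon> > 0"
  have T: "T \<ge> 0" using nonneg(2)[of "u 0"] u(2)[of 0] by linarith
  define \<delta> where "\<delta> = (\<epsilon> / 3)\<^sup>2 / (T + 1)"
  have \<delta>: "\<delta> > 0" using \<epsilon> T by (simp add: \<delta>_def)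
  obtain s where s: "s \<in> \<rat>" "s \<in> D e" "\<bar>x - s\<bar> < \<delta>"
    using rational_near[OF len_pos[OF e], of x \<delta>] x \<delta> by (auto simp: edge_dom_eq)
  have near: "\<bar>f (u n) e x - f (u n) e s\<bar> < \<epsilon> / 3" for n
  proof -
    have "(f (u n) e x - f (u n) e s)\<^sup>2 \<le> \<bar>x - s\<bar> * T"
      using mass_edge_le(2)[OF u(1) e, of n] u(2)[of n]
      by (intro H1_on_Holder'[OF H1_edge[OF u(1) e] D_facts(1)[OF e] s(2) x]) linarith
    also have "\<dots> \<le> \<delta> * T" using s(3) T by (intro mult_right_mono) auto
    also have "\<dots> < \<delta> * (T + 1)" using \<delta> by simp
    also have "\<dots> = (\<epsilon> / 3)\<^sup>2" using T by (simp add: \<delta>_def)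
    finally have "\<bar>f (u n) e x - f (u n) e s\<bar>\<^sup>2 < (\<epsilon> / 3)\<^sup>2" by simp
    then show ?thesis using \<epsilon> by (intro power_less_imp_less_base[of _ 2 "\<epsilon> / 3"]) auto
  qed
  have "Cauchy (\<lambda>n. f (u n) e s)" using r[OF e s(1,2)] by (simp add: Cauchy_convergent_iff)
  then obtain N where N: "\<And>m n. m \<ge> N \<Longrightarrow> n \<ge> N \<Longrightarrow> \<bar>f (u m) e s - f (u n) e s\<bar> < \<epsilon> / 3"
    using CauchyD[of "\<lambda>n. f (u n) e s" "\<epsilon> / 3"] \<epsilon> by auto
  have "norm (f (u m) e x - f (u n) e x) < \<epsilon>" if "m \<ge> N" "n \<ge> N" for m n
    using near[of m] near[of n] N[OF that] unfolding real_norm_def abs_less_iff by argo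
  then show "\<exists>M. \<forall>m\<ge>M. \<forall>n\<ge>M. norm (f (u m) e x - f (u n) e x) < \<epsilon>" by blast
qed

text \<open>Two diagonal extractions over countable families: first the values at the rational
  points of the edges, then the kinetic integrals over all cut edges. The limits
  \<open>t e k\<close> of the latter may exceed the kinetic integrals of \<open>F\<close>, but never
  fall below them.\<close>

lemma bounded_sequence_limit:
  assumes u: "\<And>n. u n \<in> H1_mass G \<mu>" "\<And>n. kin (u n) \<le> T"
    and B: "\<And>n e x. e \<in> edges G \<Longrightarrow> x \<in> D e \<Longrightarrow> \<bar>f (u n) e x\<bar> \<le> B"
  obtains r :: "nat \<Rightarrow> nat" and F t where "strict_mono r" "F \<in> H1 G"
    "\<And>e x. e \<in> edges G \<Longrightarrow> x \<in> D e \<Longrightarrow> (\<lambda>n. f (u (r n)) e x) \<longlonglongrightarrow> f F e x"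
    "\<And>e k. e \<in> edges G \<Longrightarrow> (\<lambda>n. LINT x:{0..cut e k}|lborel. (g (u (r n)) e x)\<^sup>2) \<longlonglongrightarrow> t e k"
    "\<And>e k. e \<in> edges G \<Longrightarrow> (LINT x:{0..cut e k}|lborel. (g F e x)\<^sup>2) \<le> t e k"
proof -
  have uH: "u n \<in> H1 G" "mass (u n) = \<mu>" for n using u(1)[of n] by (auto simp: H1_mass_iff)
  define S where "S = (\<Union>e\<in>edges G. (\<lambda>r. (e, r)) ` (\<rat> \<inter> D e))"
  have "countable S" unfolding S_def using fin(1) countable_rat
    by (intro countable_UN countable_image) (auto intro: countable_finite countable_subset)
  moreover have "norm ((\<lambda>n (e, x). f (u n) e x) n z) \<le> B" if "z \<in> S" for n z
    using B that by (auto simp: S_def)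
  ultimately obtain r1 :: "nat \<Rightarrow> nat" where r1: "strict_mono r1"
    "\<And>z. z \<in> S \<Longrightarrow> \<exists>l. (\<lambda>n. (case z of (e, x) \<Rightarrow> f (u (r1 n)) e x)) \<longlonglongrightarrow> l"
    using function_convergent_subsequence[of S "\<lambda>n (e, x). f (u n) e x" B] by blast
  define E where "E = edges G \<times> (UNIV :: nat set)"
  have "countable E" unfolding E_def using fin(1) by (intro countable_SIGMA) (auto intro: countable_finite)
  moreover have "norm ((\<lambda>n (e, k). LINT x:{0..cut e k}|lborel. (g (u (r1 n)) e x)\<^sup>2) n z) \<le> T" if zE: "z \<in> E" for n z
  proof -
    obtain e k where z: "z = (e, k)" "e \<in> edges G" using zE by (auto simp: E_def)
    have "(LINT x:{0..cut e k}|lborel. (g (u (r1 n)) e x)\<^sup>2) \<le> (LINT x:D e|lborel. (g (u (r1 n)) e x)\<^sup>2)"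
      by (rule LINT_nonneg_mono_set[OF integrable_on_edge(2)[OF uH(1) z(2)] cut_sub[OF z(2)]]) auto
    also have "\<dots> \<le> T" using mass_edge_le(2)[OF uH(1) z(2), of "r1 n"] u(2)[of "r1 n"] by linarith
    finally show ?thesis using z LINT_nonneg[of "{0..cut e k}" "\<lambda>x. (g (u (r1 n)) e x)\<^sup>2" lborel] by simp
  qed
  ultimately obtain r2 :: "nat \<Rightarrow> nat" where r2: "strict_mono r2"
    "\<And>z. z \<in> E \<Longrightarrow> \<exists>l. (\<lambda>n. (case z of (e, k) \<Rightarrow> LINT x:{0..cut e k}|lborel. (g (u (r1 (r2 n))) e x)\<^sup>2)) \<longlonglongrightarrow> l"
    using function_convergent_subsequence[of E "\<lambda>n (e, k). LINT x:{0..cut e k}|lborel. (g (u (r1 n)) e x)\<^sup>2" T] by blast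
  define r where "r n = r1 (r2 n)" for n
  have sr: "strict_mono r" using strict_mono_o[OF r1(1) r2(1)] by (simp add: r_def[abs_def] o_def)
  have rat: "convergent (\<lambda>n. f (u (r n)) e s)" if "e \<in> edges G" "s \<in> \<rat>" "s \<in> D e" for e s
  proof -
    have "(e, s) \<in> S" using that by (auto simp: S_def)
    from r1(2)[OF this] obtain l where l: "(\<lambda>n. f (u (r1 n)) e s) \<longlonglongrightarrow> l" by auto
    from LIMSEQ_subseq_LIMSEQ[OF l r2(1)] show ?thesis by (auto simp: r_def o_def convergent_def)
  qed
  have conv: "convergent (\<lambda>n. f (u (r n)) e x)" if "e \<in> edges G" "x \<in> D e" for e x
    by (rule convergent_everywhere[where u="\<lambda>n. u (r n)", OF uH(1) u(2) _ that]) (rule rat)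
  \<comment> \<open>Outside the graph the limit may fail to exist and \<open>lim\<close> is then
    arbitrary; only values in the charts enter.\<close>
  define F where "F P = lim (\<lambda>n. u (r n) P)" for P
  have lim: "(\<lambda>n. f (u (r n)) e x) \<longlonglongrightarrow> f F e x" if "e \<in> edges G" "x \<in> D e" for e x
    using conv[OF that] unfolding F_def on_edge_def by (simp add: convergent_LIMSEQ_iff)
  have "\<exists>h. H1_on (D e) (f F e) h" if e: "e \<in> edges G" for e
  proof -
    have m: "(LINT x:D e|lborel. (f (u (r n)) e x)\<^sup>2) \<le> \<mu>" for n
      using mass_edge_le(1)[OF uH(1) e, of "r n"] uH(2) by simp
    have k: "(LINT x:D e|lborel. (g (u (r n)) e x)\<^sup>2) \<le> T" for n
      using mass_edge_le(2)[OF uH(1) e, of "r n"] u(2)[of "r n"] by linarith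
    from H1_on_limit[where f="\<lambda>n. f (u (r n)) e", OF H1_edge[OF uH(1) e] D_facts[OF e] k m lim[OF e]]
    show ?thesis by blast
  qed
  then obtain h where h: "\<And>e. e \<in> edges G \<Longrightarrow> H1_on (D e) (f F e) (h e)" by metis
  have FH: "F \<in> H1 G" by (rule H1_onI_graph(1)[OF G h])
  have "\<exists>l. (\<lambda>n. LINT x:{0..cut e k}|lborel. (g (u (r n)) e x)\<^sup>2) \<longlonglongrightarrow> l" if "e \<in> edges G" for e k
    using r2(2)[of "(e, k)"] that by (auto simp: E_def r_def)
  then obtain t where t: "\<And>e k. e \<in> edges G \<Longrightarrow> (\<lambda>n. LINT x:{0..cut e k}|lborel. (g (u (r n)) e x)\<^sup>2) \<longlonglongrightarrow> t e k" by metis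
  have "(LINT x:{0..cut e k}|lborel. (g F e x)\<^sup>2) \<le> t e k" if e: "e \<in> edges G" for e k
  proof (rule H1_on_Icc_lsc[OF _ _ _ _ t[OF e]])
    note sub = cut_sub[OF e, of k]
    show "H1_on {0..cut e k} (f F e) (g F e)" "H1_on {0..cut e k} (f (u (r n)) e) (g (u (r n)) e)" for n
      using H1_on_subset[OF H1_edge[OF FH e] sub] H1_on_subset[OF H1_edge[OF uH(1) e] sub] by auto
    show "(LINT x:{0..cut e k}|lborel. (f (u (r n)) e x)\<^sup>2) \<le> \<mu>" for n
    proof -
      have "(LINT x:{0..cut e k}|lborel. (f (u (r n)) e x)\<^sup>2) \<le> (LINT x:D e|lborel. (f (u (r n)) e x)\<^sup>2)"
        by (rule LINT_nonneg_mono_set[OF integrable_on_edge(1)[OF uH(1) e] sub]) auto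
      then show ?thesis using mass_edge_le(1)[OF uH(1) e, of "r n"] uH(2)[of "r n"] by linarith
    qed
    show "(\<lambda>n. f (u (r n)) e x) \<longlonglongrightarrow> f F e x" if "x \<in> {0..cut e k}" for x
      using lim[OF e] sub that by blast
  qed
  then show thesis using that[OF sr FH lim t] by blast
qed

theorem ground_state_exists:
  assumes \<mu>: "\<mu> > 0" and w: "w \<in> H1_mass G \<mu>" "energy p q G w < e" and e: "infinity_bound \<mu> e"
  shows "\<exists>u. ground_state p q G \<mu> u"
proof -
  obtain C where C: "\<And>u. u \<in> H1_mass G \<mu> \<Longrightarrow> kin u / 4 - C \<le> energy p q G u"
    using coercive[OF \<mu>] by blast
  obtain K where K: "K > 0" "\<And>u e x. u \<in> H1_mass G \<mu> \<Longrightarrow> e \<in> edges G \<Longrightarrow> x \<in> D e \<Longrightarrow> (f u e x)^4 \<le> K * (1 + kin u)"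
    using quartic_bound[of \<mu>] \<mu> by (metis less_imp_le)
  define I where "I = Inf (energy p q G ` H1_mass G \<mu>)"
  have bdd: "bdd_below (energy p q G ` H1_mass G \<mu>)"
  proof (rule bdd_belowI2)
    fix u assume "u \<in> H1_mass G \<mu>"
    then show "- C \<le> energy p q G u" using C[of u] nonneg(2)[of u] by linarith
  qed
  have I_le: "I \<le> energy p q G u" if "u \<in> H1_mass G \<mu>" for u
    unfolding I_def using that bdd by (intro cInf_lower) auto
  have Ie: "I < e" using I_le[OF w(1)] w(2) by linarith
  have "\<exists>u\<in>H1_mass G \<mu>. energy p q G u < I + 1 / real (Suc n)" for n
  proof -
    have "\<exists>y\<in>energy p q G ` H1_mass G \<mu>. y < I + 1 / real (Suc n)"
      unfolding I_def by (rule cInf_lessD) (use w(1) in auto)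
    then show ?thesis by blast
  qed
  then obtain u where u: "\<And>n. u n \<in> H1_mass G \<mu>" "\<And>n. energy p q G (u n) < I + 1 / real (Suc n)" by metis
  \<comment> \<open>Every member has energy at most \<open>I + 1\<close>, since
    \<open>1 / Suc n \<le> 1\<close>; coercivity turns this into a kinetic bound.\<close>
  define T where "T = 4 * (I + 1 + C)"
  have uT: "kin (u n) \<le> T" for n
  proof -
    have "1 / real (Suc n) \<le> 1" by simp
    then show ?thesis using C[OF u(1), of n] u(2)[of n] unfolding T_def by argo
  qed
  define B where "B = root 4 (K * (1 + T))"
  have uB: "\<bar>f (u n) e x\<bar> \<le> B" if "e \<in> edges G" "x \<in> D e" for n e x
  proof -
    have "(f (u n) e x)^4 \<le> K * (1 + kin (u n))" by (rule K(2)[OF u(1) that])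
    also have "\<dots> \<le> K * (1 + T)" using K(1) uT[of n] by (intro mult_left_mono) auto
    finally show ?thesis unfolding B_def by (rule abs_le_root4)
  qed
  obtain r F t where r: "strict_mono (r :: nat \<Rightarrow> nat)" and F: "F \<in> H1 G"
    and lim: "\<And>e x. e \<in> edges G \<Longrightarrow> x \<in> D e \<Longrightarrow> (\<lambda>n. f (u (r n)) e x) \<longlonglongrightarrow> f F e x"
    and t: "\<And>e k. e \<in> edges G \<Longrightarrow> (\<lambda>n. LINT x:{0..cut e k}|lborel. (g (u (r n)) e x)\<^sup>2) \<longlonglongrightarrow> t e k"
    and lsc: "\<And>e k. e \<in> edges G \<Longrightarrow> (LINT x:{0..cut e k}|lborel. (g F e x)\<^sup>2) \<le> t e k"
    by (rule bounded_sequence_limit[OF u(1) uT]) (erule (1) uB, (rule that; assumption))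
  define v where "v n = u (r n)" for n
  have v: "v n \<in> H1_mass G \<mu>" "v n \<in> H1 G" "mass (v n) = \<mu>" for n using u(1)[of "r n"] by (auto simp: v_def H1_mass_iff)
  have vB: "\<bar>f (v n) e x\<bar> \<le> B" if "e \<in> edges G" "x \<in> D e" for n e x unfolding v_def by (rule uB[OF that])
  define \<kappa> where "\<kappa> = sqrt (2 / p) * B powr (p / 2 - 1) / 2"
  have p0: "0 < p" "0 < q" using p q by auto
  have vpot: "(\<lambda>n. vpot (v n)) \<longlonglongrightarrow> vpot F"
    unfolding vpot_def
  proof (rule tendsto_sum)
    fix a assume "a \<in> verts G"
    then obtain e x where "e \<in> edges G" "x \<in> D e" "chart G e x = Vertex a" by (rule vertex_on_edge)
    then have "(\<lambda>n. v n (Vertex a)) \<longlonglongrightarrow> F (Vertex a)" using lim[of e x] by (simp add: v_def on_edge_def)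
    then show "(\<lambda>n. \<bar>v n (Vertex a)\<bar> powr q) \<longlonglongrightarrow> \<bar>F (Vertex a)\<bar> powr q"
      using p0 by (intro tendsto_powr' tendsto_rabs tendsto_const) auto
  qed
  have cut_lim: "(\<lambda>n. f (v n) e x) \<longlonglongrightarrow> f F e x" "\<bar>f (v n) e x\<bar> \<le> B" "\<bar>f F e x\<bar> \<le> B" if "e \<in> edges G" "x \<in> {0..cut e k}" for e x k n
  proof -
    have x: "x \<in> D e" using that cut_sub by blast
    show l: "(\<lambda>n. f (v n) e x) \<longlonglongrightarrow> f F e x" using lim[OF that(1) x] by (simp add: v_def)
    show "\<bar>f (v n) e x\<bar> \<le> B" by (rule vB[OF that(1) x])
    show "\<bar>f F e x\<bar> \<le> B" using tendsto_rabs[OF l] by (rule LIMSEQ_le_const2) (use vB[OF that(1) x] in auto)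
  qed
  have cc: "continuous_on {0..cut e k} (f y e)" if "y \<in> H1 G" "e \<in> edges G" for y e k
    by (rule continuous_on_subset[OF integrable_on_edge(4)[OF that] cut_sub[OF that(2)]])
  have B0: "B \<ge> 0"
  proof -
    obtain h where "h \<in> edges G" "0 \<in> D h" using nc by (auto simp: noncompact_def half_lines_def edge_dom_def)
    then show ?thesis using uB[of h 0 0] by (meson abs_ge_zero order_trans)
  qed
  have inm: "(\<lambda>n. inner_mass k (v n)) \<longlonglongrightarrow> inner_mass k F" for k
    unfolding inner_mass_def
  proof (intro tendsto_sum LINT_Icc_tendsto[where C="B\<^sup>2"])
    fix e x n assume e: "e \<in> edges G"
    show "continuous_on {0..cut e k} (\<lambda>x. (f (v n) e x)\<^sup>2)" "continuous_on {0..cut e k} (\<lambda>x. (f F e x)\<^sup>2)"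
      using cc[OF v(2) e] cc[OF F e] by (auto intro!: continuous_intros)
    assume x: "x \<in> {0..cut e k}"
    have b: "\<bar>f (v n) e x\<bar> \<le> B" by (rule cut_lim(2)[OF e x])
    show "\<bar>(f (v n) e x)\<^sup>2\<bar> \<le> B\<^sup>2" using power_mono[OF b, of 2] by simp
    show "(\<lambda>n. (f (v n) e x)\<^sup>2) \<longlonglongrightarrow> (f F e x)\<^sup>2" by (intro tendsto_power cut_lim(1)[OF e x])
  qed
  have inp: "(\<lambda>n. LINT x:{0..cut e k}|lborel. \<bar>f (v n) e x\<bar> powr p) \<longlonglongrightarrow>
      (LINT x:{0..cut e k}|lborel. \<bar>f F e x\<bar> powr p)" if e: "e \<in> edges G" for e k
  proof (intro LINT_Icc_tendsto[where C="B powr p"])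
    fix x n
    show "continuous_on {0..cut e k} (\<lambda>x. \<bar>f (v n) e x\<bar> powr p)" "continuous_on {0..cut e k} (\<lambda>x. \<bar>f F e x\<bar> powr p)"
      using cc[OF v(2) e] cc[OF F e] p0 by (auto intro!: continuous_intros continuous_on_powr')
    assume x: "x \<in> {0..cut e k}"
    have b: "\<bar>f (v n) e x\<bar> \<le> B" by (rule cut_lim(2)[OF e x])
    show "\<bar>\<bar>f (v n) e x\<bar> powr p\<bar> \<le> B powr p" using powr_mono2[OF _ _ b, of p] p0 by simp
    show "(\<lambda>n. \<bar>f (v n) e x\<bar> powr p) \<longlonglongrightarrow> \<bar>f F e x\<bar> powr p"
      using p0 by (intro tendsto_powr' tendsto_rabs cut_lim(1)[OF e x] tendsto_const) auto
  qed
  have invI: "(\<lambda>n. I + 1 / real (Suc (r n))) \<longlonglongrightarrow> I + 0"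
  proof -
    have "(\<lambda>n. 1 / real (Suc n)) \<longlonglongrightarrow> 0" using LIMSEQ_inverse_real_of_nat by (simp add: inverse_eq_divide)
    from LIMSEQ_subseq_LIMSEQ[OF this r] show ?thesis by (intro tendsto_add tendsto_const) (simp add: o_def)
  qed
  \<comment> \<open>At a fixed cut all terms converge to those of \<open>F\<close> except the
    kinetic one, which converges to the sum of the \<open>t e k\<close>; lower semicontinuity
    replaces it by the kinetic term of \<open>F\<close> in the right direction.\<close>
  have step: "inner_energy k F + (\<mu> - inner_mass k F) / \<mu> * e - \<kappa> * (\<Sum>h\<in>half_lines G. (f F h (real k))\<^sup>2) \<le> I" for k
  proof -
    let ?rest = "\<lambda>y. - 1 / p * (\<Sum>e\<in>edges G. LINT x:{0..cut e k}|lborel. \<bar>f y e x\<bar> powr p) - 1 / q * vpot y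
        + (\<mu> - inner_mass k y) / \<mu> * e - \<kappa> * (\<Sum>h\<in>half_lines G. (f y h (real k))\<^sup>2)"
    have "(\<lambda>n. 1 / 2 * (\<Sum>e\<in>edges G. LINT x:{0..cut e k}|lborel. (g (v n) e x)\<^sup>2) + ?rest (v n)) \<longlonglongrightarrow>
       1 / 2 * (\<Sum>e\<in>edges G. t e k) + ?rest F"
    proof (intro tendsto_intros inm vpot)
      show "(\<lambda>n. LINT x:{0..cut e k}|lborel. \<bar>f (v n) e x\<bar> powr p) \<longlonglongrightarrow> (LINT x:{0..cut e k}|lborel. \<bar>f F e x\<bar> powr p)"
        if "e \<in> edges G" for e by (rule inp[OF that])
      show "(\<lambda>n. LINT x:{0..cut e k}|lborel. (g (v n) e x)\<^sup>2) \<longlonglongrightarrow> t e k" if "e \<in> edges G" for e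
        using t[OF that] by (simp add: v_def)
      show "(\<lambda>n. f (v n) h (real k)) \<longlonglongrightarrow> f F h (real k)" if "h \<in> half_lines G" for h
        using lim[of h "real k"] that by (auto simp: v_def half_lines_def edge_dom_def)
    qed (use \<mu> in auto)
    moreover have "1 / 2 * (\<Sum>e\<in>edges G. LINT x:{0..cut e k}|lborel. (g (v n) e x)\<^sup>2) + ?rest (v n) \<le> I + 1 / real (Suc (r n))" for n
    proof -
      have "inner_energy k (v n) + (\<mu> - inner_mass k (v n)) / \<mu> * e - \<kappa> * (\<Sum>h\<in>half_lines G. (f (v n) h (real k))\<^sup>2) \<le> energy p q G (v n)"
        unfolding \<kappa>_def by (rule energy_ge_inner[OF v(1) \<mu> e vB])
      with u(2)[of "r n"] show ?thesis unfolding inner_energy_def v_def[symmetric] by simp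
    qed
    ultimately have "1 / 2 * (\<Sum>e\<in>edges G. t e k) + ?rest F \<le> I + 0"
      using LIMSEQ_le[OF _ invI] by blast
    moreover have "(\<Sum>e\<in>edges G. LINT x:{0..cut e k}|lborel. (g F e x)\<^sup>2) \<le> (\<Sum>e\<in>edges G. t e k)"
      by (rule sum_mono[OF lsc])
    ultimately show ?thesis unfolding inner_energy_def by simp
  qed
  define m where "m = mass F"
  have main: "energy p q G F + (\<mu> - m) / \<mu> * e - \<kappa> * (\<Sum>h\<in>half_lines G. 0\<^sup>2) \<le> I"
  proof (rule LIMSEQ_le_const2)
    show "(\<lambda>k. inner_energy k F + (\<mu> - inner_mass k F) / \<mu> * e - \<kappa> * (\<Sum>h\<in>half_lines G. (f F h (real k))\<^sup>2)) \<longlonglongrightarrow>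
      energy p q G F + (\<mu> - m) / \<mu> * e - \<kappa> * (\<Sum>h\<in>half_lines G. 0\<^sup>2)"
      unfolding m_def using \<mu> by (intro tendsto_intros inner_tendsto[OF F] half_line_value_tendsto_0[OF F]) auto
  qed (use step in blast)
  have "inner_mass k (v n) \<le> \<mu>" for k n
  proof -
    have "inner_mass k (v n) \<le> (\<Sum>e\<in>edges G. LINT x:D e|lborel. (f (v n) e x)\<^sup>2)"
      unfolding inner_mass_def by (intro sum_mono LINT_nonneg_mono_set[OF integrable_on_edge(1)[OF v(2)] cut_sub]) auto
    then show ?thesis using v(3)[of n] by (simp add: mass_def graph_integral_def)
  qed
  then have "inner_mass k F \<le> \<mu>" for k using LIMSEQ_le_const2[OF inm[of k]] by blast
  then have m_le: "m \<le> \<mu>" unfolding m_def using LIMSEQ_le_const2[OF inner_tendsto(2)[OF F]] by blast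
  have m0: "m \<ge> 0" unfolding m_def by (rule nonneg)
  have "m = \<mu>"
  proof (rule ccontr)
    assume "m \<noteq> \<mu>"
    then have m_less: "m < \<mu>" using m_le by simp
    have "m / \<mu> * I \<le> energy p q G F"
    \<comment> \<open>If everything escapes, \<open>F\<close> cannot be scaled to mass
      \<open>\<mu>\<close>, but then its energy is nonnegative. Otherwise \<open>F\<close> scaled to
      mass \<open>\<mu>\<close> is a competitor for \<open>I\<close>.\<close>
    proof (cases "m = 0")
      case True then show ?thesis using energy_ge_of_mass_0[OF F] by (simp add: m_def)
    next
      case False
      then have m0: "m > 0" using m0 by simp
      define c where "c = sqrt (\<mu> / m)"
      have c: "c \<ge> 1" "c\<^sup>2 = \<mu> / m" using m0 m_le \<mu> by (auto simp: c_def)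
      have "(\<lambda>P. c * F P) \<in> H1_mass G \<mu>" using scaled(1,2)[OF F, of c] c m0 by (simp add: H1_mass_iff m_def[symmetric])
      from I_le[OF this] energy_scaled_le[OF F c(1)] have "I \<le> \<mu> / m * energy p q G F" using c(2) by simp
      then have "m / \<mu> * I \<le> m / \<mu> * (\<mu> / m * energy p q G F)" using m0 \<mu> by (intro mult_left_mono) auto
      then show ?thesis using m0 \<mu> by simp
    qed
    then have "m / \<mu> * I + (\<mu> - m) / \<mu> * e \<le> I" using main by simp
    \<comment> \<open>Splitting \<open>I\<close> in the same proportions isolates the escaped share
      \<open>(\<mu> - m) / \<mu>\<close>, which would force \<open>e \<le> I\<close>.\<close>
    moreover have "I = m / \<mu> * I + (\<mu> - m) / \<mu> * I" using \<mu> by (simp add: field_simps)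
    ultimately have "(\<mu> - m) / \<mu> * e \<le> (\<mu> - m) / \<mu> * I" by argo
    moreover have "(\<mu> - m) / \<mu> > 0" using m_less \<mu> by simp
    ultimately show False using Ie by (simp only: mult_le_cancel_left_pos)
  qed
  then have "F \<in> H1_mass G \<mu>" "energy p q G F \<le> I" using main F \<mu> by (auto simp: H1_mass_iff m_def)
  then show ?thesis using ground_stateI[of F \<mu>] I_le by (meson order_trans)
qed

end

section \<open>Small mass: spread-out competitors\<close>

lemma exp_half_line:
  assumes "a > 0"
  shows "set_integrable lborel {0..} (\<lambda>x::real. exp (- (a * x)))" "(LINT x:{0..}|lborel. exp (- (a * x))) = 1 / a"
proof -
  have lim: "((\<lambda>x. - exp (- (a * x)) / a) \<longlongrightarrow> 0) at_top" using assms by real_asymp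
  have nn: "(\<integral>\<^sup>+x. ennreal (exp (- (a * x))) * indicator {0..} x \<partial>lborel) = ennreal (0 - (- exp (- (a * 0)) / a))"
    by (rule nn_integral_FTC_atLeast[OF _ _ _ lim]) (use assms in \<open>auto intro!: derivative_eq_intros\<close>)
  have e: "ennreal (exp (- (a * x))) * indicator {0..} x = ennreal (indicator {0..} x *\<^sub>R exp (- (a * x)))" for x
    by (simp add: indicator_def)
  have "has_bochner_integral lborel (\<lambda>x. indicator {0..} x *\<^sub>R exp (- (a * x))) (1 / a)"
    by (rule has_bochner_integral_nn_integral) (use nn assms in \<open>auto simp: e\<close>)
  then show "set_integrable lborel {0..} (\<lambda>x::real. exp (- (a * x)))" "(LINT x:{0..}|lborel. exp (- (a * x))) = 1 / a"
    by (auto simp: set_integrable_def set_lebesgue_integral_def has_bochner_integral_iff)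
qed

lemma H1_on_exp:
  assumes a: "a > 0"
  shows "H1_on {0..} (\<lambda>x. c * exp (- (a * x))) (\<lambda>x. - a * c * exp (- (a * x)))"
    "(LINT x:{0..}|lborel. (c * exp (- (a * x)))\<^sup>2) = c\<^sup>2 / (2 * a)"
    "(LINT x:{0..}|lborel. (- a * c * exp (- (a * x)))\<^sup>2) = c\<^sup>2 * a / 2"
proof -
  have sq: "(k * exp (- (a * x)))\<^sup>2 = k\<^sup>2 * exp (- (2 * a * x))" for k x
    by (simp add: power_mult_distrib power2_eq_square[of "exp _"] exp_add[symmetric])
  note E = exp_half_line[of "2 * a"]
  have i: "set_integrable lborel {0..} (\<lambda>x. (k * exp (- (a * x)))\<^sup>2)" for k unfolding sq using E a by simp
  have v: "(LINT x:{0..}|lborel. (k * exp (- (a * x)))\<^sup>2) = k\<^sup>2 / (2 * a)" for k unfolding sq using E a by simp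
  have "ac_deriv {0..} (\<lambda>x. c * exp (- (a * x))) (\<lambda>x. - a * c * exp (- (a * x)))"
    by (rule ac_deriv_C1) (auto intro!: derivative_eq_intros continuous_intros simp: is_interval_1)
  moreover have "set_borel_measurable lborel {0..} (\<lambda>x. - a * c * exp (- (a * x)))"
    by (intro set_borel_measurable_cont continuous_intros) auto
  ultimately show "H1_on {0..} (\<lambda>x. c * exp (- (a * x))) (\<lambda>x. - a * c * exp (- (a * x)))"
    using i[of c] i[of "- a * c"] by (simp add: H1_on_def)
  show "(LINT x:{0..}|lborel. (c * exp (- (a * x)))\<^sup>2) = c\<^sup>2 / (2 * a)" by (rule v)
  show "(LINT x:{0..}|lborel. (- a * c * exp (- (a * x)))\<^sup>2) = c\<^sup>2 * a / 2"
    unfolding v using a by (simp add: power2_eq_square)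
qed

context nls_graph
begin

text \<open>Chosen so that \<open>A * M powr (p / 2 + 1)\<close> is twice
  \<open>calib p M M\<close>, the cost of going up to height \<open>M\<close> and down
  again.\<close>

definition "A = 2 * sqrt (2 / p) * cal p 1"

lemma A_pos: "A > 0"
  using cal_1_pos[OF p(1)] p by (simp add: A_def)

text \<open>At \<open>R\<close> the two terms are equal. Below \<open>R\<close> the positive term is
  dropped and the negative one is largest at \<open>R\<close>; above \<open>R\<close> the positive
  term dominates. The constant is not optimal, but the power of \<open>\<mu>\<close> is.\<close>

lemma infinity_bound_power:
  assumes \<mu>: "\<mu> > 0"
  shows "infinity_bound \<mu> (- ((1 / (p * A)) powr (2 * (p - 2) / (6 - p)) / p * \<mu> powr ((p + 2) / (6 - p))))"
proof -
  define R where "R = (\<mu> / (p * A)) powr (2 / (6 - p))"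
  have pA: "p * A > 0" using A_pos p by simp
  have "\<mu> * (\<mu> / (p * A)) powr (2 * (p - 2) / (6 - p)) = (1 / (p * A)) powr (2 * (p - 2) / (6 - p)) * (\<mu> * \<mu> powr (2 * (p - 2) / (6 - p)))"
    using \<mu> pA by (simp add: powr_divide)
  also have "\<mu> * \<mu> powr (2 * (p - 2) / (6 - p)) = \<mu> powr (1 + 2 * (p - 2) / (6 - p))" using \<mu> by (simp add: powr_add)
  also have "1 + 2 * (p - 2) / (6 - p) = (p + 2) / (6 - p)" using p by (simp add: field_simps)
  finally have eq: "\<mu> / p * R powr (p - 2) = (1 / (p * A)) powr (2 * (p - 2) / (6 - p)) / p * \<mu> powr ((p + 2) / (6 - p))"
    by (simp add: R_def powr_powr)
  have "- (\<mu> / p * R powr (p - 2)) \<le> A * M powr (p / 2 + 1) - \<mu> / p * M powr (p - 2)" if M: "M \<ge> 0" for M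
  proof (cases "M \<le> R")
    case True
    then have "\<mu> / p * M powr (p - 2) \<le> \<mu> / p * R powr (p - 2)" using M \<mu> p by (intro mult_left_mono powr_mono2) auto
    moreover have "0 \<le> A * M powr (p / 2 + 1)" using A_pos by simp
    ultimately show ?thesis by argo
  next
    case False
    have R: "R > 0" using \<mu> pA A_pos p by (simp add: R_def)
    have "2 / (6 - p) * ((6 - p) / 2) = 1" using p by simp
    then have "R powr ((6 - p) / 2) = (\<mu> / (p * A)) powr 1" unfolding R_def powr_powr by (rule arg_cong)
    then have "\<mu> / (p * A) = R powr ((6 - p) / 2)" using \<mu> pA by simp
    also have "\<dots> \<le> M powr ((6 - p) / 2)" using False R p by (intro powr_mono2) auto
    finally have "\<mu> / p \<le> A * M powr ((6 - p) / 2)" using A_pos p by (simp add: field_simps)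
    then have "\<mu> / p * M powr (p - 2) \<le> A * M powr ((6 - p) / 2) * M powr (p - 2)" by (intro mult_right_mono) auto
    also have "\<dots> = A * M powr (p / 2 + 1)"
    proof -
      have "(6 - p) / 2 + (p - 2) = p / 2 + 1" by (simp add: field_simps)
      then show ?thesis by (metis mult.assoc powr_add)
    qed
    finally have "\<mu> / p * M powr (p - 2) \<le> A * M powr (p / 2 + 1)" .
    moreover have "0 \<le> \<mu> / p * R powr (p - 2)" using \<mu> p by simp
    ultimately show ?thesis by argo
  qed
  then show ?thesis unfolding infinity_bound_def A_def[symmetric] eq by simp
qed

text \<open>With height \<open>c\<close> on the core the mass is
  \<open>c\<^sup>2 * (Lb + N / (2 * a))\<close> and the kinetic energy
  \<open>N * a * c\<^sup>2 / 2\<close>. Fixing the mass bounds the latter by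
  \<open>a\<^sup>2 * \<mu>\<close>, and one vertex already contributes \<open>c powr q\<close>; the
  remaining gains are discarded.\<close>

lemma spread_out_competitor:
  obtains \<kappa> where "\<kappa> > 0" "\<And>\<mu> a. 0 < \<mu> \<Longrightarrow> 0 < a \<Longrightarrow> a \<le> 1 \<Longrightarrow>
    \<exists>w\<in>H1_mass G \<mu>. energy p q G w \<le> a\<^sup>2 * \<mu> / 2 - (\<kappa> * a * \<mu>) powr (q / 2) / q"
proof -
  define N where "N = real (card (half_lines G))"
  have N: "N \<ge> 1"
  proof -
    have "card (half_lines G) > 0" using nc fin(3) by (simp add: noncompact_def card_gt_0_iff)
    then show ?thesis by (simp add: N_def)
  qed
  define Lb where "Lb = (\<Sum>e\<in>bounded_edges G. real_of_ereal (len G e))"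
  have be: "edges G = half_lines G \<union> bounded_edges G" "half_lines G \<inter> bounded_edges G = {}" "finite (bounded_edges G)"
    using fin(1) by (auto simp: half_lines_def bounded_edges_def)
  have blen: "\<exists>l>0. len G e = ereal l \<and> D e = {0..l}" if "e \<in> bounded_edges G" for e
  proof -
    have "e \<in> edges G" "len G e \<noteq> \<infinity>" using that by (auto simp: bounded_edges_def)
    then show ?thesis using len_pos[of e] by (cases rule: dom_cases[OF len_pos]) (auto simp: edge_dom_eq)
  qed
  have hD: "D e = {0..}" "e \<in> edges G" "len G e = \<infinity>" if "e \<in> half_lines G" for e
    using that by (auto simp: half_lines_def edge_dom_def)
  have Lb: "Lb \<ge> 0" unfolding Lb_def using blen by (intro sum_nonneg) force
  \<comment> \<open>For \<open>a \<le> 1\<close> the core weighs at most \<open>Lb / a\<close>, so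
    that \<open>c\<^sup>2 \<ge> \<kappa> * a * \<mu>\<close> with this constant.\<close>
  define \<kappa> where "\<kappa> = 2 / (2 * Lb + N)"
  show thesis
  proof (rule that)
    show "\<kappa> > 0" using Lb N by (simp add: \<kappa>_def)
    fix \<mu> a :: real assume \<mu>: "0 < \<mu>" and a: "0 < a" "a \<le> 1"
    define c where "c = sqrt (\<mu> / (Lb + N / (2 * a)))"
    have den: "Lb + N / (2 * a) > 0" using Lb N a by (intro add_nonneg_pos) auto
    have c: "c > 0" "c\<^sup>2 = \<mu> / (Lb + N / (2 * a))" using \<mu> den by (auto simp: c_def)
    define F where "F e x = (if len G e = \<infinity> then c * exp (- (a * x)) else c)" for e :: 'e and x
    define w where "w = (glue (\<lambda>_. c) F :: ('v, 'e) point \<Rightarrow> real)"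
    define h where "h e x = (if len G e = \<infinity> then - a * c * exp (- (a * x)) else 0)" for e :: 'e and x
    have fw: "f w e = F e" for e
      unfolding w_def by (rule ext, rule on_edge_glue) (auto simp: F_def)
    have H: "H1_on (D e) (f w e) (h e)" if "e \<in> edges G" for e
    proof (cases "e \<in> half_lines G")
      case True
      then show ?thesis using H1_on_exp(1)[OF a(1), of c] hD[OF True] by (simp add: fw F_def[abs_def] h_def[abs_def])
    next
      case False
      then have b: "e \<in> bounded_edges G" using that be by auto
      from blen[OF b] obtain l where l: "l > 0" "len G e = ereal l" "D e = {0..l}" by blast
      have "ac_deriv {0..l} (\<lambda>x. c) (\<lambda>x. 0)" by (rule ac_deriv_C1) (auto simp: is_interval_cc)
      moreover have "set_borel_measurable lborel {0..l} (\<lambda>x. 0 :: real)" by (simp add: set_borel_measurable_def)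
      ultimately show ?thesis using l set_integrable_const_Icc[of 0 l "c\<^sup>2"] set_integrable_const_Icc[of 0 l "0"]
        by (simp add: fw F_def[abs_def] h_def[abs_def] H1_on_def)
    qed
    have w: "w \<in> H1 G" by (rule H1_onI_graph(1)[OF G H])
    have split: "(\<Sum>e\<in>edges G. X e) = (\<Sum>e\<in>half_lines G. X e) + (\<Sum>e\<in>bounded_edges G. X e)" for X :: "'e \<Rightarrow> real"
      unfolding be(1) by (rule sum.union_disjoint[OF fin(3) be(3,2)])
    have "mass w = (\<Sum>e\<in>half_lines G. c\<^sup>2 / (2 * a)) + (\<Sum>e\<in>bounded_edges G. c\<^sup>2 * real_of_ereal (len G e))"
      unfolding mass_def graph_integral_def power2_abs fw split
    proof (intro arg_cong2[where f="(+)"] sum.cong refl)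
      fix e assume "e \<in> half_lines G"
      then show "(LINT x:D e|lborel. (F e x)\<^sup>2) = c\<^sup>2 / (2 * a)"
        using H1_on_exp(2)[OF a(1), of c] hD[of e] by (simp add: F_def)
    next
      fix e assume "e \<in> bounded_edges G"
      from blen[OF this] obtain l where "l > 0" "len G e = ereal l" "D e = {0..l}" by blast
      then show "(LINT x:D e|lborel. (F e x)\<^sup>2) = c\<^sup>2 * real_of_ereal (len G e)"
        using LINT_const_Icc[of 0 l "c\<^sup>2"] by (simp add: F_def)
    qed
    also have "\<dots> = c\<^sup>2 * (Lb + N / (2 * a))"
      by (simp add: Lb_def N_def sum_distrib_left distrib_left)
    finally have mass: "mass w = \<mu>" using c(2) den by simp
    have "kin w = (\<Sum>e\<in>edges G. LINT x:D e|lborel. (h e x)\<^sup>2)"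
      unfolding kin_def by (rule H1_onI_graph(2)[OF G H])
    also have "\<dots> = (\<Sum>e\<in>half_lines G. c\<^sup>2 * a / 2) + (\<Sum>e\<in>bounded_edges G. 0)"
      unfolding split
    proof (intro arg_cong2[where f="(+)"] sum.cong refl)
      fix e assume "e \<in> half_lines G"
      then show "(LINT x:D e|lborel. (h e x)\<^sup>2) = c\<^sup>2 * a / 2"
        using H1_on_exp(3)[OF a(1), of c] hD[of e] by (simp add: h_def)
    next
      fix e assume "e \<in> bounded_edges G"
      from blen[OF this] obtain l where "len G e = ereal l" by blast
      then show "(LINT x:D e|lborel. (h e x)\<^sup>2) = 0" by (simp add: h_def set_lebesgue_integral_def)
    qed
    also have "\<dots> = N * a / 2 * c\<^sup>2" by (simp add: N_def)
    also have "\<dots> \<le> N * a / 2 * (\<mu> / (N / (2 * a)))"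
      unfolding c(2) using N a \<mu> Lb by (intro mult_left_mono divide_left_mono mult_pos_pos den) auto
    also have "\<dots> = a\<^sup>2 * \<mu>" using N a by (simp add: power2_eq_square)
    finally have kin: "kin w \<le> a\<^sup>2 * \<mu>" .
    have "\<kappa> * a * \<mu> = \<mu> / (Lb / a + N / (2 * a))" using a N Lb
      by (simp add: \<kappa>_def add_divide_distrib[symmetric] divide_simps)
    also have "\<dots> \<le> \<mu> / (Lb + N / (2 * a))"
    proof (intro divide_left_mono mult_pos_pos den)
      have "Lb \<le> Lb / a" using a Lb by (simp add: field_simps mult_left_le)
      then show "Lb + N / (2 * a) \<le> Lb / a + N / (2 * a)" by simp
      then show "Lb / a + N / (2 * a) > 0" using den by simp
    qed (use \<mu> in auto)
    also have "\<dots> = c\<^sup>2" by (simp add: c)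
    finally have "(\<kappa> * a * \<mu>) powr (q / 2) \<le> (c\<^sup>2) powr (q / 2)"
      using \<open>\<kappa> > 0\<close> a \<mu> q by (intro powr_mono2) auto
    also have "(c\<^sup>2) powr (q / 2) = c powr q"
    proof -
      have "c\<^sup>2 = c powr 2" using c(1) by simp
      then show ?thesis by (simp only: powr_powr) simp
    qed
    also have "c powr q \<le> vpot w"
    proof -
      have "card (verts G) \<ge> 1" using G fin(2) by (simp add: is_metric_graph_def Suc_le_eq card_gt_0_iff)
      then have "1 * c powr q \<le> real (card (verts G)) * c powr q" by (intro mult_right_mono) auto
      then show ?thesis using c(1) by (simp add: vpot_def w_def glue_def)
    qed
    finally have "(\<kappa> * a * \<mu>) powr (q / 2) / q \<le> 1 / q * vpot w" using q by (simp add: field_simps)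
    moreover have "0 \<le> 1 / p * pot w" using nonneg[of w] p by simp
    ultimately have "energy p q G w \<le> a\<^sup>2 * \<mu> / 2 - (\<kappa> * a * \<mu>) powr (q / 2) / q"
      unfolding energy_eq using kin by argo
    then show "\<exists>w\<in>H1_mass G \<mu>. energy p q G w \<le> a\<^sup>2 * \<mu> / 2 - (\<kappa> * a * \<mu>) powr (q / 2) / q"
      using w mass by (auto simp: H1_mass_iff)
  qed
qed

lemma ground_state_small_mass:
  assumes pq: "q < p / 2 + 1"
  shows "\<exists>\<mu>0>0. \<forall>\<mu>>0. \<mu> < \<mu>0 \<longrightarrow> (\<exists>u. ground_state p q G \<mu> u)"
proof -
  obtain \<kappa> where \<kappa>: "\<kappa> > 0" "\<And>\<mu> a. 0 < \<mu> \<Longrightarrow> 0 < a \<Longrightarrow> a \<le> 1 \<Longrightarrow>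
    \<exists>w\<in>H1_mass G \<mu>. energy p q G w \<le> a\<^sup>2 * \<mu> / 2 - (\<kappa> * a * \<mu>) powr (q / 2) / q"
    using spread_out_competitor by blast
  \<comment> \<open>With \<open>a\<close> proportional to \<open>\<mu> powr s\<close>, this exponent
    gives the kinetic term and the vertex term the same power:
    \<open>2 * s + 1 = (s + 1) * (q / 2) = \<beta>\<close>.\<close>
  define s where "s = (q - 2) / (4 - q)"
  define \<beta> where "\<beta> = q / (4 - q)"
  define \<alpha> where "\<alpha> = (p + 2) / (6 - p)"
  define C where "C = (1 / (p * A)) powr (2 * (p - 2) / (6 - p)) / p"
  have C: "C > 0" using A_pos p by (simp add: C_def)
  have s: "s > 0" "2 * s + 1 = \<beta>" "(s + 1) * (q / 2) = \<beta>" using q by (auto simp: s_def \<beta>_def field_simps)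
  have \<alpha>\<beta>: "\<beta> < \<alpha>"
  proof -
    have "q * (6 - p) < (p + 2) * (4 - q)" using pq by (simp add: algebra_simps)
    then show ?thesis using p q by (simp add: \<alpha>_def \<beta>_def divide_simps)
  qed
  define b where "b = \<kappa> powr (q / 2) / q"
  have b: "b > 0" using \<kappa> q by (simp add: b_def)
  \<comment> \<open>Since \<open>q / 2 < 2\<close>, a small \<open>c\<close> makes
    \<open>b * c powr (q / 2)\<close> at least \<open>c\<^sup>2\<close>, twice the coefficient of
    the kinetic bound, so a negative multiple of \<open>\<mu> powr \<beta>\<close> remains. The cap
    1 ensures \<open>a \<le> 1\<close>.\<close>
  define c where "c = min 1 (b powr (1 / (2 - q / 2)))"
  have c: "0 < c" "c \<le> 1" using b by (auto simp: c_def)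
  have cb: "c\<^sup>2 \<le> b * c powr (q / 2)"
  proof -
    have "c powr (2 - q / 2) \<le> (b powr (1 / (2 - q / 2))) powr (2 - q / 2)"
      using c q by (intro powr_mono2) (auto simp: c_def)
    also have "\<dots> = b" using b q by (simp add: powr_powr)
    finally have "c powr (2 - q / 2) * c powr (q / 2) \<le> b * c powr (q / 2)" by (intro mult_right_mono) auto
    then show ?thesis using c by (simp add: powr_add[symmetric])
  qed
  define k where "k = c\<^sup>2 / 2"
  have k: "k > 0" using c by (simp add: k_def)
  \<comment> \<open>The second entry is where \<open>k * \<mu> powr \<beta>\<close> and
    \<open>C * \<mu> powr \<alpha>\<close> cross; below it the smaller exponent wins.\<close>
  define \<mu>0 where "\<mu>0 = min 1 ((k / C) powr (1 / (\<alpha> - \<beta>)))"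
  have "\<exists>u. ground_state p q G \<mu> u" if \<mu>: "0 < \<mu>" "\<mu> < \<mu>0" for \<mu>
  proof -
    define a where "a = c * \<mu> powr s"
    have \<mu>s: "0 < \<mu> powr s" "\<mu> powr s \<le> 1" using \<mu> s by (auto simp: \<mu>0_def powr_le1)
    have a: "0 < a" "a \<le> 1" using c \<mu>s by (auto simp: a_def mult_le_one)
    obtain w where w: "w \<in> H1_mass G \<mu>" "energy p q G w \<le> a\<^sup>2 * \<mu> / 2 - (\<kappa> * a * \<mu>) powr (q / 2) / q"
      using \<kappa>(2)[OF \<mu>(1) a] by blast
    have "a\<^sup>2 * \<mu> = c\<^sup>2 * (\<mu> powr (2 * s) * \<mu> powr 1)"
      using \<mu> by (simp add: a_def power_mult_distrib powr_power mult.commute)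
    also have "\<mu> powr (2 * s) * \<mu> powr 1 = \<mu> powr \<beta>" unfolding powr_add[symmetric] s(2) ..
    finally have e1: "a\<^sup>2 * \<mu> = c\<^sup>2 * \<mu> powr \<beta>" .
    have "\<kappa> * a * \<mu> = \<kappa> * c * \<mu> powr (s + 1)" using \<mu> by (simp add: a_def powr_add)
    then have "(\<kappa> * a * \<mu>) powr (q / 2) = (\<kappa> * c * \<mu> powr (s + 1)) powr (q / 2)" by (rule arg_cong)
    also have "\<dots> = \<kappa> powr (q / 2) * c powr (q / 2) * (\<mu> powr (s + 1)) powr (q / 2)"
      using \<kappa>(1) c by (simp add: powr_mult)
    also have "(\<mu> powr (s + 1)) powr (q / 2) = \<mu> powr \<beta>" unfolding powr_powr s(3) ..
    finally have "(\<kappa> * a * \<mu>) powr (q / 2) = \<kappa> powr (q / 2) * c powr (q / 2) * \<mu> powr \<beta>" .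
    then have e2: "(\<kappa> * a * \<mu>) powr (q / 2) / q = b * c powr (q / 2) * \<mu> powr \<beta>" by (simp add: b_def)
    have "c\<^sup>2 * \<mu> powr \<beta> \<le> b * c powr (q / 2) * \<mu> powr \<beta>" using cb by (intro mult_right_mono) auto
    then have "energy p q G w \<le> - (k * \<mu> powr \<beta>)" using w(2) unfolding e1 e2 k_def by argo
    also have "\<dots> < - (C * \<mu> powr \<alpha>)"
    proof -
      have "\<mu> powr (\<alpha> - \<beta>) < ((k / C) powr (1 / (\<alpha> - \<beta>))) powr (\<alpha> - \<beta>)"
        using \<mu> \<alpha>\<beta> by (intro powr_less_mono2) (auto simp: \<mu>0_def)
      also have "\<dots> = k / C" using \<alpha>\<beta> k C by (simp add: powr_powr)
      finally have "C * \<mu> powr (\<alpha> - \<beta>) * \<mu> powr \<beta> < k * \<mu> powr \<beta>"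
        using C \<mu> by (intro mult_strict_right_mono) (auto simp: field_simps)
      moreover have "\<mu> powr (\<alpha> - \<beta>) * \<mu> powr \<beta> = \<mu> powr \<alpha>" by (simp add: powr_add[symmetric])
      ultimately show ?thesis by (simp add: mult.assoc)
    qed
    finally show ?thesis
      using ground_state_exists[OF \<mu>(1) w(1)] infinity_bound_power[OF \<mu>(1)] unfolding C_def \<alpha>_def by blast
  qed
  moreover have "\<mu>0 > 0" using k C by (simp add: \<mu>0_def)
  ultimately show ?thesis by blast
qed

end

section \<open>Reflections and spikes at a vertex\<close>

lemma Bernoulli_powr:
  assumes "0 \<le> y" "1 < \<theta>"
  shows "1 + \<theta> * (y - 1) \<le> y powr (\<theta> :: real)"
proof -
  \<comment> \<open>The conjugate exponent: Young's inequality for the product \<open>y * 1\<close>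
    is the tangent line bound of \<open>y powr \<theta>\<close> at 1.\<close>
  define q where "q = \<theta> / (\<theta> - 1)"
  have q: "q > 1" "1 / \<theta> + 1 / q = 1" using assms(2) by (auto simp: q_def field_simps)
  have "y * 1 \<le> y powr \<theta> / \<theta> + 1 powr q / q" by (rule Youngs_inequality) (use assms q in auto)
  then have "y \<le> y powr \<theta> / \<theta> + (1 - 1 / \<theta>)" using q(2) by (simp add: algebra_simps)
  then have "\<theta> * y \<le> \<theta> * (y powr \<theta> / \<theta> + (1 - 1 / \<theta>))" using assms by (intro mult_left_mono) auto
  also have "\<dots> = y powr \<theta> + \<theta> - 1" using assms by (simp add: field_simps)
  finally show ?thesis by (simp add: algebra_simps)
qed

lemma LINT_reflect:
  fixes h :: "real \<Rightarrow> real"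
  shows "set_integrable lborel {a..b} (\<lambda>x. h (L - x)) \<longleftrightarrow> set_integrable lborel {L - b..L - a} h"
    "(LINT x:{a..b}|lborel. h (L - x)) = (LINT x:{L - b..L - a}|lborel. h x)"
proof -
  have e: "indicat_real {L - b..L - a} (L + - 1 * x) *\<^sub>R h (L + - 1 * x) = indicat_real {a..b} x *\<^sub>R h (L - x)" for x
    by (auto simp: indicator_def)
  show "set_integrable lborel {a..b} (\<lambda>x. h (L - x)) \<longleftrightarrow> set_integrable lborel {L - b..L - a} h"
    using lborel_integrable_real_affine_iff[of "- 1" "\<lambda>x. indicat_real {L - b..L - a} x *\<^sub>R h x" L]
    unfolding set_integrable_def e by simp
  show "(LINT x:{a..b}|lborel. h (L - x)) = (LINT x:{L - b..L - a}|lborel. h x)"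
    using lborel_integral_real_affine[of "- 1" "\<lambda>x. indicat_real {L - b..L - a} x *\<^sub>R h x" L]
    unfolding set_lebesgue_integral_def e by simp
qed

text \<open>Spike profiles are measured from their vertex, so at the target end of a bounded edge
  they run against its orientation.\<close>

lemma H1_on_reflect:
  assumes "H1_on {0..L} \<psi> \<psi>'"
  shows "H1_on {0..L} (\<lambda>x. \<psi> (L - x)) (\<lambda>x. - \<psi>' (L - x))"
proof -
  note h = H1_onD[OF assms]
  have "ac_deriv {0..L} (\<lambda>x. \<psi> (L - x)) (\<lambda>x. - \<psi>' (L - x))"
    unfolding ac_deriv_def
  proof (intro ballI impI)
    fix x y assume xy: "x \<in> {0..L}" "y \<in> {0..L}" "x \<le> y"
    have "L - y \<in> {0..L}" "L - x \<in> {0..L}" "L - y \<le> L - x" using xy by auto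
    note a = ac_derivD[OF h(1) this]
    have i: "set_integrable lborel {x..y} (\<lambda>t. \<psi>' (L - t))" using a(1) by (simp add: LINT_reflect)
    have "(LINT t:{x..y}|lborel. - \<psi>' (L - t)) = - (LINT t:{L - y..L - x}|lborel. \<psi>' t)"
      using set_integral_uminus[OF i] by (simp add: LINT_reflect)
    with a(2) have "\<psi> (L - y) - \<psi> (L - x) = (LINT t:{x..y}|lborel. - \<psi>' (L - t))" by simp
    moreover have "set_integrable lborel {x..y} (\<lambda>t. - \<psi>' (L - t))"
      using set_integrable_mult_right[of "-1" lborel "{x..y}" "\<lambda>t. \<psi>' (L - t)"] i by simp
    ultimately show "set_integrable lborel {x..y} (\<lambda>t. - \<psi>' (L - t)) \<and> \<psi> (L - y) - \<psi> (L - x) = (LINT t:{x..y}|lborel. - \<psi>' (L - t))"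
      by simp
  qed
  moreover have "set_borel_measurable lborel {0..L} (\<lambda>x. - \<psi>' (L - x))"
  proof -
    have m: "(\<lambda>x. indicat_real {0..L} x *\<^sub>R \<psi>' x) \<in> borel_measurable borel" using h(2) by (simp add: set_borel_measurable_def)
    have A: "(\<lambda>x. - (indicat_real {0..L} (L - x) *\<^sub>R \<psi>' (L - x))) \<in> borel_measurable borel"
      by (intro borel_measurable_uminus measurable_compose[OF _ m]) auto
    have "(\<lambda>x. - (indicat_real {0..L} (L - x) *\<^sub>R \<psi>' (L - x))) = (\<lambda>x. indicat_real {0..L} x *\<^sub>R (- \<psi>' (L - x)))"
      by (auto simp: indicator_def)
    from A[unfolded this] show ?thesis unfolding set_borel_measurable_def measurable_lborel2 .
  qed
  moreover have "set_integrable lborel {0..L} (\<lambda>x. (- \<psi>' (L - x))\<^sup>2)"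
    using h(3) LINT_reflect(1)[of 0 L "\<lambda>x. (\<psi>' x)\<^sup>2" L] by simp
  moreover have "set_integrable lborel {0..L} (\<lambda>x. (\<psi> (L - x))\<^sup>2)"
    using h(4) LINT_reflect(1)[of 0 L "\<lambda>x. (\<psi> x)\<^sup>2" L] by simp
  ultimately show ?thesis by (simp add: H1_on_def)
qed

lemma H1_on_add:
  assumes "H1_on D f g" "H1_on D f' g'" "is_interval D" "D \<in> sets borel"
  shows "H1_on D (\<lambda>x. f x + f' x) (\<lambda>x. g x + g' x)"
proof -
  note h = H1_onD[OF assms(1)] and h' = H1_onD[OF assms(2)]
  have sq: "set_borel_measurable lborel D (\<lambda>x. u x + v x) \<and> set_integrable lborel D (\<lambda>x. (u x + v x)\<^sup>2)"
    if "set_borel_measurable lborel D u" "set_borel_measurable lborel D v"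
      "set_integrable lborel D (\<lambda>x. (u x)\<^sup>2)" "set_integrable lborel D (\<lambda>x. (v x)\<^sup>2)" for u v :: "real \<Rightarrow> real"
  proof -
    have e: "(\<lambda>x. indicat_real D x *\<^sub>R (k x)\<^sup>2) = (\<lambda>x. (indicat_real D x *\<^sub>R k x)\<^sup>2)" for k :: "real \<Rightarrow> real"
      by (auto simp: indicator_def)
    have d: "indicat_real D x *\<^sub>R (u x + v x) = indicat_real D x *\<^sub>R u x + indicat_real D x *\<^sub>R v x" for x
      by (simp add: distrib_left)
    show ?thesis
      using that integrable_square_add(1)[of "\<lambda>x. indicat_real D x *\<^sub>R u x" lborel "\<lambda>x. indicat_real D x *\<^sub>R v x"]
      unfolding set_borel_measurable_def set_integrable_def e d by (auto intro: borel_measurable_add)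
  qed
  have "set_borel_measurable lborel D f" "set_borel_measurable lborel D f'"
    using H1_on_continuous assms by (auto intro: set_borel_measurable_cont)
  then show ?thesis
    using sq[OF h(2) h'(2) h(3) h'(3)] sq[of f f'] h h' ac_deriv_add[OF h(1) h'(1)] by (simp add: H1_on_def)
qed

lemma LINT_zero_outside:
  fixes k :: "real \<Rightarrow> real"
  assumes "{0..l} \<subseteq> D" "\<And>x. x \<in> D \<Longrightarrow> x > l \<Longrightarrow> k x = 0" "D \<subseteq> {0..}"
  shows "(LINT x:D|lborel. k x) = (LINT x:{0..l}|lborel. k x)"
    "set_integrable lborel D k \<longleftrightarrow> set_integrable lborel {0..l} k"
proof -
  have "indicat_real D x *\<^sub>R k x = indicat_real {0..l} x *\<^sub>R k x" for x
    using assms by (cases "x \<in> D"; cases "x \<le> l") (auto simp: indicator_def)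
  then show "(LINT x:D|lborel. k x) = (LINT x:{0..l}|lborel. k x)"
    "set_integrable lborel D k \<longleftrightarrow> set_integrable lborel {0..l} k"
    unfolding set_lebesgue_integral_def set_integrable_def by (simp_all only:)
qed

context nls_graph
begin

definition "src_at v e = (if src G e = v then 1 else 0 :: real)"
text \<open>The target of a half-line has no meaning; restricting to bounded edges matches the count
  in \<open>vertex_degree\<close>.\<close>

definition "tgt_at v e = (if e \<in> bounded_edges G \<and> tgt G e = v then 1 else 0 :: real)"

text \<open>A copy of the profile \<open>\<psi>\<close> on every edge-end at \<open>v\<close>; a loop carries two copies with disjoint supports.\<close>

definition "spike v \<psi> e x = src_at v e * \<psi> x + tgt_at v e * \<psi> (real_of_ereal (len G e) - x)"

lemma degree_sum:
  assumes "v \<in> verts G"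
  shows "(\<Sum>e\<in>edges G. src_at v e + tgt_at v e) = real (vertex_degree G v)"
proof -
  have "(\<Sum>e\<in>edges G. src_at v e) = real (card {e \<in> edges G. src G e = v})"
    unfolding src_at_def using fin(1) by (simp add: sum.If_cases Int_def)
  moreover have "{e \<in> edges G. e \<in> bounded_edges G \<and> tgt G e = v} = {e \<in> bounded_edges G. tgt G e = v}"
    by (auto simp: bounded_edges_def)
  then have "(\<Sum>e\<in>edges G. tgt_at v e) = real (card {e \<in> bounded_edges G. tgt G e = v})"
    unfolding tgt_at_def using fin(1) by (simp add: sum.If_cases Int_def)
  ultimately show ?thesis by (simp add: sum.distrib vertex_degree_def)
qed

lemma LINT_spike:
  assumes l: "l > 0" "\<And>e. e \<in> edges G \<Longrightarrow> ereal (2 * l) < len G e"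
    and k: "\<And>x. x > l \<Longrightarrow> k x = 0" "set_integrable lborel {0..l} k" and e: "e \<in> edges G"
  shows "(LINT x:D e|lborel. spike v k e x) = (src_at v e + tgt_at v e) * (LINT x:{0..l}|lborel. k x)"
proof -
  define L where "L = real_of_ereal (len G e)"
  have sub: "{0..l} \<subseteq> D e" "D e \<subseteq> {0..}"
  proof -
    show "{0..l} \<subseteq> D e"
    proof
      fix x assume "x \<in> {0..l}"
      then have "0 \<le> x" "ereal x \<le> ereal (2 * l)" using l(1) by auto
      then show "x \<in> D e" using order_trans[OF _ less_imp_le[OF l(2)[OF e]]] by (auto simp: edge_dom_def)
    qed
  qed (auto simp: edge_dom_def)
  note z = LINT_zero_outside[OF sub(1) k(1) sub(2)]
  have i: "set_integrable lborel (D e) k" using z(2) k(2) by simp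
  show ?thesis
  proof (cases "tgt_at v e = 0")
    case True
    then show ?thesis unfolding spike_def using z(1) by simp
  next
    case False
    then have "e \<in> bounded_edges G" by (auto simp: tgt_at_def split: if_splits)
    then have "len G e \<noteq> \<infinity>" by (simp add: bounded_edges_def)
    then have L: "len G e = ereal L" "D e = {0..L}" "2 * l < L"
      using len_pos[OF e] l(2)[OF e] by (cases "len G e"; auto simp: L_def edge_dom_def)+
    have i2: "set_integrable lborel (D e) (\<lambda>x. k (L - x))"
      using i LINT_reflect(1)[of 0 L k L] by (simp add: L)
    have "(LINT x:D e|lborel. spike v k e x) = src_at v e * (LINT x:D e|lborel. k x) + tgt_at v e * (LINT x:D e|lborel. k (L - x))"
      unfolding spike_def L_def[symmetric] using i i2 by (simp add: set_integral_add)
    also have "(LINT x:D e|lborel. k (L - x)) = (LINT x:D e|lborel. k x)"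
      using LINT_reflect(2)[of 0 L k L] by (simp add: L)
    finally show ?thesis using z(1) by (simp add: distrib_right)
  qed
qed

text \<open>Every edge-end at \<open>v\<close> carries the same integral, so each graph integral is
  the degree times an integral over \<open>{0..l}\<close>. Squares and powers pass through the sum
  of two copies on one edge because \<open>2 * l\<close> is below its length and the supports are
  disjoint; the copies also vanish at the opposite end, which makes \<open>u\<close> well defined at
  the other vertices.\<close>

lemma spike_competitor:
  assumes v: "v \<in> verts G" and l: "l > 0" "\<And>e. e \<in> edges G \<Longrightarrow> ereal (2 * l) < len G e"
    and H: "H1_on {0..} \<psi> \<psi>'" and z: "\<And>x. x \<ge> l \<Longrightarrow> \<psi> x = 0" "\<And>x. x > l \<Longrightarrow> \<psi>' x = 0"
  obtains u where "u \<in> H1 G" "mass u = real (vertex_degree G v) * (LINT x:{0..l}|lborel. (\<psi> x)\<^sup>2)"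
    "kin u = real (vertex_degree G v) * (LINT x:{0..l}|lborel. (\<psi>' x)\<^sup>2)"
    "pot u = real (vertex_degree G v) * (LINT x:{0..l}|lborel. \<bar>\<psi> x\<bar> powr p)" "u (Vertex v) = \<psi> 0"
proof -
  define u where "u = (glue (\<lambda>w. if w = v then \<psi> 0 else 0) (spike v \<psi>) :: ('v, 'e) point \<Rightarrow> real)"
  define h where "h e x = src_at v e * \<psi>' x - tgt_at v e * \<psi>' (real_of_ereal (len G e) - x)" for e x
  have bd: "\<exists>L. len G e = ereal L \<and> D e = {0..L} \<and> 2 * l < L" if "e \<in> bounded_edges G" for e
  proof -
    have e: "e \<in> edges G" "len G e \<noteq> \<infinity>" using that by (auto simp: bounded_edges_def)
    show ?thesis using e(2) len_pos[OF e(1)] l(2)[OF e(1)] by (cases "len G e") (auto simp: edge_dom_def)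
  qed
  have fu: "f u e = spike v \<psi> e" if e: "e \<in> edges G" for e
    unfolding u_def
  proof (rule ext, rule on_edge_glue)
    show "spike v \<psi> e 0 = (if src G e = v then \<psi> 0 else 0)"
    proof (cases "e \<in> bounded_edges G")
      case True
      then obtain L where "len G e = ereal L" "2 * l < L" using bd by blast
      then show ?thesis using z(1)[of L] l(1) by (simp add: spike_def src_at_def)
    qed (simp add: spike_def src_at_def tgt_at_def)
    fix L assume L: "len G e = ereal L"
    then have "e \<in> bounded_edges G" using e by (simp add: bounded_edges_def)
    then have "2 * l < L" using bd L by force
    then show "spike v \<psi> e L = (if tgt G e = v then \<psi> 0 else 0)"
      using z(1)[of L] l(1) L \<open>e \<in> bounded_edges G\<close> by (simp add: spike_def tgt_at_def)
  qed
  have Hu: "H1_on (D e) (f u e) (h e)" if e: "e \<in> edges G" for e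
  proof -
    have s: "H1_on (D e) (\<lambda>x. src_at v e * \<psi> x) (\<lambda>x. src_at v e * \<psi>' x)"
      by (intro H1_on_cmult H1_on_subset[OF H] D_facts(2)[OF e]) (auto simp: edge_dom_def)
    have t: "H1_on (D e) (\<lambda>x. tgt_at v e * \<psi> (real_of_ereal (len G e) - x)) (\<lambda>x. tgt_at v e * - \<psi>' (real_of_ereal (len G e) - x))"
    proof (cases "tgt_at v e = 0")
      case True
      then show ?thesis using H1_on_cmult[OF s, of 0] by simp
    next
      case False
      then have "e \<in> bounded_edges G" by (auto simp: tgt_at_def split: if_splits)
      then obtain L where L: "len G e = ereal L" "D e = {0..L}" using bd by blast
      have "H1_on {0..L} \<psi> \<psi>'" by (rule H1_on_subset[OF H]) auto
      from H1_on_cmult[OF H1_on_reflect[OF this], of "tgt_at v e"] show ?thesis by (simp add: L)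
    qed
    from H1_on_add[OF s t D_facts[OF e]] show ?thesis unfolding fu[OF e] by (simp add: h_def[abs_def] spike_def[abs_def])
  qed
  have disj: "x \<le> l \<Longrightarrow> tgt_at v e \<noteq> 0 \<Longrightarrow> real_of_ereal (len G e) - x > l" if e: "e \<in> edges G" for e x
  proof -
    assume "x \<le> l" "tgt_at v e \<noteq> 0"
    then have "e \<in> bounded_edges G" by (auto simp: tgt_at_def split: if_splits)
    then show ?thesis using bd[of e] \<open>x \<le> l\<close> by auto
  qed
  have at01: "src_at v e = 0 \<or> src_at v e = 1" "tgt_at v e = 0 \<or> tgt_at v e = 1" for e
    by (auto simp: src_at_def tgt_at_def)
  have z': "\<psi> x = 0" if "x > l" for x using z(1)[of x] that by simp
  have sq: "(spike v \<psi> e x)\<^sup>2 = spike v (\<lambda>x. (\<psi> x)\<^sup>2) e x" if e: "e \<in> edges G" for e x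
    using at01[of e] disj[OF e, of x] z'[of x] z'[of "real_of_ereal (len G e) - x"]
    by (cases "x \<le> l") (auto simp: spike_def)
  have pw: "\<bar>spike v \<psi> e x\<bar> powr p = spike v (\<lambda>x. \<bar>\<psi> x\<bar> powr p) e x" if e: "e \<in> edges G" for e x
    using at01[of e] disj[OF e, of x] z'[of x] z'[of "real_of_ereal (len G e) - x"] p(1)
    by (cases "x \<le> l") (auto simp: spike_def)
  have hq: "(h e x)\<^sup>2 = spike v (\<lambda>x. (\<psi>' x)\<^sup>2) e x" if e: "e \<in> edges G" for e x
    using at01[of e] disj[OF e, of x] z(2)[of x] z(2)[of "real_of_ereal (len G e) - x"]
    by (cases "x \<le> l") (auto simp: spike_def h_def)
  have H0: "H1_on {0..l} \<psi> \<psi>'" by (rule H1_on_subset[OF H]) auto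
  have cont: "continuous_on {0..l} \<psi>" by (rule H1_on_continuous[OF H0 is_interval_cc])
  have ip: "set_integrable lborel {0..l} (\<lambda>x. \<bar>\<psi> x\<bar> powr p)"
    unfolding set_integrable_def using p(1) cont
    by (intro borel_integrable_compact continuous_on_powr' continuous_intros) auto
  have tot: "(\<Sum>e\<in>edges G. LINT x:D e|lborel. spike v k e x) = real (vertex_degree G v) * (LINT x:{0..l}|lborel. k x)"
    if "\<And>x. x > l \<Longrightarrow> k x = 0" "set_integrable lborel {0..l} k" for k
    using LINT_spike[OF l that] by (simp add: degree_sum[OF v, symmetric] sum_distrib_right)
  show thesis
  proof (rule that)
    show "u \<in> H1 G" by (rule H1_onI_graph(1)[OF G Hu])
    show "u (Vertex v) = \<psi> 0" by (simp add: u_def glue_def)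
    show "mass u = real (vertex_degree G v) * (LINT x:{0..l}|lborel. (\<psi> x)\<^sup>2)"
      unfolding mass_def graph_integral_def power2_abs using tot[of "\<lambda>x. (\<psi> x)\<^sup>2"] z' H1_onD(4)[OF H0]
      by (simp add: fu sq)
    show "pot u = real (vertex_degree G v) * (LINT x:{0..l}|lborel. \<bar>\<psi> x\<bar> powr p)"
      unfolding pot_def graph_integral_def using tot[of "\<lambda>x. \<bar>\<psi> x\<bar> powr p"] z' ip by (simp add: fu pw)
    show "kin u = real (vertex_degree G v) * (LINT x:{0..l}|lborel. (\<psi>' x)\<^sup>2)"
    proof -
      have "kin u = (\<Sum>e\<in>edges G. LINT x:D e|lborel. (h e x)\<^sup>2)"
        unfolding kin_def by (rule H1_onI_graph(2)[OF G Hu])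
      then show ?thesis using tot[of "\<lambda>x. (\<psi>' x)\<^sup>2"] z(2) H1_onD(3)[OF H0] by (simp add: hq)
    qed
  qed
qed


section \<open>The soliton\<close>

text \<open>\<open>sol M\<close> is the even decaying solution of
  \<open>u'' + u powr (p - 1) = (\<omega> M)\<^sup>2 * u\<close> with maximum \<open>M\<close>, a
  power of sech. \<open>rate M\<close> times \<open>2 / (p - 2)\<close> is
  \<open>\<omega> M\<close>, which is thus the exponential decay rate of the soliton.\<close>

definition "\<omega> M = sqrt (2 / p) * M powr ((p - 2) / 2)"
definition "rate M = \<omega> M * (p - 2) / 2"
definition "sol M x = M * cosh (rate M * x) powr (- (2 / (p - 2)))"
definition "sol' M x = - \<omega> M * sol M x * tanh (rate M * x)"

lemma \<omega>_pos: "M > 0 \<Longrightarrow> \<omega> M > 0" using p by (simp add: \<omega>_def)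

lemma \<omega>_square: "M > 0 \<Longrightarrow> (\<omega> M)\<^sup>2 = 2 / p * M powr (p - 2)"
proof -
  have "(M powr ((p - 2) / 2))\<^sup>2 = M powr (p - 2)"
    unfolding power2_eq_square powr_add[symmetric] by (simp only: field_sum_of_halves)
  then show ?thesis using p by (simp add: \<omega>_def power_mult_distrib)
qed

lemma sol_has_derivative: "(sol M has_real_derivative sol' M x) (at x)"
proof -
  let ?b = "rate M" and ?s = "2 / (p - 2)"
  have s2: "?s * (p - 2) = 2" using nonzero_eq_divide_eq[of "p - 2" ?s 2] p by simp
  have "a * (w * c / 2) = w * (a * c) / 2" for a w c :: real by simp
  then have "?s * ?b = \<omega> M * (?s * (p - 2)) / 2" unfolding rate_def .
  then have sb: "?s * ?b = \<omega> M" unfolding s2 by simp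
  have "((\<lambda>x. cosh (?b * x)) has_real_derivative sinh (?b * x) * ?b) (at x)"
    by (auto intro!: derivative_eq_intros)
  then have "((\<lambda>x. cosh (?b * x) powr (- ?s)) has_real_derivative (- ?s * cosh (?b * x) powr (- ?s - 1)) * (sinh (?b * x) * ?b)) (at x)"
    by (intro DERIV_chain2[where f="\<lambda>y. y powr (- ?s)"] has_real_derivative_powr) (auto simp: cosh_real_pos)
  then have "(sol M has_real_derivative M * ((- ?s * cosh (?b * x) powr (- ?s - 1)) * (sinh (?b * x) * ?b))) (at x)"
    unfolding sol_def[abs_def] by (rule DERIV_cmult)
  moreover have "cosh (?b * x) powr (- ?s - 1) = cosh (?b * x) powr (- ?s) / cosh (?b * x)"
    using cosh_real_pos[of "?b * x"] by (subst powr_diff) simp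
  then have "M * ((- ?s * cosh (?b * x) powr (- ?s - 1)) * (sinh (?b * x) * ?b)) =
      - (?s * ?b) * (M * cosh (?b * x) powr (- ?s)) * tanh (?b * x)"
  proof -
    have "M * ((- s * (c / k)) * (h * b)) = - (s * b) * (M * c) * (h / k)" for s c k h b :: real by simp
    then show ?thesis if "cosh (?b * x) powr (- ?s - 1) = cosh (?b * x) powr (- ?s) / cosh (?b * x)"
      unfolding that tanh_def .
  qed
  then have "M * ((- ?s * cosh (?b * x) powr (- ?s - 1)) * (sinh (?b * x) * ?b)) = sol' M x"
    unfolding sb sol'_def sol_def .
  ultimately show ?thesis by (simp only:)
qed

lemma rate_pos: "M > 0 \<Longrightarrow> rate M > 0" using p \<omega>_pos[of M] by (simp add: rate_def)

lemma sol_pos: "M > 0 \<Longrightarrow> 0 < sol M x"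
  using cosh_real_pos by (simp add: sol_def less_imp_neq[THEN not_sym])

lemma sol_le: "M > 0 \<Longrightarrow> sol M x \<le> M"
proof -
  assume M: "M > 0"
  have "cosh (rate M * x) powr (- (2 / (p - 2))) \<le> 1 powr (- (2 / (p - 2)))"
    using p cosh_real_ge_1 by (intro powr_mono2') auto
  then show ?thesis using M by (simp add: sol_def mult_left_le)
qed

lemma sol_0: "sol M 0 = M" by (simp add: sol_def)

lemma sol'_nonpos: "M > 0 \<Longrightarrow> x \<ge> 0 \<Longrightarrow> sol' M x \<le> 0"
  unfolding sol'_def using \<omega>_pos[of M] sol_pos[of M x] rate_pos[of M] by (intro mult_nonpos_nonneg) (auto simp: mult_nonpos_nonneg)

lemma sol_antimono: assumes "M > 0" "0 \<le> x" "x \<le> y" shows "sol M y \<le> sol M x"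
  by (rule DERIV_nonpos_imp_nonincreasing[OF assms(3)])
     (use sol_has_derivative sol'_nonpos[OF assms(1)] assms(2) in \<open>meson order_trans\<close>)

text \<open>The square of sech: both \<open>sol M x powr p\<close> and the squared derivative are
  \<open>(sol M x)\<^sup>2\<close> times an affine function of it, so identities between them become
  algebra.\<close>

definition "sg M x = 1 / (cosh (rate M * x))\<^sup>2"

lemma tanh_sg: "(tanh (rate M * x))\<^sup>2 = 1 - sg M x"
proof -
  have "(sinh y)\<^sup>2 = (cosh y)\<^sup>2 - 1" "cosh y \<noteq> 0" for y :: real
    using cosh_real_pos[of y] by (auto simp: cosh_square_eq)
  then show ?thesis by (simp add: sg_def tanh_def power_divide diff_divide_distrib)
qed

lemma sol_powr:
  assumes "M > 0"
  shows "sol M x powr p = (\<omega> M)\<^sup>2 * p / 2 * sg M x * (sol M x)\<^sup>2"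
proof -
  let ?c = "cosh (rate M * x)"
  have c: "?c > 0" by (rule cosh_real_pos)
  have "2 / (p - 2) * (p - 2) = 2" using nonzero_eq_divide_eq[of "p - 2" "2 / (p - 2)" 2] p by simp
  then have "- (2 / (p - 2)) * (p - 2) = - 2" by (simp only: mult_minus_left)
  then have "(?c powr (- (2 / (p - 2)))) powr (p - 2) = ?c powr (- 2)" unfolding powr_powr by (rule arg_cong)
  also have "\<dots> = sg M x" using c by (simp add: sg_def powr_minus_divide)
  finally have e: "sol M x powr (p - 2) = M powr (p - 2) * sg M x"
    using assms unfolding sol_def by (simp add: powr_mult)
  have "sol M x powr p = \<bar>sol M x\<bar> powr (p - 2) * (sol M x)\<^sup>2"
    using powr_split_square[OF p(1), of "sol M x"] sol_pos[OF assms, of x] by simp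
  also have "\<dots> = M powr (p - 2) * sg M x * (sol M x)\<^sup>2" using e sol_pos[OF assms, of x] by simp
  finally show ?thesis using \<omega>_square[OF assms] p by simp
qed

lemma sol'_square: "(sol' M x)\<^sup>2 = (\<omega> M)\<^sup>2 * (sol M x)\<^sup>2 * (1 - sg M x)"
  by (simp add: sol'_def power_mult_distrib tanh_sg)

lemma sol'_square': "M > 0 \<Longrightarrow> (sol' M x)\<^sup>2 = (\<omega> M)\<^sup>2 * (sol M x)\<^sup>2 - 2 / p * sol M x powr p"
  using p unfolding sol_powr sol'_square by (simp add: algebra_simps)

text \<open>The first integral with the sign of a decreasing function: on its right half the soliton
  attains equality in the calibration.\<close>

lemma calib'_sol: assumes "M > 0" "x \<ge> 0" shows "calib' p M (sol M x) = - sol' M x"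
proof (rule power2_eq_imp_eq)
  have "\<bar>sol M x\<bar> \<le> M" using sol_pos[OF assms(1), of x] sol_le[OF assms(1), of x] by simp
  from calib'_square[OF p(1) assms(1) this]
  show "(calib' p M (sol M x))\<^sup>2 = (- sol' M x)\<^sup>2"
    using sol_pos[OF assms(1), of x] \<omega>_square[OF assms(1)] p
    by (simp add: calW_def sol'_square'[OF assms(1)] algebra_simps)
  show "0 \<le> calib' p M (sol M x)" using p cal_w_nonneg by (simp add: calib'_def)
  show "0 \<le> - sol' M x" using sol'_nonpos[OF assms] by simp
qed

lemma sol_cont: "continuous_on X (sol M)" "continuous_on X (sol' M)"
proof -
  show c: "continuous_on X (sol M)" for X using sol_has_derivative by (meson DERIV_isCont continuous_at_imp_continuous_on)
  have "isCont (\<lambda>x. tanh (rate M * x)) x" for x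
    by (intro continuous_intros) (use cosh_real_pos[of "rate M * x"] in simp)
  then have t: "continuous_on X (\<lambda>x. tanh (rate M * x))" by (simp add: continuous_at_imp_continuous_on)
  show "continuous_on X (sol' M)" unfolding sol'_def[abs_def]
    by (intro continuous_on_mult continuous_on_minus continuous_on_const c t)
qed

text \<open>This is the soliton equation multiplied by the solution; integrating it relates kinetic
  energy, mass and potential of a truncated soliton.\<close>

lemma sol_product_derivative:
  assumes M: "M > 0"
  shows "((\<lambda>x. sol M x * sol' M x) has_real_derivative (sol' M x)\<^sup>2 + (\<omega> M)\<^sup>2 * (sol M x)\<^sup>2 - sol M x powr p) (at x)"
proof -
  define b where "b = rate M"
  have t: "((\<lambda>x. tanh (b * x)) has_real_derivative (1 - (tanh (b * x))\<^sup>2) * b) (at x)"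
    using cosh_real_pos[of "b * x"] by (auto intro!: derivative_eq_intros)
  have d: "((\<lambda>x. - \<omega> M * sol M x * tanh (b * x)) has_real_derivative
      (- \<omega> M * sol' M x) * tanh (b * x) + (1 - (tanh (b * x))\<^sup>2) * b * (- \<omega> M * sol M x)) (at x)"
    by (intro DERIV_mult t DERIV_cmult sol_has_derivative)
  have "sol' M = (\<lambda>x. - \<omega> M * sol M x * tanh (b * x))" by (simp add: sol'_def[abs_def] b_def)
  with DERIV_mult[OF sol_has_derivative[of M x] d]
  have 1: "((\<lambda>x. sol M x * sol' M x) has_real_derivative
      sol' M x * (- \<omega> M * sol M x * tanh (b * x)) +
      ((- \<omega> M * sol' M x) * tanh (b * x) + (1 - (tanh (b * x))\<^sup>2) * b * (- \<omega> M * sol M x)) * sol M x) (at x)" by simp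
  have s: "sol' M x = - \<omega> M * sol M x * tanh (b * x)" by (simp add: sol'_def b_def)
  have tg: "(tanh (b * x))\<^sup>2 = 1 - sg M x" unfolding b_def by (rule tanh_sg)
  have "sol' M x * (- \<omega> M * sol M x * tanh (b * x)) +
      ((- \<omega> M * sol' M x) * tanh (b * x) + (1 - (tanh (b * x))\<^sup>2) * b * (- \<omega> M * sol M x)) * sol M x
     = 2 * ((\<omega> M)\<^sup>2 * (sol M x)\<^sup>2 * (tanh (b * x))\<^sup>2) - (1 - (tanh (b * x))\<^sup>2) * b * \<omega> M * (sol M x)\<^sup>2"
    unfolding s by (simp add: power2_eq_square algebra_simps)
  also have "\<dots> = (sol' M x)\<^sup>2 + (\<omega> M)\<^sup>2 * (sol M x)\<^sup>2 - sol M x powr p"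
    unfolding tg unfolding sol'_square sol_powr[OF M] b_def rate_def by (simp add: power2_eq_square field_simps)
  finally show ?thesis using 1 by simp
qed

lemma sol_decay:
  assumes "M > 0"
  shows "sol M x \<le> 2 powr (2 / (p - 2)) * M * exp (- (\<omega> M * x))"
proof -
  define y where "y = rate M * x"
  have "exp y / 2 \<le> cosh y" by (simp add: cosh_def)
  then have "cosh y powr (- (2 / (p - 2))) \<le> (exp y / 2) powr (- (2 / (p - 2)))"
    using p by (intro powr_mono2') auto
  also have "\<dots> = exp y powr (- (2 / (p - 2))) * 2 powr (2 / (p - 2))"
    by (simp add: powr_divide powr_minus_divide)
  also have "exp y powr (- (2 / (p - 2))) = exp (- (\<omega> M * x))"
    using p by (simp add: powr_def y_def rate_def)
  finally have "M * cosh y powr (- (2 / (p - 2))) \<le> M * (exp (- (\<omega> M * x)) * 2 powr (2 / (p - 2)))"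
    using assms by (intro mult_left_mono) auto
  moreover have "sol M x = M * cosh y powr (- (2 / (p - 2)))" by (simp add: sol_def y_def)
  ultimately show ?thesis by (simp add: mult_ac)
qed

lemma calib_nonneg: "M > 0 \<Longrightarrow> s \<ge> 0 \<Longrightarrow> 0 \<le> calib p M s"
  using cal_mono[OF p(1), of 0 "s / M"] p by (simp add: calib_def cal_0)

lemma calib_M: "M > 0 \<Longrightarrow> calib p M M = A / 2 * M powr (p / 2 + 1)"
  by (simp add: calib_def A_def)

text \<open>Two linear relations determine \<open>m\<close> and \<open>P\<close> from
  \<open>T\<close> up to the boundary term: the integrated first integral and the integrated
  derivative of \<open>sol M x * sol' M x\<close>. \<open>T\<close> itself is a drop of
  \<open>calib\<close>, because \<open>calib'\<close> along the soliton equals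
  \<open>- sol'\<close>.\<close>

lemma sol_integrals:
  assumes M: "M > 0" and l: "l \<ge> 0"
  defines "T \<equiv> LINT x:{0..l}|lborel. (sol' M x)\<^sup>2" and "m \<equiv> LINT x:{0..l}|lborel. (sol M x)\<^sup>2"
    and "P \<equiv> LINT x:{0..l}|lborel. sol M x powr p" and "\<beta> \<equiv> sol M l * sol' M l"
  shows "T = calib p M M - calib p M (sol M l)"
    "(p - 2) * P = p * (2 * T - \<beta>)" "(p - 2) * ((\<omega> M)\<^sup>2 * m) = (p + 2) * T - 2 * \<beta>" "\<beta> \<le> 0" "- \<beta> \<le> \<omega> M * (sol M l)\<^sup>2"
proof -
  have ci: "set_integrable lborel {0..l} k" if "continuous_on {0..l} k" for k :: "real \<Rightarrow> real"
    unfolding set_integrable_def using that by (intro borel_integrable_compact) auto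
  have i: "set_integrable lborel {0..l} (\<lambda>x. (sol' M x)\<^sup>2)" "set_integrable lborel {0..l} (\<lambda>x. (sol M x)\<^sup>2)"
    "set_integrable lborel {0..l} (\<lambda>x. sol M x powr p)"
    using sol_pos[OF M] by (auto intro!: ci continuous_intros sol_cont simp: less_imp_neq[THEN not_sym])
  have "ac_deriv {0..l} (\<lambda>x. calib p M (sol M x)) (\<lambda>x. - (sol' M x)\<^sup>2)"
  proof (rule ac_deriv_C1)
    fix x assume "x \<in> {0..l}"
    then have "calib' p M (sol M x) * sol' M x = - (sol' M x)\<^sup>2" using calib'_sol[OF M] by (simp add: power2_eq_square)
    with DERIV_chain2[OF calib_has_derivative[OF p(1) M] sol_has_derivative[of M x]]
    show "((\<lambda>x. calib p M (sol M x)) has_real_derivative - (sol' M x)\<^sup>2) (at x within {0..l})"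
      by (simp add: has_field_derivative_at_within)
  qed (auto intro!: continuous_intros sol_cont simp: is_interval_cc)
  from ac_derivD(2)[OF this, of 0 l] show T: "T = calib p M M - calib p M (sol M l)"
    using l set_integral_uminus[OF i(1)] by (simp add: T_def sol_0)
  have "ac_deriv {0..l} (\<lambda>x. sol M x * sol' M x) (\<lambda>x. (sol' M x)\<^sup>2 + (\<omega> M)\<^sup>2 * (sol M x)\<^sup>2 - sol M x powr p)"
    using sol_pos[OF M]
    by (intro ac_deriv_C1 has_field_derivative_at_within[OF sol_product_derivative[OF M]])
       (auto intro!: continuous_intros sol_cont simp: is_interval_cc less_imp_neq[THEN not_sym])
  from ac_derivD(2)[OF this, of 0 l] have b: "\<beta> = T + (\<omega> M)\<^sup>2 * m - P"
    using l i by (simp add: \<beta>_def T_def m_def P_def set_integral_add set_integral_diff sol'_def[of M 0])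
  have "T = (LINT x:{0..l}|lborel. (\<omega> M)\<^sup>2 * (sol M x)\<^sup>2 - 2 / p * sol M x powr p)"
    unfolding T_def using M by (simp add: sol'_square')
  also have "\<dots> = (\<omega> M)\<^sup>2 * m - 2 / p * P" using i by (simp add: set_integral_diff m_def P_def)
  finally have t: "(\<omega> M)\<^sup>2 * m = T + 2 / p * P" by simp
  have "\<beta> = 2 * T + 2 / p * P - P" using b t by argo
  then have "p * \<beta> = 2 * p * T + 2 * P - p * P" using p by (simp add: field_simps)
  then show P: "(p - 2) * P = p * (2 * T - \<beta>)" by (simp add: algebra_simps)
  have "(p - 2) * ((\<omega> M)\<^sup>2 * m) = (p - 2) * T + 2 / p * ((p - 2) * P)"
    unfolding t by (simp only: distrib_left mult.left_commute)
  also have "\<dots> = (p + 2) * T - 2 * \<beta>" unfolding P using p by (simp add: field_simps)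
  finally show "(p - 2) * ((\<omega> M)\<^sup>2 * m) = (p + 2) * T - 2 * \<beta>" .
  show "\<beta> \<le> 0" unfolding \<beta>_def using sol_pos[OF M, of l] sol'_nonpos[OF M l] by (intro mult_nonneg_nonpos) auto
  have "tanh (rate M * l) \<le> 1" using tanh_real_lt_1 by (simp add: less_imp_le)
  then have "\<omega> M * (sol M l)\<^sup>2 * tanh (rate M * l) \<le> \<omega> M * (sol M l)\<^sup>2 * 1"
    using \<omega>_pos[OF M] by (intro mult_left_mono) auto
  then show "- \<beta> \<le> \<omega> M * (sol M l)\<^sup>2" by (simp add: \<beta>_def sol'_def power2_eq_square mult_ac)
qed

text \<open>The mass over \<open>{0..l}\<close> grows with \<open>l\<close>. Moving the right end to
  infinity removes the boundary terms by exponential decay and leaves the mass of the full half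
  soliton as a bound.\<close>

lemma sol_mass_le:
  assumes M: "M > 0" and l: "l \<ge> 0"
  shows "(p - 2) * ((\<omega> M)\<^sup>2 * (LINT x:{0..l}|lborel. (sol M x)\<^sup>2)) \<le> (p + 2) * calib p M M"
proof -
  define C where "C = 2 powr (2 / (p - 2)) * M"
  have "((\<lambda>x. (p + 2) * calib p M M + 2 * (\<omega> M * (C * exp (- (\<omega> M * x)))\<^sup>2)) \<longlongrightarrow> (p + 2) * calib p M M + 2 * (\<omega> M * (C * 0)\<^sup>2)) at_top"
    using \<omega>_pos[OF M] by (intro tendsto_intros) real_asymp
  then have lim: "((\<lambda>x. (p + 2) * calib p M M + 2 * (\<omega> M * (C * exp (- (\<omega> M * x)))\<^sup>2)) \<longlongrightarrow> (p + 2) * calib p M M) at_top"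
    by simp
  show ?thesis
  proof (rule tendsto_lowerbound[OF lim])
    show "\<forall>\<^sub>F x in at_top. (p - 2) * ((\<omega> M)\<^sup>2 * (LINT x:{0..l}|lborel. (sol M x)\<^sup>2)) \<le> (p + 2) * calib p M M + 2 * (\<omega> M * (C * exp (- (\<omega> M * x)))\<^sup>2)"
      using eventually_ge_at_top[of l]
    proof eventually_elim
      fix y assume y: "l \<le> y"
      then have y0: "y \<ge> 0" using l by simp
      note s = sol_integrals[OF M y0]
      have i: "set_integrable lborel {0..y} (\<lambda>x. (sol M x)\<^sup>2)"
        unfolding set_integrable_def by (intro borel_integrable_compact continuous_intros sol_cont) auto
      have "(LINT x:{0..l}|lborel. (sol M x)\<^sup>2) \<le> (LINT x:{0..y}|lborel. (sol M x)\<^sup>2)"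
        by (rule LINT_nonneg_mono_set[OF i]) (use y in auto)
      then have "(p - 2) * ((\<omega> M)\<^sup>2 * (LINT x:{0..l}|lborel. (sol M x)\<^sup>2)) \<le> (p - 2) * ((\<omega> M)\<^sup>2 * (LINT x:{0..y}|lborel. (sol M x)\<^sup>2))"
        using p by (intro mult_left_mono) auto
      also have "\<dots> = (p + 2) * (calib p M M - calib p M (sol M y)) + 2 * - (sol M y * sol' M y)"
        unfolding s(3) s(1) by simp
      also have "\<dots> \<le> (p + 2) * calib p M M + 2 * (\<omega> M * (C * exp (- (\<omega> M * y)))\<^sup>2)"
      proof (intro add_mono mult_left_mono)
        show "calib p M M - calib p M (sol M y) \<le> calib p M M"
          using calib_nonneg[OF M, of "sol M y"] sol_pos[OF M, of y] by simp
        have "(sol M y)\<^sup>2 \<le> (C * exp (- (\<omega> M * y)))\<^sup>2"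
          using sol_decay[OF M, of y] sol_pos[OF M, of y] unfolding C_def by (intro power_mono) auto
        then show "- (sol M y * sol' M y) \<le> \<omega> M * (C * exp (- (\<omega> M * y)))\<^sup>2"
          using s(5) \<omega>_pos[OF M] by (meson less_imp_le mult_left_mono order_trans)
      qed (use p in auto)
      finally show "(p - 2) * ((\<omega> M)\<^sup>2 * (LINT x:{0..l}|lborel. (sol M x)\<^sup>2)) \<le> (p + 2) * calib p M M + 2 * (\<omega> M * (C * exp (- (\<omega> M * y)))\<^sup>2)" .
    qed
  qed simp
qed

section \<open>Large mass: the sharp level of the line and the truncated soliton\<close>

lemma infinity_bound_soliton:
  assumes M: "M > 0" and \<mu>: "(p - 2) * (\<mu> / p * M powr (p - 2)) = (p + 2) * calib p M M"
  shows "infinity_bound \<mu> (- (6 - p) / (p - 2) * calib p M M)"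
proof -
  define S where "S = calib p M M"
  have S: "S \<ge> 0" unfolding S_def using calib_nonneg[OF M] M by simp
  \<comment> \<open>In the variable \<open>y = (K / M) powr (p - 2)\<close> the bound reads
    \<open>2 * S * (y powr \<theta> - \<theta> * y)\<close>. The hypothesis on \<open>\<mu>\<close>
    is its stationarity at \<open>K = M\<close>, and Bernoulli's inequality, valid as
    \<open>\<theta> > 1\<close> for \<open>p < 6\<close>, makes \<open>y = 1\<close> the minimum
    with value \<open>(2 - 2 * \<theta>) * S\<close>.\<close>
  define \<theta> where "\<theta> = (p / 2 + 1) / (p - 2)"
  have \<theta>: "\<theta> > 1" "2 * \<theta> = (p + 2) / (p - 2)" "(p - 2) * \<theta> = p / 2 + 1" using p by (auto simp: \<theta>_def field_simps)
  have mS: "\<mu> / p * M powr (p - 2) = 2 * \<theta> * S"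
  proof -
    have "\<mu> / p * M powr (p - 2) * (p - 2) = (p + 2) * S"
      using \<mu> unfolding S_def by (simp only: mult.commute[of _ "p - 2"])
    then have "\<mu> / p * M powr (p - 2) = (p + 2) * S / (p - 2)"
      using p by (subst nonzero_eq_divide_eq) auto
    then show ?thesis unfolding \<theta>(2) by simp
  qed
  have "- (6 - p) / (p - 2) * S \<le> A * K powr (p / 2 + 1) - \<mu> / p * K powr (p - 2)" if K: "K \<ge> 0" for K
  proof -
    define y where "y = (K / M) powr (p - 2)"
    have Kp: "K powr (p - 2) = M powr (p - 2) * y" using K M by (simp add: y_def powr_divide)
    have "y powr \<theta> = (K / M) powr (p / 2 + 1)" unfolding y_def powr_powr \<theta>(3) ..
    then have "K powr (p / 2 + 1) = M powr (p / 2 + 1) * y powr \<theta>" using K M by (simp add: powr_divide)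
    then have AK: "A * K powr (p / 2 + 1) = 2 * S * y powr \<theta>" by (simp add: S_def calib_M[OF M])
    have "1 + \<theta> * (y - 1) \<le> y powr \<theta>" by (rule Bernoulli_powr) (use \<theta> in \<open>auto simp: y_def\<close>)
    then have "2 * S * (1 + \<theta> * (y - 1)) \<le> 2 * S * y powr \<theta>" using S by (intro mult_left_mono) auto
    moreover have muK: "\<mu> / p * K powr (p - 2) = 2 * \<theta> * S * y" unfolding Kp mS[symmetric] by simp
    moreover have "2 * S * (1 + \<theta> * (y - 1)) - 2 * \<theta> * S * y = (2 - 2 * \<theta>) * S" by (simp add: algebra_simps)
    moreover have \<theta>4: "2 - 2 * \<theta> = - (6 - p) / (p - 2)" unfolding \<theta>(2) using p by (simp add: field_simps)
    ultimately have "(2 - 2 * \<theta>) * S \<le> 2 * S * y powr \<theta> - 2 * \<theta> * S * y" by linarith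
    then show ?thesis unfolding AK muK \<theta>4 .
  qed
  then show ?thesis unfolding infinity_bound_def A_def[symmetric] S_def by blast
qed

text \<open>Degree 2 lets two half solitons form a whole one. Subtracting
  \<open>\<delta> = sol M l\<close> makes each half vanish at distance \<open>l\<close>, keeps its
  derivative and lowers its mass; the losses are the missing tail \<open>calib p M \<delta>\<close>
  and a term linear in \<open>\<delta>\<close> in the potential. \<open>gain\<close> says that the
  vertex term outweighs both.\<close>

lemma soliton_competitor:
  assumes v: "v \<in> verts G" "vertex_degree G v = 2" and l: "l > 0" "\<And>e. e \<in> edges G \<Longrightarrow> ereal (2 * l) < len G e"
    and M: "M > 0" and \<mu>: "\<mu> > 0" "(p - 2) * (\<mu> / p * M powr (p - 2)) = (p + 2) * calib p M M"
    and gain: "(6 - p) / (p - 2) * calib p M (sol M l) + 2 * sol M l * M powr (p - 1) * l < (M - sol M l) powr q / q"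
  shows "\<exists>w\<in>H1_mass G \<mu>. energy p q G w < - (6 - p) / (p - 2) * calib p M M"
proof -
  define \<delta> where "\<delta> = sol M l"
  define e where "e = - (6 - p) / (p - 2) * calib p M M"
  have \<delta>: "0 < \<delta>" "\<delta> \<le> M" using sol_pos[OF M] sol_le[OF M] by (auto simp: \<delta>_def)
  define \<psi> where "\<psi> x = sol M (min x l) - \<delta>" for x
  define \<psi>' where "\<psi>' x = (if x \<le> l then sol' M x else 0)" for x
  have \<psi>l: "\<psi> x = sol M x - \<delta>" "\<psi>' x = sol' M x" if "x \<in> {0..l}" for x using that by (auto simp: \<psi>_def \<psi>'_def min_def)
  have \<psi>0: "0 \<le> sol M x - \<delta>" if "x \<in> {0..l}" for x using sol_antimono[OF M, of x l] that by (auto simp: \<delta>_def)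
  have z: "\<And>x. x \<ge> l \<Longrightarrow> \<psi> x = 0" "\<And>x. x > l \<Longrightarrow> \<psi>' x = 0" by (auto simp: \<psi>_def \<psi>'_def \<delta>_def min_def)
  have ci: "set_integrable lborel {0..l} k" if "continuous_on {0..l} k" for k :: "real \<Rightarrow> real"
    unfolding set_integrable_def using that by (intro borel_integrable_compact) auto
  have acs: "ac_deriv UNIV (sol M) (sol' M)"
    by (intro ac_deriv_C1 has_field_derivative_at_within[OF sol_has_derivative] sol_cont) auto
  have "ac_deriv {0..} \<psi> \<psi>'"
    unfolding ac_deriv_def
  proof (intro ballI impI)
    fix x y :: real assume xy: "x \<in> {0..}" "y \<in> {0..}" "x \<le> y"
    show "set_integrable lborel {x..y} \<psi>' \<and> \<psi> y - \<psi> x = (LINT t:{x..y}|lborel. \<psi>' t)"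
    proof (cases "x \<le> l")
      case True
      have ind: "indicat_real {x..y} t *\<^sub>R \<psi>' t = indicat_real {x..min y l} t *\<^sub>R sol' M t" for t
        by (auto simp: indicator_def \<psi>'_def)
      have "x \<le> min y l" using True xy by simp
      from ac_derivD[OF acs _ _ this] True show ?thesis
        unfolding set_integrable_def set_lebesgue_integral_def ind by (simp add: \<psi>_def min_def)
    next
      case False
      then have ind: "indicat_real {x..y} t *\<^sub>R \<psi>' t = 0" for t by (auto simp: indicator_def \<psi>'_def)
      show ?thesis using False xy z(1)[of x] z(1)[of y] unfolding set_integrable_def set_lebesgue_integral_def ind by simp
    qed
  qed
  moreover have "set_borel_measurable lborel {0..} \<psi>'"
  proof -
    have ind: "indicat_real {0..} t *\<^sub>R \<psi>' t = indicat_real {0..l} t *\<^sub>R sol' M t" for t by (auto simp: indicator_def \<psi>'_def)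
    show ?thesis unfolding set_borel_measurable_def ind
      using set_borel_measurable_cont[OF sol_cont(2), of "{0..l}" M] by (simp add: set_borel_measurable_def)
  qed
  moreover have "set_integrable lborel {0..} (\<lambda>x. (\<psi>' x)\<^sup>2)"
  proof (subst LINT_zero_outside(2)[of l])
    show "set_integrable lborel {0..l} (\<lambda>x. (\<psi>' x)\<^sup>2)"
      by (subst set_integrable_cong[OF refl refl, of _ _ "\<lambda>x. (sol' M x)\<^sup>2"]) (auto simp: \<psi>l intro!: ci continuous_intros sol_cont)
  qed (use z in auto)
  moreover have "set_integrable lborel {0..} (\<lambda>x. (\<psi> x)\<^sup>2)"
  proof (subst LINT_zero_outside(2)[of l])
    show "set_integrable lborel {0..l} (\<lambda>x. (\<psi> x)\<^sup>2)"
      by (subst set_integrable_cong[OF refl refl, of _ _ "\<lambda>x. (sol M x - \<delta>)\<^sup>2"]) (auto simp: \<psi>l intro!: ci continuous_intros sol_cont)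
  qed (use z in auto)
  ultimately have H: "H1_on {0..} \<psi> \<psi>'" by (simp add: H1_on_def)
  obtain u where u: "u \<in> H1 G" "mass u = 2 * (LINT x:{0..l}|lborel. (\<psi> x)\<^sup>2)"
    "kin u = 2 * (LINT x:{0..l}|lborel. (\<psi>' x)\<^sup>2)"
    "pot u = 2 * (LINT x:{0..l}|lborel. \<bar>\<psi> x\<bar> powr p)" "u (Vertex v) = \<psi> 0"
    by (rule spike_competitor[OF v(1) l(1) _ H z]) (use l(2) v(2) in auto)
  define T where "T = (LINT x:{0..l}|lborel. (sol' M x)\<^sup>2)"
  define m where "m = (LINT x:{0..l}|lborel. (sol M x)\<^sup>2)"
  define P where "P = (LINT x:{0..l}|lborel. sol M x powr p)"
  define \<beta> where "\<beta> = sol M l * sol' M l"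
  have l0: "l \<ge> 0" using l by simp
  note S = sol_integrals[OF M l0, folded T_def m_def P_def \<beta>_def \<delta>_def]
  have kin: "kin u = 2 * T"
    unfolding u(3) T_def using \<psi>l(2) by (intro arg_cong[where f="\<lambda>x. 2 * x"] set_lebesgue_integral_cong) auto
  \<comment> \<open>By the relation between \<open>M\<close> and \<open>\<mu>\<close>, the bound of
    \<open>sol_mass_le\<close> for a half soliton is exactly \<open>\<mu> / 2\<close>.\<close>
  have mass: "mass u \<le> \<mu>"
  proof -
    have "(LINT x:{0..l}|lborel. (\<psi> x)\<^sup>2) = (LINT x:{0..l}|lborel. (sol M x - \<delta>)\<^sup>2)"
      using \<psi>l(1) by (intro set_lebesgue_integral_cong) auto
    also have "\<dots> \<le> m" unfolding m_def
    proof (rule set_integral_mono)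
      fix x assume "x \<in> {0..l}"
      then show "(sol M x - \<delta>)\<^sup>2 \<le> (sol M x)\<^sup>2" using \<psi>0 \<delta> by (intro power_mono) auto
    qed (auto intro!: ci continuous_intros sol_cont)
    finally have "mass u \<le> 2 * m" using u(2) by simp
    also have "2 * m \<le> \<mu>"
    proof -
      have "(p - 2) * ((\<omega> M)\<^sup>2 * m) \<le> (p - 2) * (\<mu> / p * M powr (p - 2))"
        using sol_mass_le[OF M l0] \<mu>(2) by (simp add: m_def)
      moreover have "0 < p - 2" using p by simp
      ultimately have "(\<omega> M)\<^sup>2 * m \<le> \<mu> / p * M powr (p - 2)" by (simp only: mult_le_cancel_left_pos)
      then have "M powr (p - 2) / p * (2 * m) \<le> M powr (p - 2) / p * \<mu>" unfolding \<omega>_square[OF M] by (simp add: mult_ac)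
      then show ?thesis using M p by (simp add: divide_simps)
    qed
    finally show ?thesis .
  qed
  have "P - p * \<delta> * M powr (p - 1) * l \<le> (LINT x:{0..l}|lborel. \<bar>\<psi> x\<bar> powr p)"
  proof -
    have i1: "set_integrable lborel {0..l} (\<lambda>x. sol M x powr p)"
      using sol_pos[OF M] by (auto intro!: ci continuous_intros sol_cont simp: less_imp_neq[THEN not_sym])
    have i2: "set_integrable lborel {0..l} (\<lambda>x. \<bar>sol M x - \<delta>\<bar> powr p)"
      using p by (intro ci continuous_on_powr' continuous_intros sol_cont) auto
    have "P - p * \<delta> * M powr (p - 1) * l = (LINT x:{0..l}|lborel. sol M x powr p - p * \<delta> * M powr (p - 1))"
    proof -
      have "(LINT x:{0..l}|lborel. sol M x powr p - k) = P - k * l" for k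
        using set_integral_diff(2)[OF i1 set_integrable_const_Icc[of 0 l k]] LINT_const_Icc[OF l0, of k]
        by (simp add: P_def mult.commute)
      then show ?thesis by simp
    qed
    also have "\<dots> \<le> (LINT x:{0..l}|lborel. \<bar>sol M x - \<delta>\<bar> powr p)"
    proof (rule set_integral_mono)
      fix x assume x: "x \<in> {0..l}"
      let ?s = "sol M x"
      have s: "0 < ?s" "\<delta> \<le> ?s" "?s \<le> M" using sol_pos[OF M] \<psi>0[OF x] sol_le[OF M] by auto
      \<comment> \<open>Bernoulli's inequality at this \<open>y\<close> linearizes the lowered
        power: subtracting \<open>\<delta>\<close> costs at most
        \<open>p * \<delta> * ?s powr (p - 1)\<close>.\<close>
      define y where "y = 1 - \<delta> / ?s"
      have y: "0 \<le> y" "?s - \<delta> = ?s * y" using s by (auto simp: y_def field_simps)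
      have "?s powr p * (1 + p * (y - 1)) \<le> ?s powr p * y powr p"
        using Bernoulli_powr[OF y(1), of p] p by (intro mult_left_mono) auto
      also have "?s powr p * y powr p = \<bar>?s - \<delta>\<bar> powr p" unfolding y(2) using s y(1) by (simp add: powr_mult)
      also have "?s powr p * (1 + p * (y - 1)) = ?s powr p - p * \<delta> * (?s powr p / ?s)"
        using s by (simp add: y_def field_simps)
      also have "?s powr p / ?s = ?s powr (p - 1)" using s by (simp add: powr_diff)
      finally have 1: "?s powr p - p * \<delta> * ?s powr (p - 1) \<le> \<bar>?s - \<delta>\<bar> powr p" .
      have "p * \<delta> * ?s powr (p - 1) \<le> p * \<delta> * M powr (p - 1)"
        using s p \<delta> by (intro mult_left_mono powr_mono2) auto
      with 1 show "?s powr p - p * \<delta> * M powr (p - 1) \<le> \<bar>?s - \<delta>\<bar> powr p" by simp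
    qed (use i1 i2 set_integrable_const_Icc in \<open>auto intro!: set_integral_diff\<close>)
    also have "\<dots> = (LINT x:{0..l}|lborel. \<bar>\<psi> x\<bar> powr p)"
      using \<psi>l(1) by (intro set_lebesgue_integral_cong) auto
    finally show ?thesis .
  qed
  then have "2 / p * (P - p * \<delta> * M powr (p - 1) * l) \<le> 2 / p * (LINT x:{0..l}|lborel. \<bar>\<psi> x\<bar> powr p)"
    using p by (intro mult_left_mono) auto
  moreover have "2 / p * (P - p * \<delta> * M powr (p - 1) * l) = 2 / p * P - 2 * \<delta> * M powr (p - 1) * l"
    using p by (simp add: field_simps)
  ultimately have pot: "2 / p * P - 2 * \<delta> * M powr (p - 1) * l \<le> 1 / p * pot u" unfolding u(4) by simp
  have "(M - \<delta>) powr q \<le> vpot u"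
  proof -
    have "\<bar>u (Vertex v)\<bar> powr q \<le> vpot u" unfolding vpot_def using fin(2) v(1) by (intro member_le_sum) auto
    then show ?thesis using u(5) \<psi>l(1)[of 0] l0 \<delta> by (simp add: sol_0)
  qed
  then have vpot: "(M - \<delta>) powr q / q \<le> 1 / q * vpot u" using q by (simp add: divide_right_mono)
  \<comment> \<open>Dropping the boundary term \<open>\<beta> \<le> 0\<close> leaves
    \<open>- (6 - p) / (p - 2) * T\<close>, and \<open>T\<close> is the drop of \<open>calib\<close>
    from \<open>M\<close> to \<open>\<delta>\<close>.\<close>
  have "T - 2 / p * P \<le> e + (6 - p) / (p - 2) * calib p M \<delta>"
  proof -
    have "2 / p * P = 2 * (2 * T - \<beta>) / (p - 2)" using S(2) p by (simp add: field_simps)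
    also have "\<dots> \<ge> 4 * T / (p - 2)" using S(4) p by (intro divide_right_mono) auto
    finally have "T - 2 / p * P \<le> T - 4 * T / (p - 2)" by simp
    also have "\<dots> = - (6 - p) / (p - 2) * T" using p by (simp add: field_simps)
    finally have "T - 2 / p * P \<le> - (6 - p) / (p - 2) * T" .
    have "- w / d * (a - b) = - w / d * a + w / d * b" for w d a b :: real by (simp add: right_diff_distrib)
    from this[of "6 - p" "p - 2"] have "- (6 - p) / (p - 2) * T = e + (6 - p) / (p - 2) * calib p M \<delta>"
      unfolding S(1) e_def .
    with \<open>T - 2 / p * P \<le> - (6 - p) / (p - 2) * T\<close> show ?thesis by simp
  qed
  then have eu: "energy p q G u < e" unfolding energy_eq kin using pot vpot gain[folded \<delta>_def] by argo
  have "e \<le> 0" unfolding e_def using p calib_nonneg[OF M, of M] M     by (intro mult_nonpos_nonneg divide_nonpos_pos) auto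
  \<comment> \<open>Rescaling needs positive mass: mass 0 would make the energy nonnegative, while
    it lies below \<open>e \<le> 0\<close>.\<close>
  have mu0: "mass u > 0"
  proof (rule ccontr)
    assume "\<not> mass u > 0"
    then have "mass u = 0" using nonneg(1)[of u] by simp
    then show False using energy_ge_of_mass_0[OF u(1)] eu \<open>e \<le> 0\<close> by simp
  qed
  \<comment> \<open>Filling the mass up to \<open>\<mu>\<close> by a factor at least 1 can only
    lower an energy that is already negative.\<close>
  define c where "c = sqrt (\<mu> / mass u)"
  have c: "c \<ge> 1" "c\<^sup>2 = \<mu> / mass u" "c\<^sup>2 \<ge> 1" using mu0 mass \<mu>(1) by (auto simp: c_def)
  have "(\<lambda>P. c * u P) \<in> H1_mass G \<mu>" using scaled(1,2)[OF u(1), of c] c mu0 by (simp add: H1_mass_iff)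
  moreover have "c\<^sup>2 * energy p q G u \<le> 1 * energy p q G u"
    using c(3) eu \<open>e \<le> 0\<close> by (intro mult_right_mono_neg) auto
  then have "energy p q G (\<lambda>P. c * u P) < e" using energy_scaled_le[OF u(1) c(1)] eu by simp
  ultimately show ?thesis unfolding e_def by blast
qed

text \<open>The value \<open>sol M l\<close> decays like an exponential of
  \<open>- M powr ((p - 2) / 2)\<close>, which beats every power of \<open>M\<close>. The left side
  therefore tends to 0, while the right side eventually exceeds the fixed number
  \<open>(1 / 2) powr q / q\<close>.\<close>

lemma soliton_gain:
  assumes l: "l > 0"
  shows "\<forall>\<^sub>F M in at_top. (6 - p) / (p - 2) * calib p M (sol M l) + 2 * sol M l * M powr (p - 1) * l < (M - sol M l) powr q / q"
proof -
  define C where "C = 2 powr (2 / (p - 2))"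
  define a where "a = sqrt (2 / p) * l"
  define K where "K = (6 - p) / (p - 2) * sqrt (2 / p) / 2"
  have a: "a > 0" and K: "K > 0" using l p by (auto simp: a_def K_def)
  \<comment> \<open>A common majorant of \<open>\<delta>\<close>,
    \<open>\<delta> * M powr (p / 2 - 1)\<close> and \<open>\<delta> * M powr (p - 1)\<close> for
    \<open>M \<ge> 1\<close>, where \<open>\<delta> = sol M l\<close>.\<close>
  define \<eta> where "\<eta> M = C * (M powr p * exp (- a * M powr ((p - 2) / 2)))" for M
  have t: "(p - 2) / 2 > 0" using p by simp
  have "((\<lambda>M. M powr p * exp (- a * M powr ((p - 2) / 2))) \<longlongrightarrow> 0) at_top"
    using a t by real_asymp
  then have "(\<eta> \<longlongrightarrow> C * 0) at_top" unfolding \<eta>_def[abs_def] by (intro tendsto_intros)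
  then have \<eta>: "(\<eta> \<longlongrightarrow> 0) at_top" by simp
  have "((\<lambda>M. K * (\<eta> M)\<^sup>2 + 2 * l * \<eta> M) \<longlongrightarrow> K * 0\<^sup>2 + 2 * l * 0) at_top" by (intro tendsto_intros \<eta>)
  then have "((\<lambda>M. K * (\<eta> M)\<^sup>2 + 2 * l * \<eta> M) \<longlongrightarrow> 0) at_top" by simp
  moreover have "(1 / 2) powr q / q > 0" using q by simp
  ultimately have "\<forall>\<^sub>F M in at_top. K * (\<eta> M)\<^sup>2 + 2 * l * \<eta> M < (1 / 2) powr q / q" by (rule order_tendstoD(2))
  moreover have "\<forall>\<^sub>F M in at_top. \<eta> M < 1 / 2" by (rule order_tendstoD(2)[OF \<eta>]) simp
  ultimately show ?thesis using eventually_ge_at_top[of "1 :: real"]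
  proof eventually_elim
    fix M assume e1: "K * (\<eta> M)\<^sup>2 + 2 * l * \<eta> M < (1 / 2) powr q / q" and e2: "\<eta> M < 1 / 2" and M1: "1 \<le> M"
    then have M: "M > 0" by simp
    define \<delta> where "\<delta> = sol M l"
    have \<delta>: "\<delta> > 0" unfolding \<delta>_def by (rule sol_pos[OF M])
    have "\<delta> * M powr (p - 1) \<le> (C * M * exp (- (\<omega> M * l))) * M powr (p - 1)"
      unfolding \<delta>_def C_def by (intro mult_right_mono sol_decay[OF M]) auto
    also have "\<dots> = C * ((M powr 1 * M powr (p - 1)) * exp (- (\<omega> M * l)))" using M by simp
    also have "M powr 1 * M powr (p - 1) = M powr p" unfolding powr_add[symmetric] by simp
    also have "\<omega> M * l = a * M powr ((p - 2) / 2)" by (simp add: \<omega>_def a_def)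
    finally have d1: "\<delta> * M powr (p - 1) \<le> \<eta> M" by (simp add: \<eta>_def)
    have "1 \<le> M powr (p - 1)" using M1 p by (intro ge_one_powr_ge_zero) auto
    then have "\<delta> * 1 \<le> \<delta> * M powr (p - 1)" using \<delta> by (intro mult_left_mono) auto
    then have d2: "\<delta> \<le> \<eta> M" using d1 by simp
    have "M powr (p / 2 - 1) \<le> M powr (p - 1)" using M1 p by (intro powr_mono) auto
    then have "\<delta> * M powr (p / 2 - 1) \<le> \<delta> * M powr (p - 1)" using \<delta> by (intro mult_left_mono) auto
    then have d3: "\<delta> * M powr (p / 2 - 1) \<le> \<eta> M" using d1 by simp
    have "(6 - p) / (p - 2) * calib p M \<delta> \<le> (6 - p) / (p - 2) * (sqrt (2 / p) * M powr (p / 2 - 1) * \<delta>\<^sup>2 / 2)"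
      using calib_abs_le[OF p(1) M, of \<delta>] p by (intro mult_left_mono) auto
    also have "\<dots> = K * ((\<delta> * M powr (p / 2 - 1)) * \<delta>)" by (simp add: K_def power2_eq_square)
    also have "\<dots> \<le> K * (\<eta> M * \<eta> M)" using K d2 d3 \<delta> by (intro mult_left_mono mult_mono) auto
    finally have 1: "(6 - p) / (p - 2) * calib p M \<delta> \<le> K * (\<eta> M)\<^sup>2" by (simp add: power2_eq_square)
    have "2 * l * (\<delta> * M powr (p - 1)) \<le> 2 * l * \<eta> M" using l d1 by (intro mult_left_mono) auto
    then have 2: "2 * \<delta> * M powr (p - 1) * l \<le> 2 * l * \<eta> M" by (simp add: mult_ac)
    have "(1 / 2) powr q \<le> (M - \<delta>) powr q" using M1 d2 e2 q by (intro powr_mono2) auto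
    then have "(1 / 2) powr q / q \<le> (M - \<delta>) powr q / q" using q by (intro divide_right_mono) auto
    then show "(6 - p) / (p - 2) * calib p M (sol M l) + 2 * sol M l * M powr (p - 1) * l < (M - sol M l) powr q / q"
      unfolding \<delta>_def[symmetric] using 1 2 e1 by linarith
  qed
qed

lemma ground_state_large_mass:
  assumes v: "v \<in> verts G" "vertex_degree G v = 2"
  shows "\<exists>\<mu>0>0. \<forall>\<mu>\<ge>\<mu>0. \<exists>u. ground_state p q G \<mu> u"
proof -
  obtain l0 where l0: "l0 > 0" "\<And>e. e \<in> edges G \<Longrightarrow> ereal (2 * l0) \<le> len G e" using min_len by blast
  \<comment> \<open>Halving turns the weak length bound into the strict one that keeps the spikes on
    an edge apart.\<close>
  define l where "l = l0 / 2"
  have l: "l > 0" using l0 by (simp add: l_def)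
  have l2: "ereal (2 * l) < len G e" if "e \<in> edges G" for e
  proof -
    have "ereal (2 * l) < ereal (2 * l0)" using l0 by (simp add: l_def)
    also have "\<dots> \<le> len G e" by (rule l0(2)[OF that])
    finally show ?thesis .
  qed
  obtain M0 where M0: "\<And>M. M \<ge> M0 \<Longrightarrow>
      (6 - p) / (p - 2) * calib p M (sol M l) + 2 * sol M l * M powr (p - 1) * l < (M - sol M l) powr q / q"
    using soliton_gain[OF l] unfolding eventually_at_top_linorder by blast
  \<comment> \<open>The relation between mass and height of the soliton reads
    \<open>M powr ((6 - p) / 2) = \<gamma> * \<mu>\<close> with this constant. As
    \<open>p < 6\<close>, large mass means large height, and \<open>\<mu>0\<close> is the mass of
    height \<open>max 1 M0\<close>.\<close>
  define \<gamma> where "\<gamma> = 2 * (p - 2) / (p * A * (p + 2))"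
  have \<gamma>: "\<gamma> > 0" using A_pos p by (simp add: \<gamma>_def)
  define \<mu>0 where "\<mu>0 = (max 1 M0) powr ((6 - p) / 2) / \<gamma>"
  have \<mu>0: "\<mu>0 > 0" using \<gamma> by (simp add: \<mu>0_def)
  have "\<exists>u. ground_state p q G \<mu> u" if \<mu>: "\<mu> \<ge> \<mu>0" for \<mu>
  proof -
    have \<mu>pos: "\<mu> > 0" using \<mu> \<mu>0 by simp
    define M where "M = (\<gamma> * \<mu>) powr (2 / (6 - p))"
    have M: "M > 0" using \<gamma> \<mu>pos by (simp add: M_def)
    have "(max 1 M0) powr ((6 - p) / 2) \<le> \<gamma> * \<mu>" using \<mu> \<gamma> by (simp add: \<mu>0_def field_simps)
    then have "((max 1 M0) powr ((6 - p) / 2)) powr (2 / (6 - p)) \<le> M"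
      unfolding M_def using p by (intro powr_mono2) auto
    moreover have inv: "2 / (6 - p) * ((6 - p) / 2) = 1" using p by simp
    ultimately have "M \<ge> M0" unfolding powr_powr mult.commute[of "(6 - p) / 2"] inv by simp
    from inv have "M powr ((6 - p) / 2) = (\<gamma> * \<mu>) powr 1" unfolding M_def powr_powr by (rule arg_cong)
    then have Mp: "M powr ((6 - p) / 2) = \<gamma> * \<mu>" using \<gamma> \<mu>pos by simp
    have "(6 - p) / 2 + (p - 2) = p / 2 + 1" by (simp add: field_simps)
    then have "M powr (p / 2 + 1) = \<gamma> * \<mu> * M powr (p - 2)" by (metis Mp powr_add)
    then have "(p + 2) * calib p M M = (p + 2) * A / 2 * \<gamma> * (\<mu> * M powr (p - 2))" by (simp add: calib_M[OF M])
    also have "(p + 2) * A / 2 * \<gamma> = (p - 2) / p"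
    proof -
      have "(p + 2) * A / 2 * (2 * d / (p * A * (p + 2))) = d / p" for d using A_pos p by simp
      then show ?thesis unfolding \<gamma>_def .
    qed
    finally have crit: "(p - 2) * (\<mu> / p * M powr (p - 2)) = (p + 2) * calib p M M" by simp
    obtain w where "w \<in> H1_mass G \<mu>" "energy p q G w < - (6 - p) / (p - 2) * calib p M M"
      using soliton_competitor[OF v l l2 M \<mu>pos crit M0[OF \<open>M \<ge> M0\<close>]] by blast
    from ground_state_exists[OF \<mu>pos this infinity_bound_soliton[OF M crit]] show ?thesis .
  qed
  with \<mu>0 show ?thesis by blast
qed

end

theorem corollary1p4:
  fixes G :: "('v, 'e) metric_graph" and p q :: real
  assumes "2 < p" and "p < 6" and "2 < q" and "q < 4" and "q < p / 2 + 1"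
    and "is_metric_graph G" and "noncompact G"
    and "card (half_lines G) \<ge> 3"
    and "\<exists>v\<in>verts G. vertex_degree G v = 2"
    and "\<forall>x\<in>points G. \<exists>T. trail G T \<and> x \<in> trail_points G T \<and> contains_two_half_lines G T"
  shows "\<exists>\<mu>_low > 0. \<exists>\<mu>_high > 0. \<forall>\<mu> > 0.
           \<mu> < \<mu>_low \<or> \<mu> \<ge> \<mu>_high \<longrightarrow> (\<exists>u. ground_state p q G \<mu> u)"
proof -
  interpret nls_graph G p q by unfold_locales (use assms in auto)
  obtain \<mu>1 where "\<mu>1 > 0" "\<forall>\<mu>>0. \<mu> < \<mu>1 \<longrightarrow> (\<exists>u. ground_state p q G \<mu> u)"
    using ground_state_small_mass[OF assms(5)] by blast
  moreover obtain \<mu>2 where "\<mu>2 > 0" "\<forall>\<mu>\<ge>\<mu>2. \<exists>u. ground_state p q G \<mu> u"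
    using assms(9) ground_state_large_mass by blast
  ultimately show ?thesis by blast
qed

end
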